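(* Let $n\ge 2$ be an integer, let $k,j\ge 0$ be integers, and let $\mathbf{q}=(q_1,\ldots,q_k)$ and $\mathbf{u}=(u_1,\ldots,u_j)$. The $\mathbf{q},\mathbf{u}$-graded Hilbert series of the dihedral coinvariant ring $R^{(k,j)}_{\mathfrak{I}_2(n)}$ is $$\mathrm{Hilb}(R_{\mathfrak{I}_{2}(n)}^{(k,j)}; \mathbf{q};\mathbf{u}) = 1 + s_{(1,1)}(\mathbf{q}/\mathbf{u}) + s_{(n)}(\mathbf{q}/\mathbf{u}) + 2\sum_{i=1}^{n-1} s_{(i)}(\mathbf{q}/\mathbf{u}).$$
   Context: **The group.** $\mathfrak{I}_2(n)$ is the dihedral group of order $2n$, realized inside $\mathrm{GL}_2(\mathbb{C})$ as generated by $$\rho=\begin{bmatrix}\cos\frac{2\pi}{n}&-\sin\frac{2\pi}{n}\\ \sin\frac{2\pi}{n}&\cos\frac{2\pi}{n}\end{bmatrix},\qquad \phi=\begin{bmatrix}1&0\\0&-1\end{bmatrix}.$$ **The ring.** Let $S=\mathbb{C}[\boldsymbol{x}^{(1)},\ldots,\boldsymbol{x}^{(k)},\boldsymbol{\theta}^{(1)},\ldots,\boldsymbol{\theta}^{(j)}]$ be the $\mathbb{C}$-algebra generated by commuting (bosonic) variables $x_1^{(a)},x_2^{(a)}$ ($1\le a\le k$) and anticommuting (fermionic) variables $\theta_1^{(b)},\theta_2^{(b)}$ ($1\le b\le j$). The bosonic variables commute with all variables; the fermionic variables anticommute with each other, and in particular square to zero. The group $\mathfrak{I}_2(n)$ acts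 diagonally on $S$ by algebra automorphisms: each $g$ acts on each pair $(x_1^{(a)},x_2^{(a)})$ and each pair $(\theta_1^{(b)},\theta_2^{(b)})$ as a basis of $\mathbb{C}^2$ through the $2\times2$ matrix of $g$, i.e. $g\cdot v_s=\sum_r g_{rs}v_r$. Let $I^{(k,j)}_{\mathfrak{I}_2(n)}$ be the ideal of $S$ generated by all $\mathfrak{I}_2(n)$-invariant elements with zero constant term, and let $R^{(k,j)}_{\mathfrak{I}_2(n)}=S/I^{(k,j)}_{\mathfrak{I}_2(n)}$. **Grading and Hilbert series.** $S$ and $R^{(k,j)}_{\mathfrak{I}_2(n)}$ are multigraded by $(\mathbf{a},\mathbf{b})\in\mathbb{Z}_{\ge0}^k\times\mathbb{Z}_{\ge0}^j$, where $a_r$ is the total degree in $x_1^{(r)},x_2^{(r)}$ and $b_r$ is the total degree in $\theta_1^{(r)},\theta_2^{(r)}$. Define $$\mathrm{Hilb}(R;\mathbf{q};\mathbf{u})=\sum_{\mathbf{a},\mathbf{b}}q_1^{a_1}\cdots q_k^{a_k}u_1^{b_1}\cdots u_j^{b_j}\,\dim_{\mathbb{C}}(R_{\mathbf{a},\mathbf{b}}).$$ **Super Schur functions.** For a partition $\lambda$, $$s_\lambda(\mathbf{q}/\mathbf{u})=\sum_{\nu\subseteq\lambda}s_\nu(\mathbf{q})\,s_{\lambda'/\nu'}(\mathbf{u}),$$ where $\lambda'$ is the transpose of $\lambda$, and $s_\nu$, $s_{\lambda'/\nu'}$ are ordinary Schur and skew Schur polynomials (in an empty set of variables, a Schur polynomial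 is $1$ for the empty shape and $0$ otherwise). In particular $s_{(m)}(\mathbf{q}/\mathbf{u})=\sum_{i=0}^m s_{(m-i)}(\mathbf{q})s_{(1^i)}(\mathbf{u})$, with $(0)$ meaning the empty partition. *)

theory Defs
  imports
    "HOL-Analysis.Analysis"
    "HOL-Algebra.Generated_Groups"
    "HOL-Algebra.QuotRing"
    "HOL-Algebra.Embedded_Algebras"
    "HOL-Library.Poly_Mapping"
begin

section \<open>The dihedral group\<close>

definition GL2 :: "(complex^2^2) monoid" where
  "GL2 = \<lparr>carrier = {A. invertible A}, mult = (**), one = mat 1\<rparr>"

definition rotation_mat :: "nat \<Rightarrow> complex^2^2" where
  "rotation_mat n = vector [vector [cos (2 * of_real pi / of_nat n), - sin (2 * of_real pi / of_nat n)],
                            vector [sin (2 * of_real pi / of_nat n),   cos (2 * of_real pi / of_nat n)]]"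

definition reflection_mat :: "complex^2^2" where
  "reflection_mat = vector [vector [1, 0], vector [0, -1]]"

definition dihedral :: "nat \<Rightarrow> (complex^2^2) set" where
  "dihedral n = generate GL2 {rotation_mat n, reflection_mat}"


section \<open>Superpolynomials\<close>

text \<open>
  The \<open>a\<close>-th bosonic pair is \<open>Bos a 1, Bos a 2\<close> and the \<open>b\<close>-th fermionic pair is
  \<open>Fer b 1, Fer b 2\<close>; the pairs are numbered from \<open>0\<close>. An exponent function \<open>m\<close> stands for the
  product of its variables in the order in which \<open>svars\<close> below lists them.
\<close>

datatype svar = Bos nat 2 | Fer nat 2

type_synonym smon = "svar \<Rightarrow>\<^sub>0 nat"
type_synonym spoly = "smon \<Rightarrow>\<^sub>0 complex"

definition svars :: "nat \<Rightarrow> nat \<Rightarrow> svar list" where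
  "svars k j = [Bos a s. a \<leftarrow> [0..<k], s \<leftarrow> [1, 2]] @ [Fer b s. b \<leftarrow> [0..<j], s \<leftarrow> [1, 2]]"

fun fer_before :: "svar \<Rightarrow> svar \<Rightarrow> bool" where
  "fer_before (Fer b s) (Fer b' s') \<longleftrightarrow> b < b' \<or> (b = b' \<and> s = 1 \<and> s' = 2)"
| "fer_before _ _ \<longleftrightarrow> False"

text \<open>
  The product of the monomials \<open>m\<close> and \<open>m'\<close> is \<open>smon_sign m m'\<close> times the monomial \<open>m + m'\<close>:
  it vanishes if a fermionic variable is repeated, and otherwise each pair of fermionic variables
  that has to be interchanged to sort the product contributes a factor \<open>-1\<close>.
\<close>

definition smon_sign :: "smon \<Rightarrow> smon \<Rightarrow> complex" where
  "smon_sign m m' =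
     (if \<exists>b s. Poly_Mapping.lookup m (Fer b s) + Poly_Mapping.lookup m' (Fer b s) \<ge> 2 then 0
      else (-1) ^ card {(v, w). v \<in> Poly_Mapping.keys m \<and> w \<in> Poly_Mapping.keys m' \<and>
                                fer_before w v})"

definition sprod :: "spoly \<Rightarrow> spoly \<Rightarrow> spoly" where
  "sprod p q = (\<Sum>m\<in>Poly_Mapping.keys p. \<Sum>m'\<in>Poly_Mapping.keys q.
     Poly_Mapping.single (m + m')
       (smon_sign m m' * Poly_Mapping.lookup p m * Poly_Mapping.lookup q m'))"

definition smonomials :: "nat \<Rightarrow> nat \<Rightarrow> smon set" where
  "smonomials k j = {m. Poly_Mapping.keys m \<subseteq> set (svars k j) \<and>
                        (\<forall>b s. Poly_Mapping.lookup m (Fer b s) \<le> 1)}"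

definition sconst :: "complex \<Rightarrow> spoly" where
  "sconst c = Poly_Mapping.single 0 c"

definition super_ring :: "nat \<Rightarrow> nat \<Rightarrow> spoly ring" where
  "super_ring k j = \<lparr>carrier = {p. Poly_Mapping.keys p \<subseteq> smonomials k j}, mult = sprod,
     one = sconst 1, zero = 0, add = (+)\<rparr>"

definition svar_poly :: "svar \<Rightarrow> spoly" where
  "svar_poly v = Poly_Mapping.single (Poly_Mapping.single v 1) 1"


section \<open>The diagonal action and the coinvariant ring\<close>

fun act_svar :: "complex^2^2 \<Rightarrow> svar \<Rightarrow> spoly" where
  "act_svar g (Bos a s) = (\<Sum>r\<in>UNIV. sprod (sconst (g $ r $ s)) (svar_poly (Bos a r)))"
| "act_svar g (Fer b s) = (\<Sum>r\<in>UNIV. sprod (sconst (g $ r $ s)) (svar_poly (Fer b r)))"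

text \<open>
  The extension of \<open>act_svar g\<close> to an algebra endomorphism: each variable in the ordered product
  of variables which a monomial stands for is replaced by its image.
\<close>

definition act_smon :: "nat \<Rightarrow> nat \<Rightarrow> complex^2^2 \<Rightarrow> smon \<Rightarrow> spoly" where
  "act_smon k j g m =
     foldr sprod
       (concat (map (\<lambda>v. replicate (Poly_Mapping.lookup m v) (act_svar g v)) (svars k j)))
       (sconst 1)"

definition act :: "nat \<Rightarrow> nat \<Rightarrow> complex^2^2 \<Rightarrow> spoly \<Rightarrow> spoly" where
  "act k j g p = (\<Sum>m\<in>Poly_Mapping.keys p.
     sprod (sconst (Poly_Mapping.lookup p m)) (act_smon k j g m))"

definition invariants :: "(complex^2^2) set \<Rightarrow> nat \<Rightarrow> nat \<Rightarrow> spoly set" where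
  "invariants G k j = {p \<in> carrier (super_ring k j). \<forall>g\<in>G. act k j g p = p}"

definition coinv_ideal :: "(complex^2^2) set \<Rightarrow> nat \<Rightarrow> nat \<Rightarrow> spoly set" where
  "coinv_ideal G k j =
     Idl\<^bsub>super_ring k j\<^esub> {p \<in> invariants G k j. Poly_Mapping.lookup p 0 = 0}"

definition coinv_ring :: "(complex^2^2) set \<Rightarrow> nat \<Rightarrow> nat \<Rightarrow> spoly set ring" where
  "coinv_ring G k j = super_ring k j Quot coinv_ideal G k j"


section \<open>Multigrading and Hilbert series\<close>

text \<open>
  A multidegree, and likewise a monomial in the variables \<open>q, u\<close> of the Hilbert series, is a
  finitely supported function: \<open>Inl a\<close> is the index of the \<open>a\<close>-th bosonic pair and of \<open>q\<close>
  number \<open>a\<close>, and \<open>Inr b\<close> is that of the \<open>b\<close>-th fermionic pair and of \<open>u\<close> number \<open>b\<close>.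
\<close>

type_synonym multideg = "(nat + nat) \<Rightarrow>\<^sub>0 nat"

fun svar_block :: "svar \<Rightarrow> nat + nat" where
  "svar_block (Bos a s) = Inl a"
| "svar_block (Fer b s) = Inr b"

definition smon_deg :: "smon \<Rightarrow> multideg" where
  "smon_deg m = (\<Sum>v\<in>Poly_Mapping.keys m.
     Poly_Mapping.single (svar_block v) (Poly_Mapping.lookup m v))"

definition super_component :: "nat \<Rightarrow> nat \<Rightarrow> multideg \<Rightarrow> spoly set" where
  "super_component k j d = {p \<in> carrier (super_ring k j). \<forall>m\<in>Poly_Mapping.keys p. smon_deg m = d}"

definition coinv_class :: "(complex^2^2) set \<Rightarrow> nat \<Rightarrow> nat \<Rightarrow> spoly \<Rightarrow> spoly set" where
  "coinv_class G k j p = coinv_ideal G k j +>\<^bsub>super_ring k j\<^esub> p"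

text \<open>
  The Hilbert series as a formal power series, given by its coefficient function. The dimension
  is taken over the copy of the complex numbers inside the coinvariant ring. Multidegrees
  involving indices outside the range of \<open>k, j\<close> have coefficient \<open>0\<close>, since the corresponding
  component is zero.
\<close>

definition coinv_hilb :: "(complex^2^2) set \<Rightarrow> nat \<Rightarrow> nat \<Rightarrow> multideg \<Rightarrow> int" where
  "coinv_hilb G k j d =
     int (ring.dim (coinv_ring G k j) (coinv_class G k j ` range sconst)
                   (coinv_class G k j ` super_component k j d))"


section \<open>Super Schur functions\<close>

text \<open>
  Partitions are weakly decreasing sequences of naturals that are eventually \<open>0\<close>; rows, columns
  and parts are numbered from \<open>0\<close>.
\<close>

definition is_partition :: "(nat \<Rightarrow> nat) \<Rightarrow> bool" where
  "is_partition lam \<longleftrightarrow> antimono lam \<and> finite {i. lam i \<noteq> 0}"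

definition part :: "nat list \<Rightarrow> nat \<Rightarrow> nat" where
  "part xs i = (if i < length xs then xs ! i else 0)"

definition conj_part :: "(nat \<Rightarrow> nat) \<Rightarrow> nat \<Rightarrow> nat" where
  "conj_part lam c = card {r. c < lam r}"

definition skew_cells :: "(nat \<Rightarrow> nat) \<Rightarrow> (nat \<Rightarrow> nat) \<Rightarrow> (nat \<times> nat) set" where
  "skew_cells lam mu = {(r, c). mu r \<le> c \<and> c < lam r}"

definition ssyt :: "(nat \<Rightarrow> nat) \<Rightarrow> (nat \<Rightarrow> nat) \<Rightarrow> nat \<Rightarrow> (nat \<times> nat \<Rightarrow> nat) set" where
  "ssyt lam mu N = {T \<in> skew_cells lam mu \<rightarrow>\<^sub>E {..<N}.
     (\<forall>r c c'. (r, c) \<in> skew_cells lam mu \<longrightarrow> (r, c') \<in> skew_cells lam mu \<longrightarrow>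
        c < c' \<longrightarrow> T (r, c) \<le> T (r, c')) \<and>
     (\<forall>r r' c. (r, c) \<in> skew_cells lam mu \<longrightarrow> (r', c) \<in> skew_cells lam mu \<longrightarrow>
        r < r' \<longrightarrow> T (r, c) < T (r', c))}"

definition skew_schur ::
  "(nat \<Rightarrow> nat) \<Rightarrow> (nat \<Rightarrow> nat) \<Rightarrow> nat \<Rightarrow> (nat \<Rightarrow> 'a::comm_ring_1) \<Rightarrow> 'a" where
  "skew_schur lam mu N x = (\<Sum>T\<in>ssyt lam mu N. \<Prod>c\<in>skew_cells lam mu. x (T c))"

definition schur :: "(nat \<Rightarrow> nat) \<Rightarrow> nat \<Rightarrow> (nat \<Rightarrow> 'a::comm_ring_1) \<Rightarrow> 'a" where
  "schur lam = skew_schur lam (\<lambda>_. 0)"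

definition super_schur ::
  "(nat \<Rightarrow> nat) \<Rightarrow> nat \<Rightarrow> (nat \<Rightarrow> 'a::comm_ring_1) \<Rightarrow> nat \<Rightarrow> (nat \<Rightarrow> 'a) \<Rightarrow> 'a" where
  "super_schur lam k q j u =
     (\<Sum>nu | is_partition nu \<and> nu \<le> lam.
        schur nu k q * skew_schur (conj_part lam) (conj_part nu) j u)"

definition qvar :: "nat \<Rightarrow> multideg \<Rightarrow>\<^sub>0 int" where
  "qvar a = Poly_Mapping.single (Poly_Mapping.single (Inl a) 1) 1"

definition uvar :: "nat \<Rightarrow> multideg \<Rightarrow>\<^sub>0 int" where
  "uvar b = Poly_Mapping.single (Poly_Mapping.single (Inr b) 1) 1"

definition super_schur_poly :: "nat \<Rightarrow> nat \<Rightarrow> nat list \<Rightarrow> multideg \<Rightarrow>\<^sub>0 int" where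
  "super_schur_poly k j lam = super_schur (part lam) k qvar j uvar"

end

theory Submission
  imports Defs
begin

text \<open>
  Over the complex numbers the dihedral group becomes monomial. In each pair of variables, bosonic or
  fermionic, pass to \<open>z = x\<^sub>1 + \<i> x\<^sub>2\<close> and \<open>w = x\<^sub>1 - \<i> x\<^sub>2\<close>: the rotation
  multiplies \<open>z\<close> by \<open>\<zeta>\<^sup>-\<^sup>1\<close> and \<open>w\<close> by \<open>\<zeta>\<close>, where
  \<open>\<zeta>\<close> is a primitive \<open>n\<close>-th root of unity, and the reflection exchanges \<open>z\<close> and \<open>w\<close>.
  With indices naming the pairs, two kinds of invariants matter:
  \<open>z\<^sub>\<alpha> w\<^sub>\<beta> + w\<^sub>\<alpha> z\<^sub>\<beta>\<close>, and the sum of a product of \<open>n\<close> variables \<open>z\<close>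
  and the corresponding product of variables \<open>w\<close>.

  By the first kind, moving the letter \<open>w\<close> from one factor to another changes the sign modulo the
  ideal. In a product \<open>z\<^sub>\<alpha> z\<^sub>\<beta> w\<^sub>\<gamma>\<close> this gives supersymmetry in the first two positions and
  super-antisymmetry in the last two, so that the product vanishes
  (\<open>mixed_triple_in_ideal\<close>). Hence all mixed monomials of degree at least 3 lie in the ideal; and by
  the second kind, so do all monomials of degree greater than \<open>n\<close>
  (\<open>large_in_ideal\<close>). There remain the monomials purely in \<open>z\<close> or purely in \<open>w\<close> of degree less
  than \<open>n\<close>, those of degree \<open>n\<close>, where \<open>z\<close> and \<open>w\<close> are identified up to sign, and the
  products \<open>z\<^sub>\<alpha> w\<^sub>\<beta>\<close>, which are super-antisymmetric in \<open>\<alpha>\<close> and \<open>\<beta>\<close>.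

  There are no further relations. The elements whose coefficients obey the conditions just described
  form an ideal, \<open>model_ideal\<close>, because a proper divisor of one of the remaining monomials
  is pure of degree less than \<open>n\<close>; and this ideal contains every invariant without constant
  term (\<open>model_invariants_subset\<close>), as an invariant of the rotation only involves monomials
  in which the numbers of letters \<open>z\<close> and \<open>w\<close> are congruent modulo \<open>n\<close>. So the model
  ideal is the coinvariant ideal in the new variables (\<open>coinv_ideal_dihedral\<close>), and the
  remaining monomials, with one chosen from each identified pair, are a basis of the quotient
  (\<open>coinv_hilb_eq_card\<close>).

  A pure monomial of degree \<open>i\<close> is a multiset of bosonic pairs together with a set of fermionic
  pairs, in other words a term of the super Schur function of a row of length \<open>i\<close>
  (\<open>super_schur_poly_row\<close>). This accounts for the summands \<open>1\<close>, \<open>s(n)\<close> and twice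
  \<open>s(i)\<close>; the mixed monomials contribute the column \<open>s(1,1)\<close>
  (\<open>super_schur_poly_column\<close>).
\<close>

abbreviation "lookup \<equiv> Poly_Mapping.lookup"
abbreviation "keys \<equiv> Poly_Mapping.keys"
abbreviation "single \<equiv> Poly_Mapping.single"

notation sprod (infixl \<open>\<star>\<close> 70)

section \<open>The algebra of superpolynomials\<close>

lemma poly_mapping_expansion:
  fixes p :: "'a \<Rightarrow>\<^sub>0 'b::comm_monoid_add"
  assumes "finite A" "keys p \<subseteq> A"
  shows "p = (\<Sum>m\<in>A. single m (lookup p m))"
proof (rule poly_mapping_eqI)
  fix x
  have "lookup (\<Sum>m\<in>A. single m (lookup p m)) x = (\<Sum>m\<in>A. lookup p m when m = x)"
    by (simp add: lookup_sum lookup_single)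
  also have "\<dots> = (\<Sum>m\<in>A. if m = x then lookup p m else 0)"
    by (rule sum.cong) (auto simp: when_def)
  also have "\<dots> = (if x \<in> A then lookup p x else 0)"
    using assms by (simp add: sum.delta)
  also have "\<dots> = lookup p x"
    using assms(2) by (auto simp: in_keys_iff)
  finally show "lookup p x = lookup (\<Sum>m\<in>A. single m (lookup p m)) x" by simp
qed

lemma poly_mapping_keys_induct [consumes 1, case_names zero single add]:
  fixes p :: "'a \<Rightarrow>\<^sub>0 'b::comm_monoid_add"
  assumes "keys p \<subseteq> M"
    and zero: "P 0"
    and single: "\<And>m c. m \<in> M \<Longrightarrow> P (single m c)"
    and add: "\<And>p q. P p \<Longrightarrow> P q \<Longrightarrow> P (p + q)"
  shows "P p"
proof -
  have "P (\<Sum>m\<in>A. single m (lookup p m))" if "A \<subseteq> keys p" for A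
    using finite_subset[OF that finite_keys] that
    by (induction A rule: finite_induct) (use assms in auto)
  from this[of "keys p"] show ?thesis
    using poly_mapping_expansion[OF finite_keys, of p p] by simp
qed

lemmas poly_mapping_induct =
  poly_mapping_keys_induct[OF subset_UNIV, case_names zero single add]

text \<open>
  Scalar multiplication is written through the commutative convolution product, which the type of
  superpolynomials carries in addition to \<open>sprod\<close>: on the carrier of the ring both products with
  a constant agree, and the simplification rules for commutative rings become available.
\<close>

lemma lookup_sconst_mult [simp]: "lookup (sconst c * p) m = c * lookup p m"
  unfolding sconst_def mult_map_scale_conv_mult[symmetric]
  by (simp add: Poly_Mapping.map.rep_eq when_def)

lemma keys_sconst_mult: "keys (sconst c * p) \<subseteq> keys p"
  by (auto simp: in_keys_iff)

lemma sconst_mult_single [simp]: "sconst c * single m a = single m (c * a)"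
  by (simp add: sconst_def mult_single)

lemma sconst_simps [simp]:
  "sconst 0 = 0" "sconst 1 = 1" "sconst (a + b) = sconst a + sconst b"
  "sconst (a * b) = sconst a * sconst b" "sconst (- a) = - sconst a"
  by (simp_all add: sconst_def single_add mult_single single_uminus)

lemma sprod_superset:
  assumes "finite A" "keys p \<subseteq> A" "finite B" "keys q \<subseteq> B"
  shows "p \<star> q = (\<Sum>m\<in>A. \<Sum>m'\<in>B.
           single (m + m') (smon_sign m m' * lookup p m * lookup q m'))"
proof -
  have "p \<star> q = (\<Sum>m\<in>keys p. \<Sum>m'\<in>B. single (m + m') (smon_sign m m' * lookup p m * lookup q m'))"
    unfolding sprod_def
    by (rule sum.cong[OF refl], rule sum.mono_neutral_left)
       (use assms in \<open>auto simp: in_keys_iff\<close>)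
  also have "\<dots> = (\<Sum>m\<in>A. \<Sum>m'\<in>B. single (m + m') (smon_sign m m' * lookup p m * lookup q m'))"
    by (rule sum.mono_neutral_left) (use assms in \<open>auto simp: in_keys_iff\<close>)
  finally show ?thesis .
qed

lemma sprod_add_left: "(p + p') \<star> q = p \<star> q + p' \<star> q"
proof -
  let ?A = "keys p \<union> keys p'"
  have "keys (p + p') \<subseteq> ?A" by (rule keys_add)
  then show ?thesis
    by (simp add: sprod_superset[of ?A _ "keys q"] lookup_add distrib_left distrib_right
        single_add sum.distrib)
qed

lemma sprod_add_right: "q \<star> (p + p') = q \<star> p + q \<star> p'"
proof -
  let ?A = "keys p \<union> keys p'"
  have "keys (p + p') \<subseteq> ?A" by (rule keys_add)
  then show ?thesis
    by (simp add: sprod_superset[of "keys q" _ ?A] lookup_add distrib_left distrib_right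
        single_add sum.distrib)
qed

lemma sprod_zero [simp]: "0 \<star> p = 0" "p \<star> 0 = 0"
  by (simp_all add: sprod_def)

lemma sprod_sum_left: "(\<Sum>x\<in>A. f x) \<star> q = (\<Sum>x\<in>A. f x \<star> q)"
  by (induction A rule: infinite_finite_induct) (simp_all add: sprod_add_left)

lemma sprod_sum_right: "q \<star> (\<Sum>x\<in>A. f x) = (\<Sum>x\<in>A. q \<star> f x)"
  by (induction A rule: infinite_finite_induct) (simp_all add: sprod_add_right)

lemma sprod_single: "single m c \<star> single m' c' = single (m + m') (smon_sign m m' * c * c')"
  by (subst sprod_superset[of "{m}" _ "{m'}"]) auto

lemma sprod_scale_left: "(sconst c * p) \<star> q = sconst c * (p \<star> q)"
proof (induction p rule: poly_mapping_induct)
  case (single m a)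
  show ?case
    by (induction q rule: poly_mapping_induct)
       (simp_all add: sprod_single sprod_add_right distrib_left mult_ac)
qed (simp_all add: sprod_add_left distrib_left)

lemma sprod_scale_right: "p \<star> (sconst c * q) = sconst c * (p \<star> q)"
proof (induction p rule: poly_mapping_induct)
  case (single m a)
  show ?case
    by (induction q rule: poly_mapping_induct)
       (simp_all add: sprod_single sprod_add_right distrib_left mult_ac)
qed (simp_all add: sprod_add_left distrib_left)

lemma keys_plus_nat: "keys (m + m' :: 'a \<Rightarrow>\<^sub>0 nat) = keys m \<union> keys m'"
  by (auto simp: in_keys_iff lookup_add)

text \<open>
  The pairs to be interchanged in a triple product are those between each two of the three factors,
  whichever product is formed first. If a fermionic
  variable is repeated among the three factors, both sides vanish.
\<close>

lemma smon_sign_cocycle: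
  "smon_sign m m' * smon_sign (m + m') m'' = smon_sign m' m'' * smon_sign m (m' + m'')"
proof (cases "\<exists>b s. lookup m (Fer b s) + lookup m' (Fer b s) + lookup m'' (Fer b s) \<ge> 2")
  case True
  then have "smon_sign (m + m') m'' = 0" "smon_sign m (m' + m'') = 0"
    by (auto simp: smon_sign_def lookup_add add.assoc)
  then show ?thesis by simp
next
  case False
  define N where "N a b = {(v, w). v \<in> keys a \<and> w \<in> keys b \<and> fer_before w v}" for a b :: smon
  have fin: "finite (N a b)" for a b
    by (rule finite_subset[of _ "keys a \<times> keys b"]) (auto simp: N_def)
  have one: "lookup m (Fer b s) + lookup m' (Fer b s) + lookup m'' (Fer b s) < 2" for b s
    using False by (metis not_less)
  have sgn: "smon_sign a b = (-1) ^ card (N a b)"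
    if "\<And>x s. lookup a (Fer x s) + lookup b (Fer x s) < 2" for a b
    using that by (auto simp: smon_sign_def N_def not_le[symmetric])
  have fer: "\<exists>x s. v = Fer x s" "\<exists>x s. w = Fer x s" if "fer_before w v" for v w
    using that by (cases v; cases w; auto)+
  have disj: "v \<notin> keys m \<or> v \<notin> keys m'" "v \<notin> keys m' \<or> v \<notin> keys m''"
    "v \<notin> keys m \<or> v \<notin> keys m''" if v: "\<exists>x s. v = Fer x s" for v
  proof -
    obtain x s where "v = Fer x s" using v by blast
    with one[of x s] have "lookup m v + lookup m' v + lookup m'' v < 2" by simp
    then show "v \<notin> keys m \<or> v \<notin> keys m'" "v \<notin> keys m' \<or> v \<notin> keys m''"
      "v \<notin> keys m \<or> v \<notin> keys m''"
      unfolding in_keys_iff by linarith+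
  qed
  have "N (m + m') m'' = N m m'' \<union> N m' m''"
    by (auto simp: N_def keys_plus_nat)
  moreover have "N m m'' \<inter> N m' m'' = {}"
    using disj(1)[OF fer(1)] by (fastforce simp: N_def)
  ultimately have 1: "card (N (m + m') m'') = card (N m m'') + card (N m' m'')"
    using fin by (simp add: card_Un_disjoint)
  have "N m (m' + m'') = N m m' \<union> N m m''"
    by (auto simp: N_def keys_plus_nat)
  moreover have "N m m' \<inter> N m m'' = {}"
    using disj(2)[OF fer(2)] by (fastforce simp: N_def)
  ultimately have 2: "card (N m (m' + m'')) = card (N m m') + card (N m m'')"
    using fin by (simp add: card_Un_disjoint)
  have le: "lookup m (Fer b s) + lookup m' (Fer b s) < 2"
       "lookup m' (Fer b s) + lookup m'' (Fer b s) < 2"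
       "lookup (m + m') (Fer b s) + lookup m'' (Fer b s) < 2"
       "lookup m (Fer b s) + lookup (m' + m'') (Fer b s) < 2" for b s
    using one[of b s] by (simp_all add: lookup_add)
  show ?thesis
    using 1 2 sgn[OF le(1)] sgn[OF le(2)] sgn[OF le(3)] sgn[OF le(4)]
    by (simp add: power_add mult_ac)
qed

lemma sprod_assoc: "(p \<star> q) \<star> r = p \<star> (q \<star> r)"
proof (induction p rule: poly_mapping_induct)
  case (single m a)
  show ?case
  proof (induction q rule: poly_mapping_induct)
    case (single m' b)
    show ?case
    proof (induction r rule: poly_mapping_induct)
      case (single m'' c)
      have "smon_sign (m + m') m'' * (smon_sign m m' * a * b) * c =
            (smon_sign m m' * smon_sign (m + m') m'') * (a * b * c)"
        by (simp only: mult_ac)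
      also have "\<dots> = smon_sign m (m' + m'') * a * (smon_sign m' m'' * b * c)"
        by (simp only: smon_sign_cocycle mult_ac)
      finally show ?case by (simp only: sprod_single add.assoc)
    qed (simp_all add: sprod_add_right)
  qed (simp_all add: sprod_add_left sprod_add_right)
qed (simp_all add: sprod_add_left)

lemma carrier_super_ring: "p \<in> carrier (super_ring k j) \<longleftrightarrow> keys p \<subseteq> smonomials k j"
  by (simp add: super_ring_def)

lemma super_ring_simps [simp]:
  "mult (super_ring k j) = sprod" "one (super_ring k j) = 1"
  "zero (super_ring k j) = 0" "add (super_ring k j) = (+)"
  by (simp_all add: super_ring_def)

lemma zero_in_smonomials [simp]: "0 \<in> smonomials k j"
  by (simp add: smonomials_def)

lemma smon_sign_zero: "m \<in> smonomials k j \<Longrightarrow> smon_sign 0 m = 1" "m \<in> smonomials k j \<Longrightarrow> smon_sign m 0 = 1"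
  by (auto simp: smon_sign_def smonomials_def not_le[symmetric])
    (metis Suc_n_not_le_n numeral_2_eq_2 One_nat_def le_trans)+

lemma smonomials_add_iff:
  assumes "m \<in> smonomials k j" "m' \<in> smonomials k j"
  shows "m + m' \<in> smonomials k j \<longleftrightarrow> smon_sign m m' \<noteq> 0"
  using assms by (auto simp: smonomials_def smon_sign_def keys_plus_nat lookup_add not_le
      less_Suc_eq_le numeral_2_eq_2 Suc_le_eq) (metis leI)

lemma smonomials_addD:
  assumes "m + m' \<in> smonomials k j"
  shows "m \<in> smonomials k j" "m' \<in> smonomials k j"
  using assms by (auto simp: smonomials_def keys_plus_nat lookup_add) (metis add_leD1 add_leD2)+

lemma one_sprod: "p \<in> carrier (super_ring k j) \<Longrightarrow> 1 \<star> p = p"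
  unfolding carrier_super_ring
proof (induction p rule: poly_mapping_keys_induct)
  case (single m c)
  then show ?case using sprod_single[of 0 1 m c] by (simp add: smon_sign_zero)
qed (simp_all add: sprod_add_right)

lemma sprod_one: "p \<in> carrier (super_ring k j) \<Longrightarrow> p \<star> 1 = p"
  unfolding carrier_super_ring
proof (induction p rule: poly_mapping_keys_induct)
  case (single m c)
  then show ?case using sprod_single[of m c 0 1] by (simp add: smon_sign_zero)
qed (simp_all add: sprod_add_left)

lemma sconst_sprod: "p \<in> carrier (super_ring k j) \<Longrightarrow> sconst c \<star> p = sconst c * p"
  using sprod_scale_left[of c 1 p] by (simp add: one_sprod)

lemma single_closed: "m \<in> smonomials k j \<Longrightarrow> single m c \<in> carrier (super_ring k j)"
  by (simp add: carrier_super_ring)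

lemma add_closed:
  "p \<in> carrier (super_ring k j) \<Longrightarrow> q \<in> carrier (super_ring k j) \<Longrightarrow> p + q \<in> carrier (super_ring k j)"
  unfolding carrier_super_ring using keys_add[of p q] by blast

lemma scale_closed: "p \<in> carrier (super_ring k j) \<Longrightarrow> sconst c * p \<in> carrier (super_ring k j)"
  unfolding carrier_super_ring using keys_sconst_mult[of c p] by blast

lemma sum_closed:
  "(\<And>x. x \<in> A \<Longrightarrow> f x \<in> carrier (super_ring k j)) \<Longrightarrow> sum f A \<in> carrier (super_ring k j)"
  by (induction A rule: infinite_finite_induct) (simp_all add: add_closed, simp_all add: carrier_super_ring)

lemma sprod_closed:
  assumes "p \<in> carrier (super_ring k j)" "q \<in> carrier (super_ring k j)"
  shows "p \<star> q \<in> carrier (super_ring k j)"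
  unfolding sprod_def
  by (intro sum_closed) (use assms in \<open>auto simp: carrier_super_ring subset_iff smonomials_add_iff\<close>)

lemma one_closed: "1 \<in> carrier (super_ring k j)"
  by (simp add: carrier_super_ring)

lemma sconst_closed: "sconst c \<in> carrier (super_ring k j)"
  by (simp add: sconst_def carrier_super_ring)

lemma ring_super_ring: "ring (super_ring k j)"
proof (rule ringI)
  show "abelian_group (super_ring k j)"
  proof (rule abelian_groupI)
    fix p assume p: "p \<in> carrier (super_ring k j)"
    have "- p \<in> carrier (super_ring k j)"
      using scale_closed[OF p, of "-1"] by simp
    then show "\<exists>y\<in>carrier (super_ring k j). y \<oplus>\<^bsub>super_ring k j\<^esub> p = \<zero>\<^bsub>super_ring k j\<^esub>"
      by (intro bexI[of _ "- p"]) simp_all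
  qed (simp_all add: add_closed add_ac, simp add: carrier_super_ring)
  show "Group.monoid (super_ring k j)"
    by (rule monoidI) (simp_all add: sprod_closed one_closed one_sprod sprod_one sprod_assoc)
qed (simp_all add: sprod_add_left sprod_add_right)

section \<open>Substitutions\<close>

fun svar_index :: "svar \<Rightarrow> 2" where
  "svar_index (Bos a s) = s"
| "svar_index (Fer b s) = s"

fun block_var :: "nat + nat \<Rightarrow> 2 \<Rightarrow> svar" where
  "block_var (Inl a) s = Bos a s"
| "block_var (Inr b) s = Fer b s"

lemma block_var_block_index [simp]: "block_var (svar_block v) (svar_index v) = v"
  by (cases v) auto

lemma svar_block_block_var [simp]: "svar_block (block_var \<alpha> s) = \<alpha>"
  by (cases \<alpha>) auto

lemma svar_index_block_var [simp]: "svar_index (block_var \<alpha> s) = s"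
  by (cases \<alpha>) auto

lemma svar_eq_iff: "v = w \<longleftrightarrow> svar_block v = svar_block w \<and> svar_index v = svar_index w"
  by (metis block_var_block_index)

definition blocks :: "nat \<Rightarrow> nat \<Rightarrow> (nat + nat) set" where
  "blocks k j = Inl ` {..<k} \<union> Inr ` {..<j}"

lemma in_set_svars: "v \<in> set (svars k j) \<longleftrightarrow> svar_block v \<in> blocks k j"
proof (cases v)
  case (Bos a s)
  then show ?thesis using exhaust_2[of s] by (auto simp: svars_def blocks_def)
next
  case (Fer b s)
  then show ?thesis using exhaust_2[of s] by (auto simp: svars_def blocks_def)
qed

definition is_fer :: "svar \<Rightarrow> bool" where
  "is_fer v \<longleftrightarrow> \<not> isl (svar_block v)"

lemma is_fer_simps [simp]: "\<not> is_fer (Bos a s)" "is_fer (Fer b s)"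
  by (simp_all add: is_fer_def)

definition koszul :: "svar \<Rightarrow> svar \<Rightarrow> complex" where
  "koszul v w = (if is_fer v \<and> is_fer w then -1 else 1)"

lemma koszul_nonzero [simp]: "koszul v w \<noteq> 0"
  by (simp add: koszul_def)

definition supercommuting :: "(svar \<Rightarrow> spoly) \<Rightarrow> bool" where
  "supercommuting f \<longleftrightarrow> (\<forall>v w. f v \<star> f w = sconst (koszul v w) * (f w \<star> f v))"

lemma supercommutingD: "supercommuting f \<Longrightarrow> f v \<star> f w = sconst (koszul v w) * (f w \<star> f v)"
  unfolding supercommuting_def by blast

definition wprod :: "(svar \<Rightarrow> spoly) \<Rightarrow> svar list \<Rightarrow> spoly" where
  "wprod f vs = foldr sprod (map f vs) 1"

lemma wprod_Nil [simp]: "wprod f [] = 1"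
  and wprod_Cons [simp]: "wprod f (v # vs) = f v \<star> wprod f vs"
  by (simp_all add: wprod_def)

definition word :: "nat \<Rightarrow> nat \<Rightarrow> smon \<Rightarrow> svar list" where
  "word k j m = concat (map (\<lambda>v. replicate (lookup m v) v) (svars k j))"

lemma act_smon_eq_wprod: "act_smon k j g m = wprod (act_svar g) (word k j m)"
  by (simp add: act_smon_def wprod_def word_def map_concat comp_def)

text \<open>
  The sign produced by reordering a product of variables does not depend on what is substituted for
  the variables, as long as the substituted elements have the same commutation signs. This is what
  makes substitutions multiplicative without any formula for these signs.
\<close>

lemma wprod_move:
  "\<exists>c. c \<noteq> 0 \<and> (\<forall>f. supercommuting f \<longrightarrow>
         wprod f (us @ v # ws) = sconst c * wprod f (v # us @ ws))"
proof (induction us)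
  case Nil
  show ?case by (intro exI[of _ 1]) simp
next
  case (Cons u us)
  then obtain c where c: "c \<noteq> 0"
    "\<And>f. supercommuting f \<Longrightarrow> wprod f (us @ v # ws) = sconst c * wprod f (v # us @ ws)"
    by blast
  have "wprod f ((u # us) @ v # ws) = sconst (c * koszul u v) * wprod f (v # (u # us) @ ws)"
    if f: "supercommuting f" for f
  proof -
    have "wprod f ((u # us) @ v # ws) = sconst c * ((f u \<star> f v) \<star> wprod f (us @ ws))"
      by (simp add: c(2)[OF f] sprod_scale_right sprod_assoc)
    also have "f u \<star> f v = sconst (koszul u v) * (f v \<star> f u)"
      using f by (rule supercommutingD)
    finally show ?thesis by (simp add: sprod_scale_left sprod_assoc mult.assoc)
  qed
  then show ?case using c(1) by (intro exI[of _ "c * koszul u v"]) auto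
qed

lemma wprod_reorder:
  assumes "mset us = mset ws"
  shows "\<exists>c. c \<noteq> 0 \<and> (\<forall>f. supercommuting f \<longrightarrow> wprod f us = sconst c * wprod f ws)"
  using assms
proof (induction us arbitrary: ws)
  case Nil
  then show ?case by (intro exI[of _ 1]) simp
next
  case (Cons u us)
  then have "u \<in> set ws" by (metis list.set_intros(1) set_mset_mset)
  then obtain xs ys where ws: "ws = xs @ u # ys" by (meson split_list)
  with Cons.prems have "mset us = mset (xs @ ys)" by simp
  from Cons.IH[OF this] obtain c where c: "c \<noteq> 0"
    "\<And>f. supercommuting f \<Longrightarrow> wprod f us = sconst c * wprod f (xs @ ys)" by blast
  obtain d where d: "d \<noteq> 0"
    "\<And>f. supercommuting f \<Longrightarrow> wprod f ws = sconst d * wprod f (u # xs @ ys)"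
    using wprod_move[of xs u ys] ws by blast
  have "wprod f (u # us) = sconst (c / d) * wprod f ws" if f: "supercommuting f" for f
  proof -
    have "sconst (c / d) * wprod f ws = sconst (c / d * d) * wprod f (u # xs @ ys)"
      by (simp only: d(2)[OF f] sconst_simps mult.assoc)
    then show ?thesis using d(1) by (simp add: c(2)[OF f] sprod_scale_right)
  qed
  then show ?case using c(1) d(1) by (intro exI[of _ "c / d"]) auto
qed

lemma supercommuting_square:
  assumes "supercommuting f" "is_fer v"
  shows "f v \<star> f v = 0"
proof (rule poly_mapping_eqI)
  fix m
  have "f v \<star> f v = sconst (-1) * (f v \<star> f v)"
    using supercommutingD[OF assms(1), of v v] assms(2) by (simp add: koszul_def)
  from arg_cong[OF this, of "\<lambda>p. lookup p m"]
  have "lookup (f v \<star> f v) m = - lookup (f v \<star> f v) m"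
    by (simp only: lookup_sconst_mult mult_minus1)
  then show "lookup (f v \<star> f v) m = lookup 0 m" by simp
qed

lemma wprod_repeated:
  assumes "supercommuting f" "is_fer v" "2 \<le> count (mset us) v"
  shows "wprod f us = 0"
proof -
  have "{#v, v#} \<subseteq># mset us"
    using assms(3) by (auto simp: subseteq_mset_def)
  then obtain M where "mset us = {#v, v#} + M" by (metis mset_subset_eq_exists_conv)
  moreover obtain ws where "mset ws = M" using ex_mset by blast
  ultimately have "mset us = mset (v # v # ws)" by simp
  from wprod_reorder[OF this] assms(1) obtain c
    where "wprod f us = sconst c * wprod f (v # v # ws)" by blast
  also have "\<dots> = 0"
    using supercommuting_square[OF assms(1,2)] by (simp flip: sprod_assoc)
  finally show ?thesis .
qed

lemma mset_word_add: "mset (word k j m @ word k j m') = mset (word k j (m + m'))"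
proof -
  have "mset (concat (map (\<lambda>v. replicate (lookup m v) v) vs)) +
        mset (concat (map (\<lambda>v. replicate (lookup m' v) v) vs)) =
        mset (concat (map (\<lambda>v. replicate (lookup (m + m') v) v) vs))" for vs
    by (induction vs) (simp_all add: lookup_add replicate_add)
  then show ?thesis by (simp add: word_def)
qed

lemma count_word:
  assumes "v \<in> set (svars k j)"
  shows "lookup m v \<le> count (mset (word k j m)) v"
proof -
  have "lookup m v \<le> count (mset (concat (map (\<lambda>v. replicate (lookup m v) v) vs))) v"
    if "v \<in> set vs" for vs
    using that by (induction vs) auto
  then show ?thesis using assms by (simp add: word_def)
qed

lemma set_word: "set (word k j m) \<subseteq> set (svars k j)"
  by (auto simp: word_def)

lemma smon_sign_var_var:
  "smon_sign (single v 1) (single w 1) =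
     (if v = w \<and> is_fer v then 0 else if fer_before w v then -1 else 1)"
proof -
  have "{(x, y). x \<in> keys (single v (1::nat)) \<and> y \<in> keys (single w (1::nat)) \<and> fer_before y x} =
        (if fer_before w v then {(v, w)} else {})"
    by auto
  moreover have "(\<exists>b s. lookup (single v (1::nat)) (Fer b s) + lookup (single w 1) (Fer b s) \<ge> 2)
        \<longleftrightarrow> v = w \<and> is_fer v"
    by (cases v; cases w) (auto simp: lookup_single when_def)
  ultimately show ?thesis
    by (auto simp: smon_sign_def)
qed

lemma fer_before_iff:
  "fer_before v w \<longleftrightarrow> (\<exists>b s c t. v = Fer b s \<and> w = Fer c t \<and> (b < c \<or> (b = c \<and> s = 1 \<and> t = 2)))"
  by (cases v; cases w) auto

lemma fer_before_total:
  assumes "is_fer v" "is_fer w" "v \<noteq> w"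
  shows "fer_before v w \<longleftrightarrow> \<not> fer_before w v"
proof -
  obtain b s c t where vw: "v = Fer b s" "w = Fer c t"
    using assms(1,2) by (metis is_fer_simps(1) svar.exhaust)
  then show ?thesis
    using assms(3) exhaust_2[of s] exhaust_2[of t] by auto
qed

lemma supercommuting_svar_poly: "supercommuting svar_poly"
proof -
  have "smon_sign (single v 1) (single w 1) = koszul v w * smon_sign (single w 1) (single v 1)"
    for v w
  proof (cases "is_fer v \<and> is_fer w \<and> v \<noteq> w")
    case True
    then show ?thesis
      using fer_before_total[of v w] unfolding smon_sign_var_var koszul_def
      by (cases "fer_before v w") auto
  next
    case False
    then have "v = w \<or> \<not> fer_before v w \<and> \<not> fer_before w v"
      by (auto simp: fer_before_iff)
    then show ?thesis
      using False unfolding smon_sign_var_var koszul_def by auto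
  qed
  then show ?thesis
    unfolding supercommuting_def svar_poly_def sprod_single sconst_mult_single
    by (metis add.commute mult.right_neutral)
qed

text \<open>
  Only fermionic variables can be out of order. Equality is excluded, so that a list sorted by this
  relation has no repetitions.
\<close>

definition in_order :: "svar \<Rightarrow> svar \<Rightarrow> bool" where
  "in_order v w \<longleftrightarrow> v \<noteq> w \<and> \<not> fer_before w v"

lemma sorted_svars: "sorted_wrt in_order (svars k j)"
proof -
  have bos: "sorted_wrt in_order [Bos a s. a \<leftarrow> [0..<k], s \<leftarrow> [1, 2]]" for k
    by (induction k) (auto simp: sorted_wrt_append in_order_def)
  have fer: "sorted_wrt in_order [Fer b s. b \<leftarrow> [0..<j], s \<leftarrow> [1, 2]]" for j
    by (induction j) (auto simp: sorted_wrt_append in_order_def)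
  show ?thesis
    unfolding svars_def sorted_wrt_append using bos fer by (auto simp: in_order_def)
qed

lemma distinct_svars: "distinct (svars k j)"
proof -
  have "distinct vs" if "sorted_wrt in_order vs" for vs
    using that by (induction vs) (auto simp: in_order_def)
  then show ?thesis using sorted_svars .
qed

text \<open>
  Multiplying the variables in increasing order produces no sign, because no fermionic variable ever
  has to pass an earlier one.
\<close>

lemma wprod_svar_poly_sorted:
  assumes "sorted_wrt in_order vs" "\<And>b s. e (Fer b s) \<le> 1"
  shows "wprod svar_poly (concat (map (\<lambda>v. replicate (e v) v) vs)) =
         single (\<Sum>v\<leftarrow>vs. single v (e v)) 1"
  using assms(1)
proof (induction vs)
  case Nil
  show ?case by simp
next
  case (Cons v vs)
  let ?M = "\<Sum>v\<leftarrow>vs. single v (e v)"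
  have lookM: "lookup ?M w = (if w \<in> set vs then e w else 0)" for w
    using Cons.prems
    by (induction vs) (auto simp: lookup_add lookup_single when_def in_order_def)
  have "v \<notin> set vs" using Cons.prems by (auto simp: in_order_def)
  have step: "smon_sign (single v 1) (single v n + ?M) = 1" if n: "Suc n \<le> e v" for n
  proof -
    have "lookup (single v 1) (Fer b s) + lookup (single v n + ?M) (Fer b s) < 2" for b s
    proof (cases "v = Fer b s")
      case True
      then have "n = 0" using n assms(2)[of b s] by simp
      then show ?thesis using True \<open>v \<notin> set vs\<close> by (simp add: lookM)
    next
      case False
      then show ?thesis using assms(2)[of b s]
        by (simp add: lookup_add lookup_single lookM)
    qed
    moreover have "\<not> fer_before w v" if "w \<in> keys (single v n + ?M)" for w
      using that Cons.prems
      by (auto simp: keys_plus_nat in_keys_iff lookM lookup_single when_def in_order_def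
               split: if_splits) (auto simp: fer_before_iff)
    then have no_swaps: "{(x, w). x \<in> keys (single v (1::nat)) \<and> w \<in> keys (single v n + ?M) \<and> fer_before w x} = {}"
      by auto
    ultimately show ?thesis
      unfolding smon_sign_def no_swaps by (simp add: not_le)
  qed
  have "wprod svar_poly (replicate n v @ concat (map (\<lambda>v. replicate (e v) v) vs)) =
        single (single v n + ?M) 1" if "n \<le> e v" for n
    using that
  proof (induction n)
    case 0
    show ?case using Cons by simp
  next
    case (Suc n)
    then show ?case using step[of n]
      by (simp add: svar_poly_def sprod_single add.assoc[symmetric] single_add[symmetric])
  qed
  from this[of "e v"] show ?case by simp
qed

lemma wprod_svar_poly_word:
  assumes "m \<in> smonomials k j"
  shows "wprod svar_poly (word k j m) = single m 1"
proof -
  have "(\<Sum>v\<leftarrow>svars k j. single v (lookup m v)) = (\<Sum>v\<in>set (svars k j). single v (lookup m v))"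
    by (simp add: sum_list_distinct_conv_sum_set distinct_svars)
  also have "\<dots> = m"
    using assms poly_mapping_expansion[of "set (svars k j)" m] by (simp add: smonomials_def)
  finally show ?thesis
    using wprod_svar_poly_sorted[OF sorted_svars, of "lookup m" k j] assms
    by (simp add: word_def smonomials_def)
qed

definition subst :: "nat \<Rightarrow> nat \<Rightarrow> (svar \<Rightarrow> spoly) \<Rightarrow> spoly \<Rightarrow> spoly" where
  "subst k j f p = (\<Sum>m\<in>keys p. sconst (lookup p m) * wprod f (word k j m))"

definition admissible :: "nat \<Rightarrow> nat \<Rightarrow> (svar \<Rightarrow> spoly) \<Rightarrow> bool" where
  "admissible k j f \<longleftrightarrow>
     supercommuting f \<and> (\<forall>v\<in>set (svars k j). f v \<in> carrier (super_ring k j))"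

lemma wprod_closed:
  assumes "\<And>v. v \<in> set vs \<Longrightarrow> f v \<in> carrier (super_ring k j)"
  shows "wprod f vs \<in> carrier (super_ring k j)"
  using assms by (induction vs) (simp_all add: one_closed sprod_closed)

lemma wprod_word_closed: "admissible k j f \<Longrightarrow> wprod f (word k j m) \<in> carrier (super_ring k j)"
  using set_word[of k j m] by (intro wprod_closed) (auto simp: admissible_def)

lemma subst_superset:
  assumes "finite A" "keys p \<subseteq> A"
  shows "subst k j f p = (\<Sum>m\<in>A. sconst (lookup p m) * wprod f (word k j m))"
  unfolding subst_def
  by (rule sum.mono_neutral_left) (use assms in \<open>auto simp: in_keys_iff\<close>)

lemma subst_add: "subst k j f (p + q) = subst k j f p + subst k j f q"
  using keys_add[of p q]
  by (simp add: subst_superset[of "keys p \<union> keys q"] lookup_add distrib_right sum.distrib)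

lemma subst_scale: "subst k j f (sconst c * p) = sconst c * subst k j f p"
  using keys_sconst_mult[of c p]
  by (simp add: subst_superset[of "keys p"] sum_distrib_left mult.assoc)

lemma subst_zero [simp]: "subst k j f 0 = 0"
  by (simp add: subst_def)

lemma subst_sum: "subst k j f (\<Sum>x\<in>A. g x) = (\<Sum>x\<in>A. subst k j f (g x))"
  by (induction A rule: infinite_finite_induct) (simp_all add: subst_add)

lemma subst_single: "subst k j f (single m c) = sconst c * wprod f (word k j m)"
  by (subst subst_superset[of "{m}"]) auto

lemma word_zero [simp]: "word k j 0 = []"
  by (simp add: word_def)

lemma subst_one [simp]: "subst k j f 1 = 1"
  using subst_single[of k j f 0 1] by simp

lemma word_var:
  assumes "v \<in> set (svars k j)"
  shows "word k j (single v 1) = [v]"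
proof -
  obtain xs ys where s: "svars k j = xs @ v # ys" using assms by (meson split_list)
  have "v \<notin> set xs" "v \<notin> set ys" using distinct_svars[of k j] unfolding s by auto
  then have xs: "concat (map (\<lambda>w. replicate (lookup (single v 1) w) w) xs) = []"
    and ys: "concat (map (\<lambda>w. replicate (lookup (single v 1) w) w) ys) = []"
    by (auto simp: lookup_single when_def)
  show ?thesis
    unfolding word_def s map_append concat_append list.map concat.simps xs ys by simp
qed

lemma subst_var: "admissible k j f \<Longrightarrow> v \<in> set (svars k j) \<Longrightarrow> subst k j f (svar_poly v) = f v"
  unfolding svar_poly_def subst_single word_var
  by (simp add: sprod_one[of "f v" k j] admissible_def)

lemma subst_closed: "admissible k j f \<Longrightarrow> subst k j f p \<in> carrier (super_ring k j)"
  unfolding subst_def by (intro sum_closed scale_closed wprod_word_closed)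

lemma wprod_append:
  assumes "\<And>v. v \<in> set (us @ vs) \<Longrightarrow> f v \<in> carrier (super_ring k j)"
  shows "wprod f (us @ vs) = wprod f us \<star> wprod f vs"
  using assms
proof (induction us)
  case Nil
  then have "wprod f vs \<in> carrier (super_ring k j)" by (intro wprod_closed) auto
  then show ?case by (simp add: one_sprod)
qed (simp add: sprod_assoc)

lemma svar_poly_closed: "v \<in> set (svars k j) \<Longrightarrow> svar_poly v \<in> carrier (super_ring k j)"
  unfolding svar_poly_def
  by (rule single_closed) (auto simp: smonomials_def lookup_single when_def)

lemma admissible_svar_poly: "admissible k j svar_poly"
  by (simp add: admissible_def supercommuting_svar_poly svar_poly_closed)

text \<open>
  The sign by which the product of two substituted words differs from the substituted word of the
  product is the one for the variables themselves, and that one is \<open>smon_sign\<close> by definition of the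
  product.
\<close>

lemma wprod_word_mult:
  assumes f: "admissible k j f" and m: "m \<in> smonomials k j" "m' \<in> smonomials k j"
  shows "wprod f (word k j m) \<star> wprod f (word k j m') =
         sconst (smon_sign m m') * wprod f (word k j (m + m'))"
proof -
  have app: "wprod h (word k j m @ word k j m') = wprod h (word k j m) \<star> wprod h (word k j m')"
    if "admissible k j h" for h
    using that set_word[of k j m] set_word[of k j m']
    by (intro wprod_append[of _ _ _ k j]) (auto simp: admissible_def)
  show ?thesis
  proof (cases "m + m' \<in> smonomials k j")
    case True
    obtain c where c: "\<And>h. supercommuting h \<Longrightarrow>
        wprod h (word k j m @ word k j m') = sconst c * wprod h (word k j (m + m'))"
      using wprod_reorder[OF mset_word_add] by blast
    have "single (m + m') (smon_sign m m') = sconst c * single (m + m') 1"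
      using c[OF supercommuting_svar_poly] app[OF admissible_svar_poly] m True
      by (simp add: wprod_svar_poly_word sprod_single)
    from arg_cong[OF this, of "\<lambda>p. lookup p (m + m')"] have "c = smon_sign m m'"
      by simp
    then show ?thesis using c[of f] app[OF f] f by (simp add: admissible_def)
  next
    case False
    then have sgn: "smon_sign m m' = 0" using smonomials_add_iff[OF m] by simp
    obtain b s where two: "2 \<le> lookup (m + m') (Fer b s)"
      using False m
      by (auto simp: smonomials_def keys_plus_nat not_le numeral_2_eq_2 Suc_le_eq)
    have "Fer b s \<in> set (svars k j)"
    proof -
      have "Fer b s \<in> keys (m + m')" using two by (simp add: in_keys_iff)
      then show ?thesis using m by (auto simp: smonomials_def keys_plus_nat)
    qed
    then have "2 \<le> count (mset (word k j m @ word k j m')) (Fer b s)"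
      using count_word[of "Fer b s" k j "m + m'"] two unfolding mset_word_add by linarith
    then have "wprod f (word k j m @ word k j m') = 0"
      using f by (intro wprod_repeated[of f "Fer b s"]) (auto simp: admissible_def)
    then show ?thesis using app[OF f] sgn by simp
  qed
qed

lemma subst_mult:
  assumes f: "admissible k j f" and "p \<in> carrier (super_ring k j)" "q \<in> carrier (super_ring k j)"
  shows "subst k j f (p \<star> q) = subst k j f p \<star> subst k j f q"
  using assms(2) unfolding carrier_super_ring
proof (induction p rule: poly_mapping_keys_induct)
  case (single m c)
  note m = single
  show ?case
    using assms(3) unfolding carrier_super_ring
  proof (induction q rule: poly_mapping_keys_induct)
    case (single m' d)
    show ?case
      using wprod_word_mult[OF f m single]
      by (simp add: sprod_single subst_single sprod_scale_left sprod_scale_right mult_ac)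
  qed (simp_all add: sprod_add_right subst_add)
qed (simp_all add: sprod_add_left subst_add)

text \<open>
  A monomial is the ordered product of its variables, so a homomorphism of algebras is determined by
  the images of the variables. The composition law of the action rests on this.
\<close>

lemma subst_unique:
  assumes add: "\<And>p q. p \<in> carrier (super_ring k j) \<Longrightarrow> q \<in> carrier (super_ring k j) \<Longrightarrow> F (p + q) = F p + F q"
    and scale: "\<And>c p. p \<in> carrier (super_ring k j) \<Longrightarrow> F (sconst c * p) = sconst c * F p"
    and mult: "\<And>p q. p \<in> carrier (super_ring k j) \<Longrightarrow> q \<in> carrier (super_ring k j) \<Longrightarrow> F (p \<star> q) = F p \<star> F q"
    and one: "F 1 = 1"
    and var: "\<And>v. v \<in> set (svars k j) \<Longrightarrow> F (svar_poly v) = f v"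
    and p: "p \<in> carrier (super_ring k j)"
  shows "F p = subst k j f p"
proof -
  have w: "F (wprod svar_poly vs) = wprod f vs" if "set vs \<subseteq> set (svars k j)" for vs
    using that
  proof (induction vs)
    case (Cons v vs)
    have "wprod svar_poly vs \<in> carrier (super_ring k j)"
      using Cons.prems by (intro wprod_closed svar_poly_closed) auto
    then show ?case using Cons by (simp add: mult svar_poly_closed var)
  qed (simp add: one)
  have "keys p \<subseteq> smonomials k j" using p by (simp add: carrier_super_ring)
  then have "p \<in> carrier (super_ring k j) \<and> F p = subst k j f p"
  proof (induction p rule: poly_mapping_keys_induct)
    case zero
    show ?case using scale[OF one_closed, of 0] by (simp add: carrier_super_ring)
  next
    case (single m c)
    have "F (single m c) = F (sconst c * single m 1)" by simp
    also have "\<dots> = sconst c * wprod f (word k j m)"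
      using scale[OF single_closed[OF single]] w[OF set_word, of m]
      by (simp only: wprod_svar_poly_word[OF single])
    finally show ?case using single by (simp add: subst_single single_closed)
  next
    case (add p q)
    then show ?case by (simp add: add_closed assms(1) subst_add)
  qed
  then show ?thesis ..
qed

section \<open>The action of matrices\<close>

lemma act_svar_eq:
  "act_svar g v = (\<Sum>r\<in>UNIV. sconst (g $ r $ svar_index v) * svar_poly (block_var (svar_block v) r))"
proof -
  have "sconst c \<star> svar_poly w = sconst c * svar_poly w" for c w
  proof -
    obtain n where n: "svar_block w \<in> blocks n n"
    proof (cases "svar_block w")
      case (Inl a)
      then show ?thesis using that[of "Suc a"] by (simp add: blocks_def)
    next
      case (Inr b)
      then show ?thesis using that[of "Suc b"] by (simp add: blocks_def)
    qed
    show ?thesis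
      by (rule sconst_sprod[OF svar_poly_closed]) (use n in \<open>simp add: in_set_svars\<close>)
  qed
  then show ?thesis by (cases v) simp_all
qed

text \<open>
  A linear change of variables inside each pair preserves the commutation signs, since these only
  depend on whether the pairs are bosonic or fermionic.
\<close>

lemma admissible_act_svar: "admissible k j (act_svar g)"
  unfolding admissible_def supercommuting_def
proof (intro conjI allI ballI)
  fix v w
  let ?v = "\<lambda>r. svar_poly (block_var (svar_block v) r)"
  let ?w = "\<lambda>r. svar_poly (block_var (svar_block w) r)"
  have comm: "?v r \<star> ?w s = sconst (koszul v w) * (?w s \<star> ?v r)" for r s
  proof -
    have "koszul (block_var (svar_block v) r) (block_var (svar_block w) s) = koszul v w"
      by (simp add: koszul_def is_fer_def)
    then show ?thesis
      using supercommutingD[OF supercommuting_svar_poly] by metis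
  qed
  have "act_svar g v \<star> act_svar g w =
    (\<Sum>r\<in>UNIV. \<Sum>s\<in>UNIV. sconst (g $ r $ svar_index v) * (sconst (g $ s $ svar_index w) * (?v r \<star> ?w s)))"
    unfolding act_svar_eq sprod_sum_left sprod_scale_left
    by (simp only: sprod_sum_right sprod_scale_right sum_distrib_left)
  also have "\<dots> = (\<Sum>r\<in>UNIV. \<Sum>s\<in>UNIV. sconst (koszul v w) *
      (sconst (g $ s $ svar_index w) * (sconst (g $ r $ svar_index v) * (?w s \<star> ?v r))))"
    by (intro sum.cong refl) (subst comm, simp only: mult_ac)
  also have "\<dots> = (\<Sum>s\<in>UNIV. \<Sum>r\<in>UNIV. sconst (koszul v w) *
      (sconst (g $ s $ svar_index w) * (sconst (g $ r $ svar_index v) * (?w s \<star> ?v r))))"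
    by (rule sum.swap)
  also have "\<dots> = sconst (koszul v w) * (act_svar g w \<star> act_svar g v)"
    unfolding act_svar_eq sprod_sum_left sprod_scale_left
    by (simp only: sprod_sum_right sprod_scale_right sum_distrib_left)
  finally show "act_svar g v \<star> act_svar g w = sconst (koszul v w) * (act_svar g w \<star> act_svar g v)" .
next
  fix v assume "v \<in> set (svars k j)"
  then show "act_svar g v \<in> carrier (super_ring k j)"
    unfolding act_svar_eq
    by (intro sum_closed scale_closed svar_poly_closed) (simp add: in_set_svars)
qed

lemma act_eq_subst: "act k j g p = subst k j (act_svar g) p"
  unfolding act_def subst_def act_smon_eq_wprod
  by (intro sum.cong refl sconst_sprod[OF wprod_word_closed[OF admissible_act_svar]])

lemmas act_add = subst_add[where f = "act_svar g" for g, folded act_eq_subst]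
lemmas act_scale = subst_scale[where f = "act_svar g" for g, folded act_eq_subst]
lemmas act_zero [simp] = subst_zero[where f = "act_svar g" for g, folded act_eq_subst]
lemmas act_one [simp] = subst_one[where f = "act_svar g" for g, folded act_eq_subst]
lemmas act_sum = subst_sum[where f = "act_svar g" for g, folded act_eq_subst]
lemmas act_mult = subst_mult[OF admissible_act_svar, folded act_eq_subst]
lemmas act_closed = subst_closed[OF admissible_act_svar, folded act_eq_subst]
lemmas act_var = subst_var[OF admissible_act_svar, folded act_eq_subst]
lemmas act_unique = subst_unique[where f = "act_svar g" for g, folded act_eq_subst]

lemma act_minus: "act k j g (- p) = - act k j g p"
  using act_scale[of k j g "-1" p] by simp

lemma act_diff: "act k j g (p - q) = act k j g p - act k j g q"
  using act_add[of k j g p "- q"] by (simp add: act_minus)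

lemma act_id:
  assumes "p \<in> carrier (super_ring k j)"
  shows "act k j (mat 1) p = p"
proof -
  have "svar_poly v = act_svar (mat 1) v" for v
  proof -
    have "act_svar (mat 1) v = (\<Sum>r\<in>UNIV. if r = svar_index v then svar_poly (block_var (svar_block v) r) else 0)"
      unfolding act_svar_eq by (intro sum.cong) (auto simp: mat_def)
    then show ?thesis by (simp add: sum.delta)
  qed
  then show ?thesis
    using act_unique[where F = "\<lambda>p. p" and g = "mat 1", OF _ _ _ _ _ assms] by simp
qed

lemma act_act:
  assumes "p \<in> carrier (super_ring k j)"
  shows "act k j g (act k j h p) = act k j (g ** h) p"
proof (rule act_unique[where F = "\<lambda>p. act k j g (act k j h p)", OF _ _ _ _ _ assms])
  fix v assume v: "v \<in> set (svars k j)"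
  let ?v = "block_var (svar_block v)"
  have v': "?v r \<in> set (svars k j)" for r using v by (simp add: in_set_svars)
  have "act k j g (act k j h (svar_poly v)) = act k j g (act_svar h v)"
    by (simp add: act_var[OF v])
  also have "\<dots> = (\<Sum>r\<in>UNIV. sconst (h $ r $ svar_index v) * act_svar g (?v r))"
    unfolding act_svar_eq[of h v] by (simp only: act_sum act_scale act_var[OF v'])
  also have "\<dots> = (\<Sum>r\<in>UNIV. \<Sum>t\<in>UNIV. sconst (g $ t $ r * h $ r $ svar_index v) * svar_poly (?v t))"
    unfolding act_svar_eq[of g] by (simp add: sum_distrib_left mult_ac)
  also have "\<dots> = (\<Sum>t\<in>UNIV. \<Sum>r\<in>UNIV. sconst (g $ t $ r * h $ r $ svar_index v) * svar_poly (?v t))"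
    by (rule sum.swap)
  also have "\<dots> = act_svar (g ** h) v"
  proof -
    have "sconst (\<Sum>r\<in>UNIV. c r) = (\<Sum>r\<in>UNIV. sconst (c r))" for c :: "2 \<Rightarrow> complex"
      by (simp add: sum_2)
    then show ?thesis
      by (simp add: act_svar_eq matrix_matrix_mult_def sum_distrib_right)
  qed
  finally show "act k j g (act k j h (svar_poly v)) = act_svar (g ** h) v" .
qed (simp_all add: act_add act_scale act_mult act_closed)

section \<open>Monomials\<close>

lemma smon_sign_square:
  assumes "m + m' \<in> smonomials k j"
  shows "smon_sign m m' * smon_sign m m' = 1"
proof -
  have "smon_sign m m' \<noteq> 0"
    using assms smonomials_add_iff smonomials_addD by blast
  then have "smon_sign m m' = (-1) ^ card {(v, w). v \<in> keys m \<and> w \<in> keys m' \<and> fer_before w v}"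
    by (auto simp: smon_sign_def split: if_splits)
  then show ?thesis by (simp flip: power_add mult_2)
qed

lemma single_add_eq_sprod:
  assumes "m + m' \<in> smonomials k j"
  shows "single (m + m') c = sconst (c * smon_sign m m') * (single m 1 \<star> single m' 1)"
  using smon_sign_square[OF assms] by (simp add: sprod_single mult.assoc)

lemma exists_var_summand:
  fixes m :: "'a \<Rightarrow>\<^sub>0 nat"
  assumes "v \<in> keys m"
  obtains m' where "m = single v 1 + m'"
proof
  show "m = single v 1 + (m - single v 1)"
    using assms
    by (intro poly_mapping_eqI) (auto simp: lookup_add lookup_minus lookup_single when_def in_keys_iff)
qed

lemma exists_var:
  fixes m :: "'a \<Rightarrow>\<^sub>0 nat"
  assumes "m \<noteq> 0"
  obtains v m' where "m = single v 1 + m'"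
proof -
  have "keys m \<noteq> {}"
    using assms by (auto simp: poly_mapping_eq_iff fun_eq_iff in_keys_iff)
  then obtain v where "v \<in> keys m" by blast
  then show ?thesis by (rule exists_var_summand) (rule that)
qed

lemma single_var_in_smonomials: "single v 1 \<in> smonomials k j \<longleftrightarrow> v \<in> set (svars k j)"
  by (auto simp: smonomials_def lookup_single when_def)

lemma sum_lookup_add:
  fixes m m' :: "'a \<Rightarrow>\<^sub>0 nat" and h :: "'a \<Rightarrow> nat \<Rightarrow> 'b::comm_monoid_add"
  assumes "\<And>v. h v 0 = 0" "\<And>v a b. h v (a + b) = h v a + h v b"
  shows "(\<Sum>v\<in>keys (m + m'). h v (lookup (m + m') v)) =
         (\<Sum>v\<in>keys m. h v (lookup m v)) + (\<Sum>v\<in>keys m'. h v (lookup m' v))"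
proof -
  let ?A = "keys m \<union> keys m'"
  have "(\<Sum>v\<in>keys x. h v (lookup x v)) = (\<Sum>v\<in>?A. h v (lookup x v))" if "keys x \<subseteq> ?A" for x
    by (rule sum.mono_neutral_left) (use that assms(1) in \<open>auto simp: in_keys_iff\<close>)
  then show ?thesis
    by (simp add: keys_plus_nat lookup_add assms(2) sum.distrib)
qed

lemma smon_deg_add: "smon_deg (m + m') = smon_deg m + smon_deg m'"
  unfolding smon_deg_def by (rule sum_lookup_add) (simp_all add: single_add)

lemma smon_deg_single [simp]: "smon_deg (single v n) = single (svar_block v) n"
  by (simp add: smon_deg_def)

lemma smon_deg_zero [simp]: "smon_deg 0 = 0"
  by (simp add: smon_deg_def)

text \<open>
  In the diagonal model below, the variables of index 1 and of index 2 are the letters \<open>z\<close> and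
  \<open>w\<close>, and a monomial is classified by how many of each it contains.
\<close>

definition index_count :: "2 \<Rightarrow> smon \<Rightarrow> nat" where
  "index_count s m = (\<Sum>v\<in>keys m. if svar_index v = s then lookup m v else 0)"

lemma index_count_add: "index_count s (m + m') = index_count s m + index_count s m'"
  unfolding index_count_def
  using sum_lookup_add[of "\<lambda>v x. if svar_index v = s then x else 0" m m'] by simp

lemma index_count_single [simp]:
  "index_count s (single v n) = (if svar_index v = s then n else 0)"
  by (simp add: index_count_def)

lemma index_count_zero [simp]: "index_count s 0 = 0"
  by (simp add: index_count_def)

lemma index_count_pos_iff: "0 < index_count s m \<longleftrightarrow> (\<exists>v\<in>keys m. svar_index v = s)"
  unfolding index_count_def
  by (subst zero_less_iff_neq_zero) (auto simp: in_keys_iff)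

lemma smon_eq_zero_iff: "m = 0 \<longleftrightarrow> index_count 1 m = 0 \<and> index_count 2 m = 0"
proof
  assume "index_count 1 m = 0 \<and> index_count 2 m = 0"
  then have "keys m = {}"
    using index_count_pos_iff[of 1 m] index_count_pos_iff[of 2 m] exhaust_2 by fastforce
  then show "m = 0" by (auto intro!: poly_mapping_eqI simp: in_keys_iff)
qed simp

lemma smonomials_induct [consumes 1, case_names zero add]:
  assumes "m \<in> smonomials k j"
    and "P 0"
    and "\<And>v m. v \<in> set (svars k j) \<Longrightarrow> single v 1 + m \<in> smonomials k j \<Longrightarrow> P m \<Longrightarrow> P (single v 1 + m)"
  shows "P m"
  using assms(1)
proof (induction "index_count 1 m + index_count 2 m" arbitrary: m rule: less_induct)
  case less
  show ?case
  proof (cases "m = 0")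
    case True
    then show ?thesis using assms(2) by simp
  next
    case False
    then obtain v m' where m: "m = single v 1 + m'" by (rule exists_var)
    have m': "m' \<in> smonomials k j" "v \<in> set (svars k j)"
      using smonomials_addD[OF less.prems[unfolded m]]
      by (simp_all only: single_var_in_smonomials)
    have "index_count 1 m' + index_count 2 m' < index_count 1 m + index_count 2 m"
      using exhaust_2[of "svar_index v"] by (auto simp: m index_count_add)
    from less.hyps[OF this m'(1)] show ?thesis
      using assms(3)[OF m'(2)] less.prems by (simp add: m)
  qed
qed

lemma act_single_var_add:
  assumes "v \<in> set (svars k j)" "single v 1 + m \<in> smonomials k j"
  shows "act k j g (single (single v 1 + m) 1) =
         sconst (smon_sign (single v 1) m) * (act_svar g v \<star> act k j g (single m 1))"
proof -
  have "m \<in> smonomials k j" using assms(2) smonomials_addD by blast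
  then show ?thesis
    unfolding single_add_eq_sprod[OF assms(2)] svar_poly_def[symmetric]
    by (simp add: act_scale act_mult svar_poly_closed[OF assms(1)] single_closed act_var[OF assms(1)])
qed

lemma act_single: "act k j g (single m c) = sconst c * act k j g (single m 1)"
  using act_scale[of k j g c "single m 1"] by simp

section \<open>Homogeneous components\<close>

definition homogeneous :: "multideg \<Rightarrow> spoly \<Rightarrow> bool" where
  "homogeneous d p \<longleftrightarrow> (\<forall>m\<in>keys p. smon_deg m = d)"

lemma super_component_iff:
  "p \<in> super_component k j d \<longleftrightarrow> p \<in> carrier (super_ring k j) \<and> homogeneous d p"
  by (simp add: super_component_def homogeneous_def)

lemma homogeneous_add: "homogeneous d p \<Longrightarrow> homogeneous d q \<Longrightarrow> homogeneous d (p + q)"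
  using keys_add[of p q] by (auto simp: homogeneous_def)

lemma homogeneous_scale: "homogeneous d p \<Longrightarrow> homogeneous d (sconst c * p)"
  using keys_sconst_mult[of c p] by (auto simp: homogeneous_def)

lemma homogeneous_sum: "(\<And>x. x \<in> A \<Longrightarrow> homogeneous d (f x)) \<Longrightarrow> homogeneous d (sum f A)"
  by (induction A rule: infinite_finite_induct) (simp_all add: homogeneous_add, simp_all add: homogeneous_def)

lemma keys_sprod: "keys (p \<star> q) \<subseteq> {m + m' | m m'. m \<in> keys p \<and> m' \<in> keys q}"
proof
  fix x assume "x \<in> keys (p \<star> q)"
  then have "(\<Sum>m\<in>keys p. \<Sum>m'\<in>keys q.
      lookup (single (m + m') (smon_sign m m' * lookup p m * lookup q m')) x) \<noteq> 0"
    by (simp add: sprod_def in_keys_iff lookup_sum)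
  then obtain m where "m \<in> keys p"
    "(\<Sum>m'\<in>keys q. lookup (single (m + m') (smon_sign m m' * lookup p m * lookup q m')) x) \<noteq> 0"
    by (meson sum.not_neutral_contains_not_neutral)
  then obtain m' where "m' \<in> keys q"
    "lookup (single (m + m') (smon_sign m m' * lookup p m * lookup q m')) x \<noteq> 0"
    by (meson sum.not_neutral_contains_not_neutral)
  then show "x \<in> {m + m' | m m'. m \<in> keys p \<and> m' \<in> keys q}"
    using \<open>m \<in> keys p\<close> by (auto simp: lookup_single when_def split: if_splits)
qed

lemma homogeneous_sprod: "homogeneous d p \<Longrightarrow> homogeneous e q \<Longrightarrow> homogeneous (d + e) (p \<star> q)"
  using keys_sprod[of p q] by (fastforce simp: homogeneous_def smon_deg_add)

lemma homogeneous_act_svar: "homogeneous (single (svar_block v) 1) (act_svar g v)"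
  unfolding act_svar_eq
  by (intro homogeneous_sum homogeneous_scale) (simp add: homogeneous_def svar_poly_def)

lemma homogeneous_act_single:
  "m \<in> smonomials k j \<Longrightarrow> homogeneous (smon_deg m) (act k j g (single m 1))"
proof (induction m rule: smonomials_induct)
  case zero
  then show ?case by (simp add: homogeneous_def)
next
  case (add v m)
  then show ?case
    unfolding act_single_var_add[OF add(1,2)] smon_deg_add smon_deg_single
    by (intro homogeneous_scale homogeneous_sprod homogeneous_act_svar)
qed

lemma act_eq_sum: "act k j g p = (\<Sum>m\<in>keys p. sconst (lookup p m) * act k j g (single m 1))"
  using arg_cong[OF poly_mapping_expansion[OF finite_keys order.refl, of p], of "act k j g"]
  by (simp add: act_sum act_single[of k j g _ "lookup p _"])

lemma act_component:
  assumes "p \<in> super_component k j d"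
  shows "act k j g p \<in> super_component k j d"
proof -
  have "homogeneous d (act k j g p)"
    unfolding act_eq_sum[of k j g p]
  proof (intro homogeneous_sum homogeneous_scale)
    fix m assume "m \<in> keys p"
    then show "homogeneous d (act k j g (single m 1))"
      using assms homogeneous_act_single[of m k j g]
      by (auto simp: super_component_iff homogeneous_def carrier_super_ring)
  qed
  then show ?thesis by (simp add: super_component_iff act_closed)
qed

lemma smon_deg_eq_zero_iff: "smon_deg m = 0 \<longleftrightarrow> m = 0"
proof
  assume d: "smon_deg m = 0"
  show "m = 0"
  proof (rule ccontr)
    assume "m \<noteq> 0"
    then obtain v m' where m: "m = single v 1 + m'" by (rule exists_var)
    have "lookup (smon_deg m) (svar_block v) \<noteq> 0" by (simp add: m smon_deg_add lookup_add)
    then show False by (simp add: d)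
  qed
qed simp

lemma lookup_act_zero:
  assumes "p \<in> carrier (super_ring k j)" "lookup p 0 = 0"
  shows "lookup (act k j g p) 0 = 0"
proof -
  have "lookup (act k j g (single m 1)) 0 = 0" if "m \<in> keys p" for m
  proof -
    have "m \<noteq> 0" "m \<in> smonomials k j" using that assms by (auto simp: carrier_super_ring in_keys_iff)
    then show ?thesis
      using homogeneous_act_single[of m k j g] smon_deg_eq_zero_iff[of m]
      by (force simp: homogeneous_def in_keys_iff)
  qed
  then show ?thesis
    unfolding act_eq_sum[of k j g p] by (simp add: lookup_sum)
qed

section \<open>The diagonal model\<close>

definition diag_mat :: "complex \<Rightarrow> complex \<Rightarrow> complex^2^2" where
  "diag_mat x y = vector [vector [x, 0], vector [0, y]]"

definition swap_mat :: "complex^2^2" where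
  "swap_mat = vector [vector [0, 1], vector [1, 0]]"

definition swap_var :: "svar \<Rightarrow> svar" where
  "swap_var v = block_var (svar_block v) (if svar_index v = 1 then 2 else 1)"

lemma swap_var_swap_var [simp]: "swap_var (swap_var v) = v"
  using exhaust_2[of "svar_index v"] by (auto simp: swap_var_def svar_eq_iff)

lemma inj_swap_var [simp]: "inj swap_var"
  by (metis injI swap_var_swap_var)

lemma svar_block_swap_var [simp]: "svar_block (swap_var v) = svar_block v"
  by (simp add: swap_var_def)

lemma is_fer_swap_var [simp]: "is_fer (swap_var v) = is_fer v"
  by (simp add: is_fer_def)

lemma svar_index_swap_var [simp]: "svar_index (swap_var v) = (if svar_index v = 1 then 2 else 1)"
  by (simp add: swap_var_def)

definition swap_mon :: "smon \<Rightarrow> smon" where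
  "swap_mon m = Poly_Mapping.map_key swap_var m"

lemma lookup_swap_mon [simp]: "lookup (swap_mon m) v = lookup m (swap_var v)"
  by (simp add: swap_mon_def map_key.rep_eq)

lemma swap_mon_simps [simp]:
  "swap_mon 0 = 0" "swap_mon (single v n) = single (swap_var v) n"
  "swap_mon (m + m') = swap_mon m + swap_mon m'" "swap_mon (swap_mon m) = m"
proof -
  have "swap_var v = w \<longleftrightarrow> v = swap_var w" for v w by auto
  then show "swap_mon (single v n) = single (swap_var v) n"
    by (intro poly_mapping_eqI) (auto simp: lookup_single when_def)
qed (auto intro!: poly_mapping_eqI simp: lookup_add)

lemma index_count_swap_mon [simp]:
  "index_count 1 (swap_mon m) = index_count 2 m" "index_count 2 (swap_mon m) = index_count 1 m"
proof -
  have "index_count 1 (swap_mon m) = index_count 2 m" for m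
  proof (induction m rule: poly_mapping_induct)
    case (single v n)
    show ?case using exhaust_2[of "svar_index v"] by auto
  qed (simp_all add: index_count_add)
  from this[of m] this[of "swap_mon m"] show "index_count 1 (swap_mon m) = index_count 2 m"
    "index_count 2 (swap_mon m) = index_count 1 m" by simp_all
qed

lemma smon_deg_swap_mon [simp]: "smon_deg (swap_mon m) = smon_deg m"
  by (induction m rule: poly_mapping_induct) (simp_all add: smon_deg_add)

lemma swap_mon_in_smonomials [simp]: "swap_mon m \<in> smonomials k j \<longleftrightarrow> m \<in> smonomials k j"
proof -
  have "swap_mon m \<in> smonomials k j" if m: "m \<in> smonomials k j" for m
  proof -
    have "keys (swap_mon m) \<subseteq> set (svars k j)"
    proof
      fix v assume "v \<in> keys (swap_mon m)"
      then have "swap_var v \<in> keys m" by (simp add: in_keys_iff)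
      then have "swap_var v \<in> set (svars k j)" using m by (auto simp: smonomials_def)
      then show "v \<in> set (svars k j)" by (simp add: in_set_svars)
    qed
    then show ?thesis using m by (simp add: smonomials_def swap_var_def)
  qed
  from this[of m] this[of "swap_mon m"] show ?thesis by auto
qed

lemma act_svar_diag:
  "act_svar (diag_mat x y) v = sconst (if svar_index v = 1 then x else y) * svar_poly v"
proof -
  have b: "block_var (svar_block v) s = v" if "svar_index v = s" for s
    using that by auto
  show ?thesis
    using exhaust_2[of "svar_index v"] by (auto simp: act_svar_eq sum_2 diag_mat_def b)
qed

lemma act_svar_swap: "act_svar swap_mat v = svar_poly (swap_var v)"
  using exhaust_2[of "svar_index v"]
  by (auto simp: act_svar_eq sum_2 swap_mat_def swap_var_def)

lemma act_diag_single:
  "m \<in> smonomials k j \<Longrightarrow>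
   act k j (diag_mat x y) (single m 1) = single m (x ^ index_count 1 m * y ^ index_count 2 m)"
proof (induction m rule: smonomials_induct)
  case zero
  then show ?case by simp
next
  case (add v m)
  let ?e = "smon_sign (single v 1) m"
  have ee: "?e * (c * (?e * d)) = c * d" for c d
    using smon_sign_square[OF add(2)] by (metis mult.assoc mult.commute mult.right_neutral)
  have "act k j (diag_mat x y) (single (single v 1 + m) 1) =
      single (single v 1 + m) (?e * ((if svar_index v = 1 then x else y) *
        (?e * (x ^ index_count 1 m * y ^ index_count 2 m))))"
    unfolding act_single_var_add[OF add(1,2)] add(3) act_svar_diag svar_poly_def
      sprod_scale_left sprod_single sconst_mult_single 
    by (simp only: mult_ac mult_1_right mult_1_left)
  then show ?case
    using exhaust_2[of "svar_index v"] unfolding ee by (auto simp: index_count_add mult_ac)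
qed

text \<open>
  The sign that arises when the letters \<open>z\<close> and \<open>w\<close> are exchanged in a monomial and the product
  is put back in order.
\<close>

definition swap_coeff :: "nat \<Rightarrow> nat \<Rightarrow> smon \<Rightarrow> complex" where
  "swap_coeff k j m = lookup (act k j swap_mat (single m 1)) (swap_mon m)"

lemma act_swap_single:
  assumes "m \<in> smonomials k j"
  shows "act k j swap_mat (single m c) = single (swap_mon m) (swap_coeff k j m * c)"
proof -
  have "\<exists>\<gamma>. act k j swap_mat (single m 1) = single (swap_mon m) \<gamma>"
    using assms
  proof (induction m rule: smonomials_induct)
    case zero
    then show ?case by (intro exI[of _ 1]) simp
  next
    case (add v m)
    then show ?case
      unfolding act_single_var_add[OF add(1,2)] act_svar_swap
      by (auto simp: svar_poly_def sprod_single)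
  qed
  then have "act k j swap_mat (single m 1) = single (swap_mon m) (swap_coeff k j m)"
    by (auto simp: swap_coeff_def)
  then show ?thesis by (simp add: act_single[of _ _ _ m c] mult.commute)
qed

lemma swap_mat_square: "swap_mat ** swap_mat = mat 1"
  by (simp add: vec_eq_iff forall_2 matrix_matrix_mult_def sum_2 swap_mat_def mat_def)

lemma act_swap_swap: "p \<in> carrier (super_ring k j) \<Longrightarrow> act k j swap_mat (act k j swap_mat p) = p"
  by (simp add: act_act swap_mat_square act_id)

text \<open>
  The exchange of \<open>z\<close> and \<open>w\<close> is an involution.
\<close>

lemma swap_coeff_mult:
  assumes "m \<in> smonomials k j"
  shows "swap_coeff k j m * swap_coeff k j (swap_mon m) = 1"
proof -
  have "single m 1 = act k j swap_mat (act k j swap_mat (single m 1))"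
    using assms by (simp add: act_swap_swap single_closed)
  also have "\<dots> = single m (swap_coeff k j (swap_mon m) * swap_coeff k j m)"
    using assms by (simp add: act_swap_single)
  finally have "lookup (single m (1::complex)) m = lookup (single m (swap_coeff k j (swap_mon m) * swap_coeff k j m)) m"
    by simp
  then show ?thesis by (simp add: mult.commute)
qed

lemma lookup_act_swap:
  assumes "p \<in> carrier (super_ring k j)"
  shows "lookup (act k j swap_mat p) m = swap_coeff k j (swap_mon m) * lookup p (swap_mon m)"
  using assms unfolding carrier_super_ring
proof (induction p rule: poly_mapping_keys_induct)
  case (single x c)
  then show ?case by (auto simp: act_swap_single lookup_single when_def)
qed (simp_all add: act_add lookup_add distrib_left)

lemma lookup_act_diag:
  assumes "p \<in> carrier (super_ring k j)"
  shows "lookup (act k j (diag_mat x y) p) m = x ^ index_count 1 m * y ^ index_count 2 m * lookup p m"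
  using assms unfolding carrier_super_ring
proof (induction p rule: poly_mapping_keys_induct)
  case (single m' c)
  then show ?case
    using act_single[of k j _ m' c] by (simp add: act_diag_single lookup_single when_def)
qed (simp_all add: act_add lookup_add distrib_left)

section \<open>Ideals of the superpolynomial ring\<close>

lemma a_inv_super_ring: "p \<in> carrier (super_ring k j) \<Longrightarrow> \<ominus>\<^bsub>super_ring k j\<^esub> p = - p"
proof -
  interpret R: ring "super_ring k j" by (rule ring_super_ring)
  assume p: "p \<in> carrier (super_ring k j)"
  have "- p \<in> carrier (super_ring k j)" using scale_closed[OF p, of "-1"] by simp
  then show ?thesis using R.minus_equality[of "- p" p] p by simp
qed

text \<open>
  Negation is multiplication by a constant, so that it is covered by closure under products.
\<close>

lemma ideal_super_ringI:
  assumes sub: "I \<subseteq> carrier (super_ring k j)" and "0 \<in> I"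
    and add: "\<And>p q. p \<in> I \<Longrightarrow> q \<in> I \<Longrightarrow> p + q \<in> I"
    and left: "\<And>p q. p \<in> I \<Longrightarrow> q \<in> carrier (super_ring k j) \<Longrightarrow> q \<star> p \<in> I"
    and right: "\<And>p q. p \<in> I \<Longrightarrow> q \<in> carrier (super_ring k j) \<Longrightarrow> p \<star> q \<in> I"
  shows "ideal I (super_ring k j)"
proof (rule idealI[OF ring_super_ring])
  interpret R: ring "super_ring k j" by (rule ring_super_ring)
  show "subgroup I (add_monoid (super_ring k j))"
  proof (rule R.add.subgroupI)
    fix p assume p: "p \<in> I"
    have "sconst (-1) \<star> p \<in> I" using left[OF p sconst_closed] .
    then show "\<ominus>\<^bsub>super_ring k j\<^esub> p \<in> I"
      using p sub a_inv_super_ring[of p k j] sconst_sprod[of p k j "-1"] by auto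
  qed (use assms in auto)
qed (use left right in auto)

context
  fixes k j I assumes I: "ideal I (super_ring k j)"
begin

lemma ideal_carrier: "p \<in> I \<Longrightarrow> p \<in> carrier (super_ring k j)"
  using ideal.Icarr[OF I] .

lemma ideal_add: "p \<in> I \<Longrightarrow> q \<in> I \<Longrightarrow> p + q \<in> I"
  using additive_subgroup.a_closed[OF ideal.axioms(1)[OF I]] by simp

lemma ideal_left: "p \<in> I \<Longrightarrow> q \<in> carrier (super_ring k j) \<Longrightarrow> q \<star> p \<in> I"
  using ideal.I_l_closed[OF I] by simp

lemma ideal_right: "p \<in> I \<Longrightarrow> q \<in> carrier (super_ring k j) \<Longrightarrow> p \<star> q \<in> I"
  using ideal.I_r_closed[OF I] by simp

lemma ideal_scale: "p \<in> I \<Longrightarrow> sconst c * p \<in> I"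
  using ideal_left[OF _ sconst_closed, of p c] sconst_sprod[OF ideal_carrier] by simp

lemma ideal_minus: "p \<in> I \<Longrightarrow> - p \<in> I"
  using ideal_scale[of p "-1"] by simp

lemma ideal_diff: "p \<in> I \<Longrightarrow> q \<in> I \<Longrightarrow> p - q \<in> I"
  using ideal_add[of p "- q"] ideal_minus[of q] by simp

lemma ideal_zero: "0 \<in> I"
  using additive_subgroup.zero_closed[OF ideal.axioms(1)[OF I]] by simp

lemma ideal_sum: "(\<And>x. x \<in> A \<Longrightarrow> f x \<in> I) \<Longrightarrow> sum f A \<in> I"
  by (induction A rule: infinite_finite_induct) (simp_all add: ideal_zero ideal_add)

lemma ideal_scale_iff: "c \<noteq> 0 \<Longrightarrow> p \<in> carrier (super_ring k j) \<Longrightarrow> sconst c * p \<in> I \<longleftrightarrow> p \<in> I"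
proof
  assume "c \<noteq> 0" "sconst c * p \<in> I"
  from this(2) have "sconst (1 / c) * (sconst c * p) \<in> I" by (rule ideal_scale)
  also have "sconst (1 / c) * (sconst c * p) = sconst (1 / c * c) * p"
    by (simp only: sconst_simps mult.assoc)
  finally show "p \<in> I" using \<open>c \<noteq> 0\<close> by simp
qed (rule ideal_scale)

lemma ideal_monomial_multiple:
  assumes "single m 1 \<in> I" "m' + m \<in> smonomials k j"
  shows "single (m' + m) c \<in> I"
  unfolding single_add_eq_sprod[OF assms(2)]
  using smonomials_addD[OF assms(2)] assms(1)
  by (intro ideal_scale ideal_left single_closed)

end

section \<open>The model ideal\<close>

text \<open>
  The coinvariant ideal of the diagonal model is described by conditions on coefficients, for which
  the monomials fall into three classes. Small monomials do not occur in elements of the ideal. At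
  critical monomials, which are those in the basic invariants, the coefficients have to be symmetric
  under the exchange of \<open>z\<close> and \<open>w\<close>. All other monomials lie in the ideal.
\<close>

definition small :: "nat \<Rightarrow> smon \<Rightarrow> bool" where
  "small n m \<longleftrightarrow> (index_count 1 m = 0 \<or> index_count 2 m = 0) \<and> index_count 1 m + index_count 2 m < n"

definition critical :: "nat \<Rightarrow> smon \<Rightarrow> bool" where
  "critical n m \<longleftrightarrow> (index_count 1 m, index_count 2 m) \<in> {(n, 0), (0, n), (1, 1)}"

lemma small_swap_mon [simp]: "small n (swap_mon m) \<longleftrightarrow> small n m"
  by (auto simp: small_def)

lemma critical_swap_mon [simp]: "critical n (swap_mon m) \<longleftrightarrow> critical n m"
  by (auto simp: critical_def)

lemma small_not_critical: "small n m \<Longrightarrow> \<not> critical n m"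
  by (auto simp: small_def critical_def)

definition model_ideal :: "nat \<Rightarrow> nat \<Rightarrow> nat \<Rightarrow> spoly set" where
  "model_ideal n k j = {p \<in> carrier (super_ring k j).
     (\<forall>m. small n m \<longrightarrow> lookup p m = 0) \<and>
     (\<forall>m. critical n m \<longrightarrow> lookup (act k j swap_mat p) m = lookup p m)}"

text \<open>
  This is why the coefficient conditions define an ideal: the product of an element without small
  monomials and an element without constant term involves neither small nor critical monomials.
\<close>

lemma proper_divisor_small:
  assumes "n \<ge> 2" "small n (a + b) \<or> critical n (a + b)" "a \<noteq> 0"
  shows "small n b"
  using assms unfolding smon_eq_zero_iff[of a] by (auto simp: small_def critical_def index_count_add)

lemma lookup_sprod_small_critical:
  assumes n: "n \<ge> 2" and p: "\<And>m. small n m \<Longrightarrow> lookup p m = 0" and q: "lookup q 0 = 0"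
    and m: "small n m \<or> critical n m"
  shows "lookup (q \<star> p) m = 0" "lookup (p \<star> q) m = 0"
proof -
  have no: "\<not> (m = a + b \<and> a \<in> keys q \<and> b \<in> keys p)" for a b
  proof
    assume h: "m = a + b \<and> a \<in> keys q \<and> b \<in> keys p"
    then have "a \<noteq> 0" using q by (auto simp: in_keys_iff)
    then have "small n b" using proper_divisor_small[OF n] m h by blast
    then show False using p h by (auto simp: in_keys_iff)
  qed
  then have "m \<notin> keys (q \<star> p)" using keys_sprod[of q p] by auto
  then show "lookup (q \<star> p) m = 0" by (simp add: in_keys_iff)
  have "m \<notin> keys (p \<star> q)"
  proof
    assume "m \<in> keys (p \<star> q)"
    then obtain b a where "m = b + a" "b \<in> keys p" "a \<in> keys q"
      using keys_sprod[of p q] by auto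
    then show False using no[of a b] by (simp add: add.commute)
  qed
  then show "lookup (p \<star> q) m = 0" by (simp add: in_keys_iff)
qed

lemma model_idealI:
  assumes "p \<in> carrier (super_ring k j)" "\<And>m. small n m \<or> critical n m \<Longrightarrow> lookup p m = 0"
  shows "p \<in> model_ideal n k j"
  unfolding model_ideal_def using assms by (simp add: lookup_act_swap)

lemma ideal_model_ideal:
  assumes n: "n \<ge> 2"
  shows "ideal (model_ideal n k j) (super_ring k j)"
proof (rule ideal_super_ringI)
  let ?J = "model_ideal n k j"
  show add: "p + q \<in> ?J" if "p \<in> ?J" "q \<in> ?J" for p q
    using that by (simp add: model_ideal_def add_closed lookup_add act_add)
  have scale: "sconst c * p \<in> ?J" if "p \<in> ?J" for c p
    using that by (simp add: model_ideal_def scale_closed act_scale)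
  fix p q assume p: "p \<in> ?J" and q: "q \<in> carrier (super_ring k j)"
  have pc: "p \<in> carrier (super_ring k j)" and ps: "\<And>m. small n m \<Longrightarrow> lookup p m = 0"
    using p by (auto simp: model_ideal_def)
  \<comment> \<open>Constants act by scaling; the rest of \<open>q\<close> has no constant term.\<close>
  define q0 where "q0 = q + sconst (- lookup q 0)"
  have q0: "q0 \<in> carrier (super_ring k j)" "lookup q0 0 = 0"
    unfolding q0_def using q by (intro add_closed sconst_closed) (simp_all add: lookup_add sconst_def del: sconst_simps)
  have q_eq: "q = sconst (lookup q 0) + q0" by (simp add: q0_def)
  have "q0 \<star> p \<in> ?J" "p \<star> q0 \<in> ?J"
    using lookup_sprod_small_critical[OF n ps q0(2)] pc q0(1) by (auto intro!: model_idealI sprod_closed)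
  moreover have "sconst c \<star> p = sconst c * p" "p \<star> sconst c = sconst c * p" for c
    using sprod_scale_left[of c 1 p] sprod_scale_right[of p c 1] pc by (simp_all add: one_sprod sprod_one)
  ultimately show "q \<star> p \<in> ?J" "p \<star> q \<in> ?J"
    by (subst q_eq, simp only: sprod_add_left sprod_add_right, intro add, use scale[OF p] in simp_all)+
qed (auto simp: model_ideal_def carrier_super_ring)

text \<open>
  The two matrices are the rotation and the reflection in the basis of eigenvectors of the rotation.
  The argument \<open>z\<close> is an eigenvalue, whereas \<open>z\<close> and \<open>w\<close> in the explanations of the lemmas
  below stand for variables of index 1 and 2.
\<close>

definition model_invariants :: "complex \<Rightarrow> nat \<Rightarrow> nat \<Rightarrow> spoly set" where
  "model_invariants z k j = {p \<in> carrier (super_ring k j).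
     act k j (diag_mat (inverse z) z) p = p \<and> act k j swap_mat p = p \<and> lookup p 0 = 0}"

definition primitive_root :: "nat \<Rightarrow> complex \<Rightarrow> bool" where
  "primitive_root n z \<longleftrightarrow> (\<forall>i. z ^ i = 1 \<longleftrightarrow> n dvd i)"

text \<open>
  Invariance under the exchange of \<open>z\<close> and \<open>w\<close> is the condition at the critical monomials.
  The rotation scales a pure monomial by a power of a primitive \<open>n\<close>-th root of unity whose exponent
  is, up to sign, the degree. So small monomials of positive degree are not fixed by the rotation and
  cannot occur in an invariant.
\<close>

lemma model_invariants_subset:
  assumes z: "primitive_root n z"
  shows "model_invariants z k j \<subseteq> model_ideal n k j"
proof
  fix p assume "p \<in> model_invariants z k j"
  then have p: "p \<in> carrier (super_ring k j)" "act k j (diag_mat (inverse z) z) p = p"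
    "act k j swap_mat p = p" "lookup p 0 = 0" by (simp_all add: model_invariants_def)
  have "lookup p m = 0" if "small n m" for m
  proof (cases "m = 0")
    case False
    let ?c = "inverse z ^ index_count 1 m * z ^ index_count 2 m"
    let ?i = "index_count 1 m + index_count 2 m"
    have "\<not> n dvd ?i"
      using False that unfolding smon_eq_zero_iff[of m] small_def
      by (metis add_gr_0 neq0_conv nat_dvd_not_less)
    then have "z ^ ?i \<noteq> 1" using z by (simp add: primitive_root_def)
    then have "?c \<noteq> 1"
      using that by (auto simp: small_def power_inverse)
    moreover have "lookup p m = ?c * lookup p m"
      using lookup_act_diag[OF p(1), of "inverse z" z m] p(2) by simp
    ultimately show ?thesis by simp
  qed (use p in simp)
  then show "p \<in> model_ideal n k j" using p by (simp add: model_ideal_def)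
qed

lemma primitive_root_nonzero: "primitive_root n z \<Longrightarrow> n \<noteq> 0 \<Longrightarrow> z \<noteq> 0"
  unfolding primitive_root_def by (metis dvd_refl power_0_left zero_neq_one)

text \<open>
  The polarizations of the invariant quadratic form \<open>z w\<close>.
\<close>

lemma mixed_pair_invariant:
  assumes z: "z \<noteq> 0" and v: "v \<in> set (svars k j)" and w: "w \<in> set (svars k j)"
    and eq: "svar_index v = svar_index w"
  shows "svar_poly v \<star> svar_poly (swap_var w) + svar_poly (swap_var v) \<star> svar_poly w
           \<in> model_invariants z k j"
proof -
  have sv: "swap_var v \<in> set (svars k j)" "swap_var w \<in> set (svars k j)"
    using v w by (simp_all add: in_set_svars)
  note cl = svar_poly_closed[OF v] svar_poly_closed[OF w] svar_poly_closed[OF sv(1)] svar_poly_closed[OF sv(2)]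
  have "act k j (diag_mat (inverse z) z) (svar_poly x \<star> svar_poly y) = svar_poly x \<star> svar_poly y"
    if "x \<in> set (svars k j)" "y \<in> set (svars k j)" "svar_index x \<noteq> svar_index y" for x y
  proof -
    let ?c = "\<lambda>v. if svar_index v = 1 then inverse z else z"
    have "?c y * ?c x = 1"
      using that(3) z exhaust_2[of "svar_index x"] exhaust_2[of "svar_index y"] by auto
    then have "sconst (?c y) * (sconst (?c x) * q) = q" for q
      by (metis mult.assoc mult_1_left sconst_simps(2,4))
    then show ?thesis
      by (simp only: act_mult[OF svar_poly_closed[OF that(1)] svar_poly_closed[OF that(2)]]
          act_var[OF that(1)] act_var[OF that(2)] act_svar_diag sprod_scale_left sprod_scale_right)
  qed
  from this[OF v sv(2)] this[OF sv(1) w] eq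
  have "act k j (diag_mat (inverse z) z) (svar_poly v \<star> svar_poly (swap_var w) + svar_poly (swap_var v) \<star> svar_poly w)
      = svar_poly v \<star> svar_poly (swap_var w) + svar_poly (swap_var v) \<star> svar_poly w"
    using exhaust_2[of "svar_index v"] exhaust_2[of "svar_index w"] by (auto simp: act_add)
  moreover have "act k j swap_mat (svar_poly v \<star> svar_poly (swap_var w) + svar_poly (swap_var v) \<star> svar_poly w)
      = svar_poly v \<star> svar_poly (swap_var w) + svar_poly (swap_var v) \<star> svar_poly w"
    using cl v w sv by (simp add: act_add act_mult act_var act_svar_swap add.commute)
  moreover have "single x 1 + single y 1 \<noteq> (0 :: smon)" for x y
    unfolding smon_eq_zero_iff using exhaust_2[of "svar_index x"] by (auto simp: index_count_add)
  then have "lookup (svar_poly x \<star> svar_poly y) 0 = 0" for x y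
    by (simp add: svar_poly_def sprod_single lookup_single when_def)
  ultimately show ?thesis
    using cl by (simp add: model_invariants_def add_closed sprod_closed lookup_add)
qed

lemma index_count_swap_mon_neq: "s \<noteq> t \<Longrightarrow> index_count s (swap_mon m) = index_count t m"
  using exhaust_2[of s] exhaust_2[of t] by auto

lemma submonomial:
  assumes "N \<le> index_count s m"
  shows "\<exists>a b. m = a + b \<and> index_count s b = N"
  using assms
proof (induction N)
  case 0
  show ?case by (intro exI[of _ m] exI[of _ 0]) simp
next
  case (Suc N)
  then obtain a b where ab: "m = a + b" "index_count s b = N" by auto
  then have "0 < index_count s a" using Suc.prems by (simp add: index_count_add)
  then obtain v where v: "v \<in> keys a" "svar_index v = s" by (auto simp: index_count_pos_iff)
  obtain a' where a: "a = single v 1 + a'" using v(1) by (rule exists_var_summand)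
  show ?case
    by (rule exI[of _ a'], rule exI[of _ "single v 1 + b"])
       (use v(2) ab in \<open>simp add: a index_count_add add_ac\<close>)
qed

context
  fixes n k j z I
  assumes n: "n \<ge> 2" and z: "primitive_root n z"
    and I: "ideal I (super_ring k j)" and inv: "model_invariants z k j \<subseteq> I"
begin

text \<open>
  Write a prime for \<open>swap_var\<close>. Modulo the ideal, moving the prime to a neighbouring factor
  changes the sign, so \<open>u v w' = - u v' w = u' v w\<close>. After exchanging \<open>v\<close> and \<open>w\<close>, which
  costs a sign \<open>e\<close>, the prime is moved back from \<open>u\<close> to \<open>w\<close>, and exchanging again gives
  \<open>u' v w = - u v w'\<close>. So twice the product vanishes.
\<close>

lemma mixed_triple_in_ideal:
  assumes V: "u \<in> set (svars k j)" "v \<in> set (svars k j)" "w \<in> set (svars k j)"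
    and s: "svar_index u = s" "svar_index v = s" "svar_index w = s"
  shows "svar_poly u \<star> (svar_poly v \<star> svar_poly (swap_var w)) \<in> I"
proof -
  note z0 = primitive_root_nonzero[OF z]
  let ?x = "\<lambda>v. svar_poly v" and ?y = "\<lambda>v. svar_poly (swap_var v)"
  have V': "swap_var u \<in> set (svars k j)" "swap_var v \<in> set (svars k j)" "swap_var w \<in> set (svars k j)"
    using V by (simp_all add: in_set_svars)
  have pair: "?x a \<star> ?y b + ?y a \<star> ?x b \<in> I"
    if "a \<in> set (svars k j)" "b \<in> set (svars k j)" "svar_index a = s" "svar_index b = s" for a b
    using mixed_pair_invariant[of z a k j b] that z0 n inv by auto
  define e where "e = koszul v w"
  have e: "e * e = 1" by (simp add: e_def koszul_def)
  have 1: "?x u \<star> (?x v \<star> ?y w) + ?x u \<star> (?y v \<star> ?x w) \<in> I"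
    using ideal_left[OF I pair[OF V(2,3) s(2,3)] svar_poly_closed[OF V(1)]]
    by (simp add: sprod_add_right)
  have 2: "?x u \<star> (?y v \<star> ?x w) + ?y u \<star> (?x v \<star> ?x w) \<in> I"
    using ideal_right[OF I pair[OF V(1,2) s(1,2)] svar_poly_closed[OF V(3)]]
    by (simp add: sprod_add_left sprod_assoc)
  have 3: "?x u \<star> (?y w \<star> ?x v) + ?y u \<star> (?x w \<star> ?x v) \<in> I"
    using ideal_right[OF I pair[OF V(1,3) s(1,3)] svar_poly_closed[OF V(2)]]
    by (simp add: sprod_add_left sprod_assoc)
  have k1: "?x v \<star> ?x w = sconst e * (?x w \<star> ?x v)"
    unfolding e_def by (rule supercommutingD[OF supercommuting_svar_poly])
  have "koszul v (swap_var w) = e" by (simp add: e_def koszul_def)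
  then have k2: "?x v \<star> ?y w = sconst e * (?y w \<star> ?x v)"
    using supercommutingD[OF supercommuting_svar_poly, of v "swap_var w"] by simp
  \<comment> \<open>Exchanging \<open>v\<close> and \<open>w\<close> in both terms of 3 produces the same sign \<open>e\<close>.\<close>
  have 4: "?x u \<star> (?x v \<star> ?y w) + ?y u \<star> (?x v \<star> ?x w) \<in> I"
    using ideal_scale[OF I 3, of e]
    unfolding k1 k2 sprod_scale_right by (simp add: distrib_left)
  have "sconst 2 * (?x u \<star> (?x v \<star> ?y w)) \<in> I"
  proof -
    have "sconst 2 = (1 + 1 :: spoly)" by (metis one_add_one sconst_simps(2,3))
    then have "sconst 2 * (?x u \<star> (?x v \<star> ?y w)) =
      (?x u \<star> (?x v \<star> ?y w) + ?x u \<star> (?y v \<star> ?x w))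
      - (?x u \<star> (?y v \<star> ?x w) + ?y u \<star> (?x v \<star> ?x w))
      + (?x u \<star> (?x v \<star> ?y w) + ?y u \<star> (?x v \<star> ?x w))"
      by (simp add: distrib_right)
    also have "\<dots> \<in> I" by (intro ideal_add[OF I] ideal_diff[OF I] 1 2 4)
    finally show ?thesis .
  qed
  then show ?thesis
    using V V' by (subst (asm) ideal_scale_iff[OF I]) (auto intro!: sprod_closed svar_poly_closed)
qed

lemma large_mixed_in_ideal:
  assumes m: "m \<in> smonomials k j" and st: "s \<noteq> t"
    and s: "2 \<le> index_count s m" and t: "1 \<le> index_count t m"
  shows "single m c \<in> I"
proof -
  obtain u where u: "u \<in> keys m" "svar_index u = s"
    using s index_count_pos_iff[of s m] by auto
  obtain m1 where m1: "m = single u 1 + m1" using u(1) by (rule exists_var_summand)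
  have "0 < index_count s m1" using s u by (simp add: m1 index_count_add)
  then obtain v where v: "v \<in> keys m1" "svar_index v = s" by (auto simp: index_count_pos_iff)
  obtain m2 where m2: "m1 = single v 1 + m2" using v(1) by (rule exists_var_summand)
  have "0 < index_count t m2" using t st u v by (simp add: m1 m2 index_count_add)
  then obtain w where w: "w \<in> keys m2" "svar_index w = t" by (auto simp: index_count_pos_iff)
  obtain m3 where m3: "m2 = single w 1 + m3" using w(1) by (rule exists_var_summand)
  have m_eq: "m = m3 + (single u 1 + (single v 1 + single w 1))"
    by (simp add: m1 m2 m3 add_ac)
  have uvw: "single u 1 + (single v 1 + single w 1) \<in> smonomials k j"
    using smonomials_addD(2)[OF m[unfolded m_eq]] .
  have vw: "single v 1 + single w 1 \<in> smonomials k j"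
    using smonomials_addD(2)[OF uvw] .
  have V: "u \<in> set (svars k j)" "v \<in> set (svars k j)" "w \<in> set (svars k j)"
    using smonomials_addD[OF uvw] smonomials_addD[OF vw] by (simp_all only: single_var_in_smonomials)
  have "swap_var w \<in> set (svars k j)" using V by (simp add: in_set_svars)
  moreover have "svar_index (swap_var w) = s"
    using w(2) st exhaust_2[of s] exhaust_2[of t] by auto
  ultimately have "svar_poly u \<star> (svar_poly v \<star> svar_poly w) \<in> I"
    using mixed_triple_in_ideal[of u v "swap_var w" s] V u v by simp
  then have "single (single u 1 + (single v 1 + single w 1)) 1 \<in> I"
    unfolding single_add_eq_sprod[OF uvw] single_add_eq_sprod[OF vw] svar_poly_def sprod_scale_right
    by (intro ideal_scale[OF I])
  then show ?thesis
    unfolding m_eq by (rule ideal_monomial_multiple[OF I _ m[unfolded m_eq]])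
qed

text \<open>
  The polarizations of the invariant \<open>z\<^sup>n + w\<^sup>n\<close>: the rotation fixes both terms because
  its eigenvalues are \<open>n\<close>-th roots of unity.
\<close>

lemma critical_power_invariant:
  assumes m: "m \<in> smonomials k j" and st: "s \<noteq> t" and "index_count s m = n" "index_count t m = 0"
  shows "single m 1 + single (swap_mon m) (swap_coeff k j m) \<in> model_invariants z k j"
proof -
  have zn: "z ^ n = 1" using z by (simp add: primitive_root_def)
  have ic: "index_count 1 m = n \<and> index_count 2 m = 0 \<or> index_count 1 m = 0 \<and> index_count 2 m = n"
    using assms(2-4) exhaust_2[of s] exhaust_2[of t] by auto
  let ?p = "single m 1 + single (swap_mon m) (swap_coeff k j m)"
  have p: "?p \<in> carrier (super_ring k j)"
    using m by (intro add_closed single_closed) simp_all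
  have "act k j (diag_mat (inverse z) z) ?p = ?p"
    using ic zn by (intro poly_mapping_eqI)
      (auto simp: lookup_act_diag[OF p] lookup_add lookup_single when_def power_inverse)
  moreover have "act k j swap_mat ?p = ?p"
    using m swap_coeff_mult[OF m]
    by (simp add: act_add act_swap_single add.commute mult.commute)
  moreover have "m \<noteq> 0" "swap_mon m \<noteq> 0"
    using n ic unfolding smon_eq_zero_iff by auto
  ultimately show ?thesis
    using p by (simp add: model_invariants_def lookup_add lookup_single when_def)
qed

text \<open>
  Replacing \<open>n\<close> of the factors \<open>z\<close> by \<open>w\<close>, with a change of sign, does not alter the monomial
  modulo the ideal, but makes it a mixed monomial of degree at least 3.
\<close>

lemma large_pure_in_ideal:
  assumes m: "m \<in> smonomials k j" and st: "s \<noteq> t"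
    and s: "n < index_count s m" and t: "index_count t m = 0"
  shows "single m c \<in> I"
proof -
  obtain a b where ab: "m = a + b" "index_count s b = n"
    using submonomial[of n s m] s by auto
  have a: "a \<in> smonomials k j" and b: "b \<in> smonomials k j"
    using smonomials_addD m ab by blast+
  have b0: "index_count t b = 0" and a1: "1 \<le> index_count s a"
    using s t ab by (simp_all add: index_count_add)
  have swap: "single (a + swap_mon b) d \<in> I" if "a + swap_mon b \<in> smonomials k j" for d
  proof (rule large_mixed_in_ideal[OF that])
    show "t \<noteq> s" using st by simp
    show "2 \<le> index_count t (a + swap_mon b)"
      using n st ab(2) by (simp add: index_count_add index_count_swap_mon_neq[of t s])
    show "1 \<le> index_count s (a + swap_mon b)"
      using a1 by (simp add: index_count_add)
  qed
  have "single (a + swap_mon b) (smon_sign a (swap_mon b) * d) \<in> I" for d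
    using swap[of "smon_sign a (swap_mon b) * d"] smonomials_add_iff[OF a, of "swap_mon b"] b
    by (cases "smon_sign a (swap_mon b) = 0") (auto simp: ideal_zero[OF I])
  moreover have "single a 1 \<star> (single b 1 + single (swap_mon b) (swap_coeff k j b)) \<in> I"
    using critical_power_invariant[OF b st ab(2) b0] inv
    by (intro ideal_left[OF I] single_closed[OF a]) auto
  ultimately have "single a 1 \<star> (single b 1 + single (swap_mon b) (swap_coeff k j b))
       - single (a + swap_mon b) (smon_sign a (swap_mon b) * swap_coeff k j b) \<in> I"
    by (intro ideal_diff[OF I])
  then have "single a 1 \<star> single b 1 \<in> I"
    by (simp add: sprod_add_right sprod_single)
  then show ?thesis
    unfolding ab(1) single_add_eq_sprod[OF m[unfolded ab(1)]] by (rule ideal_scale[OF I])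
qed

lemma large_in_ideal:
  assumes m: "m \<in> smonomials k j" and "\<not> small n m" "\<not> critical n m"
  shows "single m c \<in> I"
proof -
  let ?a = "index_count 1 m" and ?b = "index_count 2 m"
  have "2 \<le> ?a \<and> 1 \<le> ?b \<or> 1 \<le> ?a \<and> 2 \<le> ?b \<or> n < ?a \<and> ?b = 0 \<or> ?a = 0 \<and> n < ?b"
    using assms(2,3) by (simp add: small_def critical_def) presburger
  then consider "2 \<le> ?a" "1 \<le> ?b" | "1 \<le> ?a" "2 \<le> ?b" | "n < ?a" "?b = 0" | "?a = 0" "n < ?b"
    by metis
  then show ?thesis
  proof cases
    case 1 then show ?thesis using large_mixed_in_ideal[OF m, of 1 2] by simp
  next
    case 2 then show ?thesis using large_mixed_in_ideal[OF m, of 2 1] by simp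
  next
    case 3 then show ?thesis using large_pure_in_ideal[OF m, of 1 2] by simp
  next
    case 4 then show ?thesis using large_pure_in_ideal[OF m, of 2 1] by simp
  qed
qed

text \<open>
  The large monomials of an element of the model ideal can be removed within any ideal that contains
  the invariants. What is left is supported on critical monomials, which the rotation fixes, and its
  symmetry there says that it is an invariant itself.
\<close>

lemma model_ideal_subset: "model_ideal n k j \<subseteq> I"
proof
  fix p assume p: "p \<in> model_ideal n k j"
  then have pc: "p \<in> carrier (super_ring k j)" by (simp add: model_ideal_def)
  define L where "L = {m \<in> keys p. \<not> critical n m}"
  define q where "q = (\<Sum>m\<in>L. single m (lookup p m))"
  have L: "m \<in> smonomials k j" "\<not> small n m" "\<not> critical n m" if "m \<in> L" for m
    using that p pc by (auto simp: L_def model_ideal_def carrier_super_ring in_keys_iff)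
  have q: "q \<in> I" unfolding q_def by (intro ideal_sum[OF I] large_in_ideal L)
  have "finite L" by (simp add: L_def)
  then have "lookup q m = (if m \<in> L then lookup p m else 0)" for m
    unfolding q_def by (simp add: lookup_sum lookup_single when_def sum.delta)
  then have look: "lookup (p - q) m = (if critical n m then lookup p m else 0)" for m
    by (auto simp: lookup_minus L_def in_keys_iff)
  have r: "p - q \<in> carrier (super_ring k j)"
    using add_closed[OF pc, of "- q"] scale_closed[OF ideal_carrier[OF I q], of "-1"] by simp
  have z0: "z \<noteq> 0" using primitive_root_nonzero[OF z] n by simp
  have zn: "z ^ n = 1" using z by (simp add: primitive_root_def)
  have "act k j (diag_mat (inverse z) z) (p - q) = p - q"
    using z0 zn by (intro poly_mapping_eqI)
      (auto simp: lookup_act_diag[OF r] look critical_def power_inverse)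
  moreover have "act k j swap_mat (p - q) = p - q"
  proof (rule poly_mapping_eqI)
    fix m
    have "critical n m \<Longrightarrow> lookup p m = swap_coeff k j (swap_mon m) * lookup p (swap_mon m)"
      using p lookup_act_swap[OF pc, of m] by (simp add: model_ideal_def)
    then show "lookup (act k j swap_mat (p - q)) m = lookup (p - q) m"
      by (simp add: lookup_act_swap[OF r] look)
  qed
  moreover have "lookup (p - q) 0 = 0"
    using n by (simp add: look critical_def)
  ultimately have "p - q \<in> I"
    using r inv by (auto simp: model_invariants_def)
  from ideal_add[OF I this q] show "p \<in> I" by simp
qed

end

section \<open>Change of basis\<close>

lemma group_GL2: "group GL2"
proof (rule groupI)
  fix A assume "A \<in> carrier GL2"
  then obtain B where "A ** B = mat 1" "B ** A = mat 1"
    by (auto simp: GL2_def invertible_def)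
  then show "\<exists>B\<in>carrier GL2. B \<otimes>\<^bsub>GL2\<^esub> A = \<one>\<^bsub>GL2\<^esub>"
    by (intro bexI[of _ B]) (auto simp: GL2_def invertible_def)
next
  have "invertible (mat 1 :: complex^2^2)"
    unfolding invertible_def by (rule exI[of _ "mat 1"]) simp
  then show "\<one>\<^bsub>GL2\<^esub> \<in> carrier GL2" by (simp add: GL2_def)
qed (simp_all add: GL2_def invertible_mult matrix_mul_assoc)

lemma act_generate_fixed:
  assumes p: "p \<in> carrier (super_ring k j)" and H: "H \<subseteq> carrier GL2"
    and fixed: "\<And>h. h \<in> H \<Longrightarrow> act k j h p = p" and g: "g \<in> generate GL2 H"
  shows "act k j g p = p"
  using g
proof induction
  case one
  then show ?case using act_id[OF p] by (simp add: GL2_def)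
next
  case (incl h)
  then show ?case by (rule fixed)
next
  case (inv h)
  interpret group GL2 by (rule group_GL2)
  have "inv\<^bsub>GL2\<^esub> h ** h = mat 1"
    using l_inv[of h] inv H by (auto simp: GL2_def)
  then have "act k j (inv\<^bsub>GL2\<^esub> h) (act k j h p) = p"
    by (simp add: act_act[OF p] act_id[OF p])
  then show ?case by (simp add: fixed[OF inv])
next
  case (eng g h)
  then have "act k j g (act k j h p) = p" by simp
  then show ?case by (simp add: act_act[OF p] GL2_def)
qed

text \<open>
  The columns are eigenvectors of all rotations, exchanged by the reflection.
\<close>

definition eigen_mat :: "complex^2^2" where
  "eigen_mat = vector [vector [1, 1], vector [\<i>, - \<i>]]"

definition eigen_mat_inv :: "complex^2^2" where
  "eigen_mat_inv = vector [vector [1 / 2, - \<i> / 2], vector [1 / 2, \<i> / 2]]"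

definition rotation_eigenvalue :: "nat \<Rightarrow> complex" where
  "rotation_eigenvalue n = exp (2 * of_real pi * \<i> / of_nat n)"

lemma primitive_root_rotation_eigenvalue:
  assumes "n \<noteq> 0"
  shows "primitive_root n (rotation_eigenvalue n)"
  unfolding primitive_root_def
proof
  fix i
  have "rotation_eigenvalue n ^ i = exp (2 * of_real pi * \<i> * of_nat i / of_nat n)"
    unfolding rotation_eigenvalue_def exp_of_nat_mult[symmetric] by (simp add: mult_ac)
  then show "rotation_eigenvalue n ^ i = 1 \<longleftrightarrow> n dvd i"
    using complex_root_unity_eq_1[of n i] assms by simp
qed

lemma rotation_eigenvalue_eq:
  "rotation_eigenvalue n = cos (2 * of_real pi / of_nat n) + \<i> * sin (2 * of_real pi / of_nat n)"
  "inverse (rotation_eigenvalue n) = cos (2 * of_real pi / of_nat n) - \<i> * sin (2 * of_real pi / of_nat n)"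
proof -
  let ?x = "2 * of_real pi / of_nat n :: complex"
  show 1: "rotation_eigenvalue n = cos ?x + \<i> * sin ?x"
    unfolding rotation_eigenvalue_def exp_Euler[symmetric] by (simp add: mult_ac)
  have "(cos ?x + \<i> * sin ?x) * (cos ?x - \<i> * sin ?x) = cos ?x ^ 2 + sin ?x ^ 2"
    by (simp add: algebra_simps power2_eq_square)
  also have "\<dots> = 1" by simp
  finally show "inverse (rotation_eigenvalue n) = cos ?x - \<i> * sin ?x"
    unfolding 1 by (rule inverse_unique)
qed

lemma eigen_mat_inverse: "eigen_mat_inv ** eigen_mat = mat 1" "eigen_mat ** eigen_mat_inv = mat 1"
  by (simp_all add: vec_eq_iff forall_2 matrix_matrix_mult_def sum_2 eigen_mat_def eigen_mat_inv_def mat_def)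

lemma rotation_eigen_mat:
  "rotation_mat n ** eigen_mat =
   eigen_mat ** diag_mat (inverse (rotation_eigenvalue n)) (rotation_eigenvalue n)"
  by (simp add: vec_eq_iff forall_2 matrix_matrix_mult_def sum_2 eigen_mat_def rotation_mat_def
      diag_mat_def rotation_eigenvalue_eq(2)) (simp add: rotation_eigenvalue_eq(1) algebra_simps)

lemma reflection_eigen_mat: "reflection_mat ** eigen_mat = eigen_mat ** swap_mat"
  by (simp add: vec_eq_iff forall_2 matrix_matrix_mult_def sum_2 eigen_mat_def reflection_mat_def
      swap_mat_def)

lemma eigen_mat_inv_commute:
  assumes "A ** eigen_mat = eigen_mat ** B"
  shows "eigen_mat_inv ** A = B ** eigen_mat_inv"
proof -
  have "eigen_mat_inv ** A = eigen_mat_inv ** ((A ** eigen_mat) ** eigen_mat_inv)"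
    by (simp add: matrix_mul_assoc[symmetric] eigen_mat_inverse)
  also have "\<dots> = (eigen_mat_inv ** eigen_mat) ** (B ** eigen_mat_inv)"
    unfolding assms by (simp add: matrix_mul_assoc)
  finally show ?thesis by (simp add: eigen_mat_inverse)
qed

lemma dihedral_generators_GL2: "{rotation_mat n, reflection_mat} \<subseteq> carrier GL2"
proof -
  have "det (rotation_mat n) \<noteq> 0" "det reflection_mat \<noteq> 0"
    by (simp_all add: det_2 rotation_mat_def reflection_mat_def power2_eq_square[symmetric])
  then show ?thesis by (simp add: GL2_def invertible_det_nz)
qed

lemma ideal_act_vimage:
  assumes I: "ideal I (super_ring k j)"
  shows "ideal {p \<in> carrier (super_ring k j). act k j g p \<in> I} (super_ring k j)"
  by (rule ideal_super_ringI)
     (auto simp: act_add act_mult act_closed add_closed sprod_closed ideal_zero[OF I]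
        ideal_add[OF I] ideal_left[OF I] ideal_right[OF I],
      simp add: carrier_super_ring)

text \<open>
  The change of variables is an automorphism of the algebra which conjugates the generators of the
  dihedral group to the diagonal matrix and the exchange of the model. It therefore matches
  invariants, and hence the ideals which they generate.
\<close>

lemma coinv_ideal_dihedral:
  assumes n: "n \<ge> 2"
  shows "coinv_ideal (dihedral n) k j =
         {p \<in> carrier (super_ring k j). act k j eigen_mat_inv p \<in> model_ideal n k j}"
    (is "_ = ?J")
proof
  let ?z = "rotation_eigenvalue n"
  let ?X = "{p \<in> invariants (dihedral n) k j. lookup p 0 = 0}"
  let ?\<delta> = "diag_mat (inverse ?z) ?z"
  interpret R: ring "super_ring k j" by (rule ring_super_ring)
  have z: "primitive_root n ?z" using n by (intro primitive_root_rotation_eigenvalue) simp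
  have X: "?X \<subseteq> carrier (super_ring k j)" by (auto simp: invariants_def)
  have "ideal ?J (super_ring k j)"
    by (rule ideal_act_vimage[OF ideal_model_ideal[OF n]])
  moreover have "?X \<subseteq> ?J"
  proof
    fix p assume "p \<in> ?X"
    then have p: "p \<in> carrier (super_ring k j)" "lookup p 0 = 0"
      and fixed: "\<And>g. g \<in> dihedral n \<Longrightarrow> act k j g p = p"
      by (auto simp: invariants_def)
    have gen: "rotation_mat n \<in> dihedral n" "reflection_mat \<in> dihedral n"
      by (auto simp: dihedral_def intro: generate.incl)
    have "act k j B (act k j eigen_mat_inv p) = act k j eigen_mat_inv p"
      if AB: "A ** eigen_mat = eigen_mat ** B" and A: "A \<in> dihedral n" for A B
    proof -
      have "act k j B (act k j eigen_mat_inv p) = act k j (eigen_mat_inv ** A) p"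
        unfolding eigen_mat_inv_commute[OF AB] by (rule act_act[OF p(1)])
      also have "\<dots> = act k j eigen_mat_inv (act k j A p)"
        by (rule act_act[OF p(1), symmetric])
      finally show ?thesis unfolding fixed[OF A] .
    qed
    from this[OF rotation_eigen_mat gen(1)] this[OF reflection_eigen_mat gen(2)]
    have "act k j eigen_mat_inv p \<in> model_invariants ?z k j"
      using lookup_act_zero[OF p] by (simp add: model_invariants_def act_closed)
    then show "p \<in> ?J" using model_invariants_subset[OF z] p(1) by auto
  qed
  ultimately show "coinv_ideal (dihedral n) k j \<subseteq> ?J"
    unfolding coinv_ideal_def by (rule R.genideal_minimal)
  have I: "ideal (coinv_ideal (dihedral n) k j) (super_ring k j)"
    unfolding coinv_ideal_def by (rule R.genideal_ideal[OF X])
  let ?I = "{p \<in> carrier (super_ring k j). act k j eigen_mat p \<in> coinv_ideal (dihedral n) k j}"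
  have "model_invariants ?z k j \<subseteq> ?I"
  proof
    fix p assume "p \<in> model_invariants ?z k j"
    then have p: "p \<in> carrier (super_ring k j)" "act k j ?\<delta> p = p" "act k j swap_mat p = p"
      "lookup p 0 = 0" by (simp_all add: model_invariants_def)
    let ?q = "act k j eigen_mat p"
    have "act k j A ?q = ?q" if AB: "A ** eigen_mat = eigen_mat ** B" and B: "act k j B p = p" for A B
    proof -
      have "act k j A ?q = act k j (eigen_mat ** B) p"
        unfolding AB[symmetric] by (rule act_act[OF p(1)])
      also have "\<dots> = act k j eigen_mat (act k j B p)"
        by (rule act_act[OF p(1), symmetric])
      finally show ?thesis unfolding B .
    qed
    from this[OF rotation_eigen_mat p(2)] this[OF reflection_eigen_mat p(3)]
    have gen: "act k j (rotation_mat n) ?q = ?q" "act k j reflection_mat ?q = ?q" .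
    have "act k j g ?q = ?q" if "g \<in> dihedral n" for g
    proof (rule act_generate_fixed[OF act_closed dihedral_generators_GL2[of n]])
      show "g \<in> generate GL2 {rotation_mat n, reflection_mat}"
        using that by (simp add: dihedral_def)
    qed (use gen in auto)
    then have "?q \<in> ?X"
      using lookup_act_zero[OF p(1,4)] by (simp add: invariants_def act_closed)
    then have "?q \<in> coinv_ideal (dihedral n) k j"
      unfolding coinv_ideal_def using R.genideal_self[OF X] by auto
    then show "p \<in> ?I" using p(1) by simp
  qed
  then have sub: "model_ideal n k j \<subseteq> ?I"
    by (rule model_ideal_subset[OF n z ideal_act_vimage[OF I, of eigen_mat]])
  show "?J \<subseteq> coinv_ideal (dihedral n) k j"
  proof
    fix p assume "p \<in> ?J"
    then have p: "p \<in> carrier (super_ring k j)" "act k j eigen_mat_inv p \<in> model_ideal n k j" by auto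
    then have "act k j eigen_mat (act k j eigen_mat_inv p) \<in> coinv_ideal (dihedral n) k j"
      using sub by blast
    then show "p \<in> coinv_ideal (dihedral n) k j"
      using p(1) by (simp add: act_act eigen_mat_inverse act_id)
  qed
qed

section \<open>Dimensions of quotient components\<close>

lemma sconst_sprod_sconst: "sconst a \<star> sconst b = sconst (a * b)"
  using sconst_sprod[OF sconst_closed, of a b] by simp

lemma subfield_scalars: "subfield (range sconst) (super_ring k j)"
proof -
  interpret R: ring "super_ring k j" by (rule ring_super_ring)
  show ?thesis
  proof (rule R.subfieldI)
    show "subcring (range sconst) (super_ring k j)"
    proof (rule R.subcringI[OF R.subringI])
      show "range sconst \<subseteq> carrier (super_ring k j)" using sconst_closed by blast
      show "\<one>\<^bsub>super_ring k j\<^esub> \<in> range sconst"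
        using sconst_simps(2) by (simp, metis rangeI)
      fix h1 h2 assume h: "h1 \<in> range sconst" "h2 \<in> range sconst"
      then obtain a b where ab: "h1 = sconst a" "h2 = sconst b" by blast
      have "\<ominus>\<^bsub>super_ring k j\<^esub> h1 = sconst (- a)"
        unfolding ab using a_inv_super_ring[OF sconst_closed, of k j a] by simp
      then show "\<ominus>\<^bsub>super_ring k j\<^esub> h1 \<in> range sconst" by (metis rangeI)
      show "h1 \<otimes>\<^bsub>super_ring k j\<^esub> h2 \<in> range sconst"
        unfolding ab super_ring_simps sconst_sprod_sconst by (rule rangeI)
      show "h1 \<oplus>\<^bsub>super_ring k j\<^esub> h2 \<in> range sconst"
        unfolding ab super_ring_simps sconst_simps(3)[symmetric] by (rule rangeI)
      show "h1 \<otimes>\<^bsub>super_ring k j\<^esub> h2 = h2 \<otimes>\<^bsub>super_ring k j\<^esub> h1"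
        unfolding ab super_ring_simps sconst_sprod_sconst by (simp only: mult.commute)
    qed
    show "Units (super_ring k j\<lparr>carrier := range sconst\<rparr>) = range sconst - {\<zero>\<^bsub>super_ring k j\<^esub>}"
    proof (rule Set.set_eqI, rule iffI)
      fix x assume "x \<in> Units (super_ring k j\<lparr>carrier := range sconst\<rparr>)"
      then obtain a b where x: "x = sconst a" "sconst b \<star> sconst a = 1"
        by (auto simp: Units_def)
      then have "x \<noteq> 0" by auto
      then show "x \<in> range sconst - {\<zero>\<^bsub>super_ring k j\<^esub>}" using x(1) by simp
    next
      fix x assume "x \<in> range sconst - {\<zero>\<^bsub>super_ring k j\<^esub>}"
      then obtain a where x: "x = sconst a" and "x \<noteq> 0" by auto
      then have a: "a \<noteq> 0" by auto
      have "sconst (inverse a) \<star> sconst a = 1" "sconst a \<star> sconst (inverse a) = 1"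
        unfolding sconst_sprod_sconst using a by (metis left_inverse right_inverse sconst_simps(2))+
      then show "x \<in> Units (super_ring k j\<lparr>carrier := range sconst\<rparr>)"
        unfolding Units_def by (auto simp: x)
    qed
  qed
qed

lemma combine_super_ring:
  assumes "distinct xs" "\<And>x. x \<in> set xs \<Longrightarrow> f x \<in> carrier (super_ring k j)"
  shows "ring.combine (super_ring k j) (map (\<lambda>x. sconst (c x)) xs) (map f xs)
         = (\<Sum>x\<in>set xs. sconst (c x) * f x)"
proof -
  interpret R: ring "super_ring k j" by (rule ring_super_ring)
  show ?thesis
    using assms by (induction xs) (simp_all add: sconst_sprod[where k = k and j = j])
qed

text \<open>
  Dimensions of subspaces of a ring over a subfield are defined through lists of ring elements. Here
  they are reduced to finite linear combinations modulo the ideal with complex coefficients.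
\<close>

lemma dim_quotient_component:
  assumes I: "ideal I (super_ring k j)" and one: "1 \<notin> I"
    and B: "finite B" and f: "\<And>b. b \<in> B \<Longrightarrow> f b \<in> super_component k j d"
    and span: "\<And>p. p \<in> super_component k j d \<Longrightarrow> \<exists>c. p - (\<Sum>b\<in>B. sconst (c b) * f b) \<in> I"
    and indep: "\<And>c b. (\<Sum>b\<in>B. sconst (c b) * f b) \<in> I \<Longrightarrow> b \<in> B \<Longrightarrow> c b = 0"
  shows "ring.dim (super_ring k j Quot I) ((+>\<^bsub>super_ring k j\<^esub>) I ` range sconst)
           ((+>\<^bsub>super_ring k j\<^esub>) I ` super_component k j d) = card B"
proof -
  let ?R = "super_ring k j" and ?E = "super_component k j d"
  let ?S = "?R Quot I"
  define h where "h = (+>\<^bsub>?R\<^esub>) I"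
  interpret h: ring_hom_ring ?R ?S h
    unfolding h_def by (rule ideal.rcos_ring_hom_ring[OF I])
  have zero: "h p = \<zero>\<^bsub>?S\<^esub> \<longleftrightarrow> p \<in> I" if "p \<in> carrier ?R" for p
    using that ideal.rcos_const_imp_mem[OF I, of p] h.R.a_rcos_zero[OF I, of p]
    by (auto simp: h_def FactRing_def)
  have fc: "f b \<in> carrier ?R" if "b \<in> B" for b
    using f[OF that] by (simp add: super_component_iff)
  have ne: "\<one>\<^bsub>?S\<^esub> \<noteq> \<zero>\<^bsub>?S\<^esub>"
    using zero[OF one_closed] one h.hom_one by simp
  have K: "subfield (h ` range sconst) ?S"
    by (rule h.img_is_subfield(2)[OF subfield_scalars ne])
  obtain xs where xs: "set xs = B" "distinct xs" using finite_distinct_list[OF B] by blast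
  have comb: "h.S.combine (map h (map (\<lambda>x. sconst (c x)) xs)) (map h (map f xs))
      = h (\<Sum>b\<in>B. sconst (c b) * f b)" for c
  proof -
    have "h.R.combine (map (\<lambda>x. sconst (c x)) xs) (map f xs) = (\<Sum>b\<in>B. sconst (c b) * f b)"
      using combine_super_ring[OF xs(2), of f k j c] fc xs(1) by auto
    then show ?thesis
      using fc xs(1) sconst_closed by (subst h.combine_hom) auto
  qed
  have sumc: "(\<Sum>b\<in>B. sconst (c b) * f b) \<in> carrier ?R" for c
    by (intro sum_closed scale_closed fc)
  have Us: "set (map h (map f xs)) \<subseteq> carrier ?S"
    using fc xs(1) by auto
  have scal: "\<exists>c. Ks = map h (map (\<lambda>x. sconst (c x)) xs)"
    if "length Ks = length xs" "set Ks \<subseteq> h ` range sconst" for Ks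
    using that xs(2)
  proof (induction Ks xs rule: list_induct2)
    case Nil
    then show ?case by simp
  next
    case (Cons K Ks x xs)
    then obtain c where c: "Ks = map h (map (\<lambda>x. sconst (c x)) xs)" by auto
    obtain a where "K = h (sconst a)" using Cons.prems by auto
    then show ?case using Cons.prems(2) c
      by (intro exI[of _ "c(x := a)"]) (auto intro!: map_cong)
  qed
  have "h.S.independent (h ` range sconst) (map h (map f xs))"
  proof (rule ccontr)
    assume dep: "\<not> h.S.independent (h ` range sconst) (map h (map f xs))"
    obtain Ks where Ks: "length Ks = length (map h (map f xs))"
      "h.S.combine Ks (map h (map f xs)) = \<zero>\<^bsub>?S\<^esub>"
      "set Ks \<subseteq> h ` range sconst" "set Ks \<noteq> {\<zero>\<^bsub>?S\<^esub>}"
      using h.S.dependent_imp_non_trivial_combine[OF K Us dep] by blast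
    from Ks(1) have "length Ks = length xs" by simp
    from scal[OF this Ks(3)] obtain c where c: "Ks = map h (map (\<lambda>x. sconst (c x)) xs)" by (rule exE)
    have "h (\<Sum>b\<in>B. sconst (c b) * f b) = \<zero>\<^bsub>?S\<^esub>" using Ks(2) comb unfolding c by simp
    then have "c b = 0" if "b \<in> B" for b
      using indep zero[OF sumc] that by blast
    then have "set Ks \<subseteq> {h 0}" using xs(1) unfolding c by auto
    moreover have "h 0 = \<zero>\<^bsub>?S\<^esub>" using h.hom_zero by simp
    ultimately have "set Ks = {}" using Ks(4) by (metis subset_singletonD)
    then have "xs = []" unfolding c by simp
    then show False using dep by simp
  qed
  moreover have "h.S.Span (h ` range sconst) (map h (map f xs)) = h ` ?E"
  proof (rule Set.set_eqI, rule iffI)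
    fix y assume "y \<in> h.S.Span (h ` range sconst) (map h (map f xs))"
    then obtain Ks where Ks: "set Ks \<subseteq> h ` range sconst" "length Ks = length xs"
      "y = h.S.combine Ks (map h (map f xs))"
      using h.S.Span_mem_iff_length_version[OF K Us] by auto
    from scal[OF Ks(2,1)] obtain c where c: "Ks = map h (map (\<lambda>x. sconst (c x)) xs)" by (rule exE)
    have "(\<Sum>b\<in>B. sconst (c b) * f b) \<in> ?E"
      using f sumc[of c] by (auto simp: super_component_iff intro!: homogeneous_sum homogeneous_scale)
    then show "y \<in> h ` ?E" unfolding Ks(3) c comb by (rule imageI)
  next
    fix y assume "y \<in> h ` ?E"
    then obtain p where p: "p \<in> ?E" "y = h p" by blast
    obtain c where c: "p - (\<Sum>b\<in>B. sconst (c b) * f b) \<in> I" using span[OF p(1)] by blast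
    let ?q = "\<Sum>b\<in>B. sconst (c b) * f b" 
    have r: "p - ?q \<in> carrier ?R" using ideal_carrier[OF I c] .
    have "h p = h (?q \<oplus>\<^bsub>?R\<^esub> (p - ?q))" by simp
    also have "\<dots> = h ?q \<oplus>\<^bsub>?S\<^esub> h (p - ?q)" by (rule h.hom_add[OF sumc r])
    also have "\<dots> = h ?q" using zero[OF r] c h.hom_closed[OF sumc] by simp
    finally have "y = h.S.combine (map h (map (\<lambda>x. sconst (c x)) xs)) (map h (map f xs))"
      unfolding p(2) comb by simp
    moreover have "set (map h (map (\<lambda>x. sconst (c x)) xs)) \<subseteq> h ` range sconst" by auto
    ultimately show "y \<in> h.S.Span (h ` range sconst) (map h (map f xs))"
      using h.S.Span_mem_iff_length_version[OF K Us] by (metis length_map)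
  qed
  ultimately have "h.S.dimension (length xs) (h ` range sconst) (h ` ?E)"
    using h.S.dimension_independent[of "h ` range sconst" "map h (map f xs)"] by simp
  then have "h.S.dim (h ` range sconst) (h ` ?E) = length xs"
    using h.S.dimI[OF K] by (simp add: over_def)
  then show ?thesis
    using xs distinct_card[OF xs(2)] by (simp add: h_def)
qed

section \<open>A monomial basis of the coinvariant ring\<close>

definition pure_monomials :: "nat \<Rightarrow> nat \<Rightarrow> 2 \<Rightarrow> nat \<Rightarrow> smon set" where
  "pure_monomials k j s i =
     {m \<in> smonomials k j. index_count s m = i \<and> (\<forall>t. t \<noteq> s \<longrightarrow> index_count t m = 0)}"

text \<open>
  The choice of one of \<open>z\<^sub>\<alpha> w\<^sub>\<beta>\<close> and \<open>w\<^sub>\<alpha> z\<^sub>\<beta>\<close>, with the bosonic pairs ordered before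
  the fermionic ones. On the diagonal, \<open>z w\<close> is itself invariant for a bosonic pair, so that it is
  left out, whereas for a fermionic pair it changes sign under the exchange and survives.
\<close>

fun mixes :: "nat + nat \<Rightarrow> nat + nat \<Rightarrow> bool" where
  "mixes (Inl a) (Inl a') \<longleftrightarrow> a < a'"
| "mixes (Inl a) (Inr b) \<longleftrightarrow> True"
| "mixes (Inr b) (Inl a) \<longleftrightarrow> False"
| "mixes (Inr b) (Inr b') \<longleftrightarrow> b \<le> b'"

definition mixed_monomial :: "nat + nat \<Rightarrow> nat + nat \<Rightarrow> smon" where
  "mixed_monomial \<alpha> \<beta> = single (block_var \<alpha> 1) 1 + single (block_var \<beta> 2) 1"

definition mixed_monomials :: "nat \<Rightarrow> nat \<Rightarrow> smon set" where
  "mixed_monomials k j =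
     {mixed_monomial \<alpha> \<beta> | \<alpha> \<beta>. \<alpha> \<in> blocks k j \<and> \<beta> \<in> blocks k j \<and> mixes \<alpha> \<beta>}"

text \<open>
  The monomials of degree \<open>n\<close> in the variables of index 2 are omitted, since modulo the ideal
  they are the negatives of those of index 1 up to the sign of the exchange.
\<close>

definition basis :: "nat \<Rightarrow> nat \<Rightarrow> nat \<Rightarrow> smon set" where
  "basis n k j = (\<Union>i<n. pure_monomials k j 1 i \<union> pure_monomials k j 2 i) \<union>
     pure_monomials k j 1 n \<union> mixed_monomials k j"

lemma pure_monomials_12:
  "pure_monomials k j 1 i = {m \<in> smonomials k j. index_count 1 m = i \<and> index_count 2 m = 0}"
  "pure_monomials k j 2 i = {m \<in> smonomials k j. index_count 1 m = 0 \<and> index_count 2 m = i}"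
proof -
  have "(\<forall>t::2. t \<noteq> 1 \<longrightarrow> P t) \<longleftrightarrow> P 2" "(\<forall>t::2. t \<noteq> 2 \<longrightarrow> P t) \<longleftrightarrow> P 1" for P
    by (simp_all add: forall_2)
  then show "pure_monomials k j 1 i = {m \<in> smonomials k j. index_count 1 m = i \<and> index_count 2 m = 0}"
    "pure_monomials k j 2 i = {m \<in> smonomials k j. index_count 1 m = 0 \<and> index_count 2 m = i}"
    by (auto simp: pure_monomials_def)
qed

lemma index_count_mixed_monomial [simp]:
  "index_count 1 (mixed_monomial \<alpha> \<beta>) = 1" "index_count 2 (mixed_monomial \<alpha> \<beta>) = 1"
  by (simp_all add: mixed_monomial_def index_count_add)

lemma swap_mon_mixed_monomial: "swap_mon (mixed_monomial \<alpha> \<beta>) = mixed_monomial \<beta> \<alpha>"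
  by (simp add: mixed_monomial_def swap_var_def add.commute)

lemma block_var_eq_iff: "block_var \<alpha> s = v \<longleftrightarrow> svar_block v = \<alpha> \<and> svar_index v = s"
  by auto

lemma lookup_mixed_monomial:
  "lookup (mixed_monomial \<alpha> \<beta>) v =
     (if svar_block v = \<alpha> \<and> svar_index v = 1 then 1 else 0) +
     (if svar_block v = \<beta> \<and> svar_index v = 2 then 1 else 0)"
  by (simp add: mixed_monomial_def lookup_add lookup_single when_def block_var_eq_iff)

lemma mixed_monomial_eq_iff: "mixed_monomial \<alpha> \<beta> = mixed_monomial \<alpha>' \<beta>' \<longleftrightarrow> \<alpha> = \<alpha>' \<and> \<beta> = \<beta>'"
proof
  assume eq: "mixed_monomial \<alpha> \<beta> = mixed_monomial \<alpha>' \<beta>'"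
  have "lookup (mixed_monomial a b) (block_var c 1) = (if c = a then 1 else 0)"
       "lookup (mixed_monomial a b) (block_var c 2) = (if c = b then 1 else 0)" for a b c
    by (simp_all add: lookup_mixed_monomial)
  then show "\<alpha> = \<alpha>' \<and> \<beta> = \<beta>'"
    using eq by (metis zero_neq_one)
qed simp

lemma block_var_in_svars: "block_var \<alpha> s \<in> set (svars k j) \<longleftrightarrow> \<alpha> \<in> blocks k j"
  by (simp add: in_set_svars)

lemma mixed_monomial_in_smonomials:
  "mixed_monomial \<alpha> \<beta> \<in> smonomials k j \<longleftrightarrow> \<alpha> \<in> blocks k j \<and> \<beta> \<in> blocks k j"
proof
  assume "mixed_monomial \<alpha> \<beta> \<in> smonomials k j"
  from smonomials_addD[OF this[unfolded mixed_monomial_def]]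
  show "\<alpha> \<in> blocks k j \<and> \<beta> \<in> blocks k j"
    by (simp only: single_var_in_smonomials block_var_in_svars)
next
  assume "\<alpha> \<in> blocks k j \<and> \<beta> \<in> blocks k j"
  then show "mixed_monomial \<alpha> \<beta> \<in> smonomials k j"
    by (auto simp: smonomials_def in_keys_iff lookup_mixed_monomial in_set_svars split: if_splits)
qed

lemma mixed_monomial_in_mixed_monomials:
  "mixed_monomial \<alpha> \<beta> \<in> mixed_monomials k j \<longleftrightarrow>
     mixed_monomial \<alpha> \<beta> \<in> smonomials k j \<and> mixes \<alpha> \<beta>"
  by (auto simp: mixed_monomials_def mixed_monomial_eq_iff mixed_monomial_in_smonomials)

lemma exists_mixed_monomial:
  assumes "index_count 1 m = 1" "index_count 2 m = 1"
  obtains \<alpha> \<beta> where "m = mixed_monomial \<alpha> \<beta>"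
proof -
  obtain v where v: "v \<in> keys m" "svar_index v = 1"
    using index_count_pos_iff[of 1 m] assms(1) by auto
  obtain m1 where m1: "m = single v 1 + m1" using v(1) by (rule exists_var_summand)
  then have "0 < index_count 2 m1" using assms(2) v(2) by (simp add: index_count_add)
  then obtain w where w: "w \<in> keys m1" "svar_index w = 2" by (auto simp: index_count_pos_iff)
  obtain m2 where m2: "m1 = single w 1 + m2" using w(1) by (rule exists_var_summand)
  have "index_count 1 m2 = 0 \<and> index_count 2 m2 = 0"
    using assms v(2) w(2) unfolding m1 m2 by (simp add: index_count_add)
  then have "m2 = 0" by (simp only: smon_eq_zero_iff[symmetric])
  moreover have "v = block_var (svar_block v) 1" "w = block_var (svar_block w) 2"
    using v(2) w(2) by (metis block_var_block_index)+
  ultimately have "m = mixed_monomial (svar_block v) (svar_block w)"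
    unfolding m1 m2 mixed_monomial_def by simp
  then show ?thesis by (rule that)
qed

text \<open>
  The exchange reverses the order of the two factors, which commute or anticommute.
\<close>

lemma swap_coeff_mixed_monomial:
  assumes "\<alpha> \<in> blocks k j"
  shows "swap_coeff k j (mixed_monomial \<alpha> \<alpha>) = (if isl \<alpha> then 1 else -1)"
proof -
  let ?v = "block_var \<alpha> 1" and ?w = "block_var \<alpha> 2"
  let ?e = "smon_sign (single ?v 1) (single ?w 1)"
  have vw: "?v \<in> set (svars k j)" "?w \<in> set (svars k j)"
    using assms by (simp_all add: block_var_in_svars)
  have m: "single ?v 1 + single ?w 1 \<in> smonomials k j"
    using mixed_monomial_in_smonomials[of \<alpha> \<alpha> k j] assms by (simp add: mixed_monomial_def)
  have "act k j swap_mat (single (single ?v 1 + single ?w 1) 1) =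
        sconst ?e * (act_svar swap_mat ?v \<star> act k j swap_mat (single (single ?w 1) 1))"
    by (rule act_single_var_add[OF vw(1) m])
  also have "act k j swap_mat (single (single ?w 1) 1) = svar_poly ?v"
    using act_var[OF vw(2), of swap_mat] unfolding act_svar_swap svar_poly_def[of ?w]
    by (simp add: swap_var_def)
  also have "act_svar swap_mat ?v = svar_poly ?w"
    unfolding act_svar_swap by (simp add: swap_var_def)
  also have "svar_poly ?w \<star> svar_poly ?v = sconst (koszul ?w ?v) * (svar_poly ?v \<star> svar_poly ?w)"
    by (rule supercommutingD[OF supercommuting_svar_poly])
  also have "sconst ?e * (sconst (koszul ?w ?v) * (svar_poly ?v \<star> svar_poly ?w)) =
      single (single ?v 1 + single ?w 1) (koszul ?w ?v)"
    using smon_sign_square[OF m] by (simp add: svar_poly_def sprod_single mult_ac)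
  finally have "act k j swap_mat (single (mixed_monomial \<alpha> \<alpha>) 1) = single (mixed_monomial \<alpha> \<alpha>) (koszul ?w ?v)"
    by (simp add: mixed_monomial_def)
  then show ?thesis
    by (simp add: swap_coeff_def swap_mon_mixed_monomial koszul_def is_fer_def)
qed

lemma small_iff:
  assumes "m \<in> smonomials k j"
  shows "small n m \<longleftrightarrow> m \<in> (\<Union>i<n. pure_monomials k j 1 i \<union> pure_monomials k j 2 i)"
  using assms by (auto simp: small_def pure_monomials_12)

lemma basis_subset: "basis n k j \<subseteq> smonomials k j"
  unfolding basis_def pure_monomials_12
  by (auto simp: mixed_monomials_def mixed_monomial_in_smonomials)

lemma small_in_basis: "m \<in> smonomials k j \<Longrightarrow> small n m \<Longrightarrow> m \<in> basis n k j"
  unfolding basis_def using small_iff[of m k j n] by blast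

lemma basis_small_or_critical: "m \<in> basis n k j \<Longrightarrow> small n m \<or> critical n m"
  unfolding basis_def pure_monomials_12
  by (auto simp: mixed_monomials_def small_def critical_def)

text \<open>
  The critical monomials in the basis represent the orbits of the swap, apart from the fixed points
  of sign \<open>1\<close>, on which the model ideal imposes no condition.
\<close>

lemma critical_basis_cases:
  assumes n: "n \<ge> 2" and m: "m \<in> smonomials k j" "critical n m"
  shows "swap_mon m \<noteq> m \<Longrightarrow> m \<in> basis n k j \<longleftrightarrow> swap_mon m \<notin> basis n k j"
    and "swap_mon m = m \<Longrightarrow> m \<in> basis n k j \<longleftrightarrow> swap_coeff k j m \<noteq> 1"
proof -
  consider (pure) "index_count 1 m = n \<and> index_count 2 m = 0 \<or> index_count 1 m = 0 \<and> index_count 2 m = n"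
    | (mixed) "index_count 1 m = 1" "index_count 2 m = 1"
    using m(2) by (auto simp: critical_def)
  then have "(swap_mon m \<noteq> m \<longrightarrow> (m \<in> basis n k j \<longleftrightarrow> swap_mon m \<notin> basis n k j)) \<and>
      (swap_mon m = m \<longrightarrow> (m \<in> basis n k j \<longleftrightarrow> swap_coeff k j m \<noteq> 1))"
  proof cases
    case pure
    have ne: "swap_mon m \<noteq> m"
    proof
      assume "swap_mon m = m"
      then have "index_count 2 m = index_count 1 m" using index_count_swap_mon(1)[of m] by simp
      then show False using pure n by auto
    qed
    have not_mixed: "x \<notin> mixed_monomials k j" if "index_count 1 x = 0 \<or> index_count 2 x = 0" for x
      using that by (auto simp: mixed_monomials_def)
    have "m \<in> basis n k j \<longleftrightarrow> index_count 1 m = n" "swap_mon m \<in> basis n k j \<longleftrightarrow> index_count 2 m = n"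
      using pure n m(1) not_mixed[of m] not_mixed[of "swap_mon m"]
      unfolding basis_def pure_monomials_12 by auto
    then show ?thesis using ne pure n by auto
  next
    case mixed
    then obtain \<alpha> \<beta> where ab: "m = mixed_monomial \<alpha> \<beta>" by (rule exists_mixed_monomial)
    have bas: "x \<in> basis n k j \<longleftrightarrow> x \<in> mixed_monomials k j" if "index_count 1 x = 1" "index_count 2 x = 1" for x
      using that unfolding basis_def pure_monomials_12 by auto
    have bl: "\<alpha> \<in> blocks k j" "\<beta> \<in> blocks k j"
      using m(1) by (simp_all add: ab mixed_monomial_in_smonomials)
    have "m \<in> basis n k j \<longleftrightarrow> mixes \<alpha> \<beta>" "swap_mon m \<in> basis n k j \<longleftrightarrow> mixes \<beta> \<alpha>"
      using bl by (simp_all add: bas ab swap_mon_mixed_monomial mixed_monomial_in_mixed_monomials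
          mixed_monomial_in_smonomials)
    moreover have "swap_mon m = m \<longleftrightarrow> \<alpha> = \<beta>"
      by (auto simp: ab swap_mon_mixed_monomial mixed_monomial_eq_iff)
    moreover have "\<alpha> \<noteq> \<beta> \<Longrightarrow> mixes \<alpha> \<beta> \<longleftrightarrow> \<not> mixes \<beta> \<alpha>" "mixes \<alpha> \<alpha> \<longleftrightarrow> \<not> isl \<alpha>"
      by (cases \<alpha>; cases \<beta>; auto)+
    ultimately show ?thesis
      using swap_coeff_mixed_monomial[OF bl(1)] by (auto simp: ab)
  qed
  then show "swap_mon m \<noteq> m \<Longrightarrow> m \<in> basis n k j \<longleftrightarrow> swap_mon m \<notin> basis n k j"
    and "swap_mon m = m \<Longrightarrow> m \<in> basis n k j \<longleftrightarrow> swap_coeff k j m \<noteq> 1" by blast+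
qed

context
  fixes n k j :: nat and d :: multideg
  assumes n: "n \<ge> 2" and fin: "finite (basis n k j)"
begin

abbreviation "basis_d \<equiv> {m \<in> basis n k j. smon_deg m = d}"

lemma lookup_combination:
  "lookup (\<Sum>b\<in>basis_d. single b (c b)) m = (if m \<in> basis_d then c m else 0)"
proof -
  have "lookup (\<Sum>b\<in>basis_d. single b (c b)) m = (\<Sum>b\<in>basis_d. if b = m then c b else 0)"
    unfolding lookup_sum lookup_single when_def by (rule refl)
  also have "\<dots> = (if m \<in> basis_d then c m else 0)"
    using fin by (subst sum.delta) auto
  finally show ?thesis .
qed

lemma combination_closed: "(\<Sum>b\<in>basis_d. single b (c b)) \<in> carrier (super_ring k j)"
  using basis_subset[of n k j] by (intro sum_closed single_closed) auto

lemma basis_independent: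
  assumes r: "(\<Sum>b\<in>basis_d. single b (c b)) \<in> model_ideal n k j" and b: "b \<in> basis_d"
  shows "c b = 0"
proof -
  let ?r = "\<Sum>b\<in>basis_d. single b (c b)"
  have bs: "b \<in> smonomials k j" using b basis_subset by blast
  consider "small n b" | "critical n b" using b basis_small_or_critical by blast
  then have "lookup ?r b = 0"
  proof cases
    case 1
    then show ?thesis using r by (simp add: model_ideal_def)
  next
    case 2
    then have eq: "lookup ?r b = swap_coeff k j (swap_mon b) * lookup ?r (swap_mon b)"
      using r lookup_act_swap[OF combination_closed] by (simp add: model_ideal_def)
    show ?thesis
    proof (cases "swap_mon b = b")
      case True
      then have "swap_coeff k j b \<noteq> 1" using critical_basis_cases(2)[OF n bs 2] b by simp
      then show ?thesis using eq True by simp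
    next
      case False
      then have "lookup ?r (swap_mon b) = 0"
        using critical_basis_cases(1)[OF n bs 2] b unfolding lookup_combination by simp
      then show ?thesis using eq by simp
    qed
  qed
  then show ?thesis using b unfolding lookup_combination by simp
qed

text \<open>
  Small coefficients are copied. At a critical monomial of the basis, the combination takes up the
  defect of symmetry between this monomial and the exchanged one, which is not in the basis. A
  critical monomial of the basis that is its own exchange has the sign -1, so its coefficient vanishes
  in the model ideal and is copied as well.
\<close>

lemma basis_spanning:
  assumes p: "p \<in> super_component k j d"
  shows "\<exists>c. p - (\<Sum>b\<in>basis_d. single b (c b)) \<in> model_ideal n k j"
proof
  define c where "c m = (if small n m \<or> swap_mon m = m then lookup p m
      else lookup p m - swap_coeff k j (swap_mon m) * lookup p (swap_mon m))" for m
  define q where "q = p - (\<Sum>b\<in>basis_d. single b (c b))"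
  have pc: "p \<in> carrier (super_ring k j)" using p by (simp add: super_component_iff)
  have q: "q \<in> carrier (super_ring k j)"
    unfolding q_def using add_closed[OF pc scale_closed[OF combination_closed, of "-1" c]] by simp
  have look: "lookup q m = lookup p m - (if m \<in> basis_d then c m else 0)" for m
    unfolding q_def by (simp only: lookup_minus lookup_combination)
  have p0: "lookup p m = 0" if "m \<notin> smonomials k j \<or> smon_deg m \<noteq> d" for m
    using that p by (auto simp: super_component_iff homogeneous_def carrier_super_ring in_keys_iff)
  have "lookup q m = 0" if "small n m" for m
    using that p0[of m] small_in_basis[of m k j n] by (auto simp: look c_def)
  moreover have "lookup (act k j swap_mat q) m = lookup q m" if crit: "critical n m" for m
  proof (cases "m \<in> smonomials k j \<and> smon_deg m = d")
    case False
    then have "lookup q m = 0" "lookup q (swap_mon m) = 0"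
      using p0[of m] p0[of "swap_mon m"] basis_subset[of n k j]
      by (auto simp: look subset_iff)
    then show ?thesis by (simp add: lookup_act_swap[OF q])
  next
    case True
    then have m: "m \<in> smonomials k j" and deg: "smon_deg m = d" by auto
    have ns: "\<not> small n m" "\<not> small n (swap_mon m)" using crit small_not_critical by auto
    note cases = critical_basis_cases[OF n m crit]
    have "lookup q m = swap_coeff k j (swap_mon m) * lookup q (swap_mon m)"
    proof (cases "swap_mon m = m")
      case True
      then show ?thesis using cases(2)[OF True] deg by (auto simp: look c_def)
    next
      case False
      note ff = swap_coeff_mult[OF m]
      show ?thesis
      proof (cases "m \<in> basis n k j")
        case True
        then have "swap_mon m \<notin> basis n k j" using cases(1)[OF False] by simp
        then show ?thesis using True False ns deg by (simp add: look c_def)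
      next
        case nb: False
        then have "swap_mon m \<in> basis n k j" using cases(1)[OF False] by simp
        then show ?thesis using nb False ns deg ff
          by (simp add: look c_def mult.assoc[symmetric] mult.commute[of "swap_coeff k j (swap_mon m)"])
      qed
    qed
    then show ?thesis by (simp add: lookup_act_swap[OF q])
  qed
  ultimately show "p - (\<Sum>b\<in>basis_d. single b (c b)) \<in> model_ideal n k j"
    unfolding q_def[symmetric] model_ideal_def using q by simp
qed

lemma coinv_hilb_eq_card: "coinv_hilb (dihedral n) k j d = int (card basis_d)"
proof -
  let ?I = "coinv_ideal (dihedral n) k j"
  let ?f = "\<lambda>b. act k j eigen_mat (single b 1)"
  have restore: "act k j eigen_mat_inv (act k j eigen_mat p) = p"
    if "p \<in> carrier (super_ring k j)" for p
    using that by (simp add: act_act eigen_mat_inverse act_id)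
  have sum_f: "(\<Sum>b\<in>basis_d. sconst (c b) * ?f b) =
      act k j eigen_mat (\<Sum>b\<in>basis_d. single b (c b))" for c
    by (simp only: act_sum act_single[of k j eigen_mat _ "c _"])
  have sum_closed: "(\<Sum>b\<in>basis_d. sconst (c b) * ?f b) \<in> carrier (super_ring k j)" for c
    unfolding sum_f by (rule act_closed)
  have ideal: "ideal ?I (super_ring k j)"
    unfolding coinv_ideal_dihedral[OF n] by (rule ideal_act_vimage[OF ideal_model_ideal[OF n]])
  have "card basis_d = ring.dim (super_ring k j Quot ?I) ((+>\<^bsub>super_ring k j\<^esub>) ?I ` range sconst)
           ((+>\<^bsub>super_ring k j\<^esub>) ?I ` super_component k j d)"
  proof (rule dim_quotient_component[OF ideal, symmetric])
    have "(1::spoly) \<notin> model_ideal n k j"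
      using n by (auto simp: model_ideal_def small_def lookup_one intro!: exI[of _ 0])
    then show "1 \<notin> ?I" by (simp add: coinv_ideal_dihedral[OF n])
    show "finite basis_d" using fin by simp
    show "?f b \<in> super_component k j d" if "b \<in> basis_d" for b
      using that basis_subset[of n k j]
      by (intro act_component) (auto simp: super_component_iff single_closed homogeneous_def)
    show "\<exists>c. p - (\<Sum>b\<in>basis_d. sconst (c b) * ?f b) \<in> ?I" if p: "p \<in> super_component k j d" for p
    proof -
      have pc: "p \<in> carrier (super_ring k j)" using p by (simp add: super_component_iff)
      obtain c where c: "act k j eigen_mat_inv p - (\<Sum>b\<in>basis_d. single b (c b))
          \<in> model_ideal n k j"
        using basis_spanning[OF act_component[OF p]] by blast
      have "p - (\<Sum>b\<in>basis_d. sconst (c b) * ?f b) \<in> carrier (super_ring k j)"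
        using add_closed[OF pc scale_closed[OF sum_closed, of "-1" c]] by simp
      moreover have "act k j eigen_mat_inv (p - (\<Sum>b\<in>basis_d. sconst (c b) * ?f b)) \<in> model_ideal n k j"
        using c unfolding act_diff sum_f restore[OF combination_closed] .
      ultimately show ?thesis unfolding coinv_ideal_dihedral[OF n] by blast
    qed
    show "c b = 0" if "(\<Sum>b\<in>basis_d. sconst (c b) * ?f b) \<in> ?I" "b \<in> basis_d" for c b
    proof (rule basis_independent[OF _ that(2), of c])
      show "(\<Sum>b\<in>basis_d. single b (c b)) \<in> model_ideal n k j"
        using that(1) unfolding coinv_ideal_dihedral[OF n] sum_f mem_Collect_eq
          restore[OF combination_closed] by (rule conjunct2)
    qed
  qed
  then show ?thesis
    by (simp add: coinv_hilb_def coinv_ring_def coinv_class_def[abs_def])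
qed

end

section \<open>Super Schur functions of one row and of one column\<close>

definition sorted_lists :: "(nat \<Rightarrow> nat \<Rightarrow> bool) \<Rightarrow> nat \<Rightarrow> nat \<Rightarrow> nat list set" where
  "sorted_lists R N l = {xs. sorted_wrt R xs \<and> set xs \<subseteq> {..<N} \<and> length xs = l}"

lemma finite_sorted_lists [simp]: "finite (sorted_lists R N l)"
  by (rule finite_subset[OF _ finite_lists_length_eq[of "{..<N}" l]]) (auto simp: sorted_lists_def)

text \<open>
  If the cells are enumerated in such a way that the tableau condition only compares the entries in
  the order of enumeration, then a tableau is the same as the sorted list of its entries.
\<close>

lemma skew_schur_eq_sum_lists:
  fixes x :: "nat \<Rightarrow> 'a::comm_ring_1"
  assumes e: "bij_betw e {..<l} (skew_cells lam mu)"
    and R: "\<And>T. T \<in> ssyt lam mu N \<longleftrightarrow>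
      T \<in> skew_cells lam mu \<rightarrow>\<^sub>E {..<N} \<and> (\<forall>i<l. \<forall>i'<l. i < i' \<longrightarrow> R (T (e i)) (T (e i')))"
  shows "skew_schur lam mu N x = (\<Sum>xs\<in>sorted_lists R N l. prod_list (map x xs))"
proof -
  let ?C = "skew_cells lam mu"
  define f where "f xs = restrict (\<lambda>c. xs ! (inv_into {..<l} e c)) ?C" for xs :: "nat list"
  have eC: "e i \<in> ?C" if "i < l" for i using e that by (auto simp: bij_betw_def)
  have inv: "inv_into {..<l} e (e i) = i" if "i < l" for i
    using e that by (auto simp: bij_betw_def)
  have inv': "inv_into {..<l} e c < l" "e (inv_into {..<l} e c) = c" if "c \<in> ?C" for c
    using e that inv_into_into[of c e "{..<l}"] by (auto simp: bij_betw_def f_inv_into_f)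
  have f: "f xs (e i) = xs ! i" if "i < l" for xs i
    using eC[OF that] inv[OF that] by (simp add: f_def)
  show ?thesis
    unfolding skew_schur_def
  proof (rule sum.reindex_bij_witness[where i = f and j = "\<lambda>T. map (T \<circ> e) [0..<l]"])
    fix T assume T: "T \<in> ssyt lam mu N"
    show "f (map (T \<circ> e) [0..<l]) = T"
    proof
      fix c show "f (map (T \<circ> e) [0..<l]) c = T c"
      proof (cases "c \<in> ?C")
        case True
        then show ?thesis using inv'[of c] by (simp add: f_def)
      next
        case False
        then show ?thesis using T PiE_arb[of T ?C "\<lambda>_. {..<N}" c] by (simp add: f_def R)
      qed
    qed
    have "T (e i) < N" if "i < l" for i
      using T eC[OF that] by (auto simp: R)
    then show "map (T \<circ> e) [0..<l] \<in> sorted_lists R N l"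
      using T by (auto simp: sorted_lists_def sorted_wrt_iff_nth_less R)
    have "(\<Prod>c\<in>?C. x (T c)) = (\<Prod>i<l. x (T (e i)))"
      by (rule prod.reindex_bij_betw[OF e, symmetric])
    then show "prod_list (map x (map (T \<circ> e) [0..<l])) = (\<Prod>c\<in>?C. x (T c))"
      by (simp add: prod.list_conv_set_nth atLeast0LessThan)
  next
    fix xs assume xs: "xs \<in> sorted_lists R N l"
    then have len: "length xs = l" by (simp add: sorted_lists_def)
    show "map (f xs \<circ> e) [0..<l] = xs"
      using len by (intro nth_equalityI) (auto simp: f)
    have "xs ! i < N" if "i < l" for i
    proof -
      have "xs ! i \<in> set xs" using that len by simp
      then show ?thesis using xs by (auto simp: sorted_lists_def)
    qed
    then have "f xs \<in> ?C \<rightarrow>\<^sub>E {..<N}"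
      using inv'(1) by (simp add: f_def restrict_PiE_iff)
    then show "f xs \<in> ssyt lam mu N"
      using xs by (auto simp: R f sorted_lists_def sorted_wrt_iff_nth_less)
  qed
qed

definition row :: "nat \<Rightarrow> nat \<Rightarrow> nat" where
  "row m r = (if r = 0 then m else 0)"

definition column :: "nat \<Rightarrow> nat \<Rightarrow> nat" where
  "column m r = (if r < m then 1 else 0)"

lemma skew_cells_row: "skew_cells (row l) (row m) = {0} \<times> {m..<l}"
  by (auto simp: skew_cells_def row_def split: if_splits)

lemma skew_cells_column: "skew_cells (column l) (column m) = {m..<l} \<times> {0}"
  by (auto simp: skew_cells_def column_def split: if_splits)

lemma skew_schur_row:
  assumes "m \<le> l"
  shows "skew_schur (row l) (row m) N x = (\<Sum>xs\<in>sorted_lists (\<le>) N (l - m). prod_list (map x xs))"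
proof (rule skew_schur_eq_sum_lists[where e = "\<lambda>i. (0, m + i)"])
  show "bij_betw (\<lambda>i. (0, m + i)) {..<l - m} (skew_cells (row l) (row m))"
    unfolding skew_cells_row
    by (rule bij_betwI[where g = "\<lambda>(r, c). c - m"]) auto
  fix T :: "nat \<times> nat \<Rightarrow> nat"
  have "(\<forall>r c c'. (r, c) \<in> {0} \<times> {m..<l} \<longrightarrow> (r, c') \<in> {0} \<times> {m..<l} \<longrightarrow> c < c' \<longrightarrow> T (r, c) \<le> T (r, c'))
    \<longleftrightarrow> (\<forall>i<l - m. \<forall>i'<l - m. i < i' \<longrightarrow> T (0, m + i) \<le> T (0, m + i'))" (is "?A \<longleftrightarrow> ?B")
  proof
    assume ?A then show ?B using assms by auto
  next
    assume B: ?B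
    show ?A
    proof (intro allI impI)
      fix r c c' :: nat assume "(r, c) \<in> {0} \<times> {m..<l}" "(r, c') \<in> {0} \<times> {m..<l}" "c < c'"
      then show "T (r, c) \<le> T (r, c')"
        using B[rule_format, of "c - m" "c' - m"] by auto
    qed
  qed
  then show "T \<in> ssyt (row l) (row m) N \<longleftrightarrow> T \<in> skew_cells (row l) (row m) \<rightarrow>\<^sub>E {..<N} \<and>
      (\<forall>i<l - m. \<forall>i'<l - m. i < i' \<longrightarrow> T (0, m + i) \<le> T (0, m + i'))"
    unfolding ssyt_def skew_cells_row by auto
qed

lemma skew_schur_column:
  assumes "m \<le> l"
  shows "skew_schur (column l) (column m) N x = (\<Sum>xs\<in>sorted_lists (<) N (l - m). prod_list (map x xs))"
proof (rule skew_schur_eq_sum_lists[where e = "\<lambda>i. (m + i, 0)"])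
  show "bij_betw (\<lambda>i. (m + i, 0)) {..<l - m} (skew_cells (column l) (column m))"
    unfolding skew_cells_column
    by (rule bij_betwI[where g = "\<lambda>(r, c). r - m"]) auto
  fix T :: "nat \<times> nat \<Rightarrow> nat"
  have "(\<forall>r r' c. (r, c) \<in> {m..<l} \<times> {0} \<longrightarrow> (r', c) \<in> {m..<l} \<times> {0} \<longrightarrow> r < r' \<longrightarrow> T (r, c) < T (r', c))
    \<longleftrightarrow> (\<forall>i<l - m. \<forall>i'<l - m. i < i' \<longrightarrow> T (m + i, 0) < T (m + i', 0))" (is "?A \<longleftrightarrow> ?B")
  proof
    assume ?A then show ?B using assms by auto
  next
    assume B: ?B
    show ?A
    proof (intro allI impI)
      fix r r' c :: nat assume "(r, c) \<in> {m..<l} \<times> {0}" "(r', c) \<in> {m..<l} \<times> {0}" "r < r'"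
      then show "T (r, c) < T (r', c)"
        using B[rule_format, of "r - m" "r' - m"] by auto
    qed
  qed
  then show "T \<in> ssyt (column l) (column m) N \<longleftrightarrow> T \<in> skew_cells (column l) (column m) \<rightarrow>\<^sub>E {..<N} \<and>
      (\<forall>i<l - m. \<forall>i'<l - m. i < i' \<longrightarrow> T (m + i, 0) < T (m + i', 0))"
    unfolding ssyt_def skew_cells_column by auto
qed

lemma conj_part_row: "conj_part (row m) = column m"
proof
  fix c
  have "{r. c < row m r} = (if c < m then {0} else {})" by (auto simp: row_def)
  then show "conj_part (row m) c = column m c" by (simp add: conj_part_def column_def)
qed

lemma conj_part_column: "conj_part (column m) = row m"
proof
  fix c
  have "{r. c < column m r} = (if c = 0 then {..<m} else {})" by (auto simp: column_def)
  then show "conj_part (column m) c = row m c" by (simp add: conj_part_def row_def)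
qed

lemma partitions_below_row: "{nu. is_partition nu \<and> nu \<le> row l} = row ` {..l}"
proof (intro Set.set_eqI iffI)
  fix nu assume "nu \<in> {nu. is_partition nu \<and> nu \<le> row l}"
  then have le: "nu r \<le> row l r" for r by (auto simp: le_fun_def)
  have "nu = row (nu 0)"
  proof
    fix r show "nu r = row (nu 0) r" using le[of r] by (auto simp: row_def)
  qed
  moreover have "nu 0 \<le> l" using le[of 0] by (simp add: row_def)
  ultimately show "nu \<in> row ` {..l}" by blast
next
  fix nu assume "nu \<in> row ` {..l}"
  then obtain m where m: "nu = row m" "m \<le> l" by blast
  have "finite {i. row m i \<noteq> 0}" by (rule finite_subset[of _ "{0}"]) (auto simp: row_def)
  then show "nu \<in> {nu. is_partition nu \<and> nu \<le> row l}"
    using m by (auto simp: is_partition_def antimono_def le_fun_def row_def)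
qed

lemma partitions_below_column: "{nu. is_partition nu \<and> nu \<le> column l} = column ` {..l}"
proof (intro Set.set_eqI iffI)
  fix nu assume "nu \<in> {nu. is_partition nu \<and> nu \<le> column l}"
  then have le: "\<And>r. nu r \<le> column l r" and anti: "antimono nu"
    by (auto simp: le_fun_def is_partition_def)
  define m where "m = (LEAST r. nu r = 0)"
  have l0: "nu l = 0" using le[of l] by (simp add: column_def)
  then have m0: "nu m = 0" and ml: "m \<le> l"
    unfolding m_def by (rule LeastI) (use l0 in \<open>simp add: Least_le\<close>)
  have "nu = column m"
  proof
    fix r
    show "nu r = column m r"
    proof (cases "r < m")
      case True
      then have "nu r \<noteq> 0" unfolding m_def by (rule not_less_Least)
      moreover have "nu r \<le> 1" using le[of r] by (simp add: column_def split: if_splits)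
      ultimately show ?thesis using True by (simp add: column_def)
    next
      case False
      then have "nu r \<le> nu m" using anti by (simp add: antimono_def)
      then show ?thesis using False m0 by (simp add: column_def)
    qed
  qed
  then show "nu \<in> column ` {..l}" using ml by blast
next
  fix nu assume "nu \<in> column ` {..l}"
  then obtain m where m: "nu = column m" "m \<le> l" by blast
  have "finite {i. column m i \<noteq> 0}" by (rule finite_subset[of _ "{..<m}"]) (auto simp: column_def)
  then show "nu \<in> {nu. is_partition nu \<and> nu \<le> column l}"
    using m by (auto simp: is_partition_def antimono_def le_fun_def column_def)
qed

definition list_pairs ::
  "(nat \<Rightarrow> nat \<Rightarrow> bool) \<Rightarrow> (nat \<Rightarrow> nat \<Rightarrow> bool) \<Rightarrow> nat \<Rightarrow> nat \<Rightarrow> nat \<Rightarrow> (nat list \<times> nat list) set" where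
  "list_pairs R R' k j l = (\<Union>m\<le>l. sorted_lists R k m \<times> sorted_lists R' j (l - m))"

lemma finite_list_pairs: "finite (list_pairs R R' k j l)"
  by (simp add: list_pairs_def)

lemma in_list_pairs:
  "(xs, ys) \<in> list_pairs R R' k j l \<longleftrightarrow> sorted_wrt R xs \<and> set xs \<subseteq> {..<k} \<and>
     sorted_wrt R' ys \<and> set ys \<subseteq> {..<j} \<and> length xs + length ys = l"
  by (auto simp: list_pairs_def sorted_lists_def)

lemma sum_list_pairs:
  fixes f g :: "nat list \<Rightarrow> 'a::comm_ring_1"
  shows "(\<Sum>m\<le>l. (\<Sum>xs\<in>sorted_lists R k m. f xs) * (\<Sum>ys\<in>sorted_lists R' j (l - m). g ys)) =
    (\<Sum>(xs, ys)\<in>list_pairs R R' k j l. f xs * g ys)"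
proof -
  have "(\<Sum>(xs, ys)\<in>list_pairs R R' k j l. f xs * g ys) =
    (\<Sum>m\<le>l. \<Sum>(xs, ys)\<in>sorted_lists R k m \<times> sorted_lists R' j (l - m). f xs * g ys)"
    unfolding list_pairs_def by (rule sum.UNION_disjoint) (simp, simp, auto simp: sorted_lists_def)
  then show ?thesis by (simp add: sum_product sum.cartesian_product)
qed

lemma inj_row: "inj row"
  by (rule injI) (metis row_def)

lemma inj_column: "inj column"
  by (metis conj_part_column inj_row injD injI)

text \<open>
  The partitions below a row are rows, which are filled weakly increasingly with bosonic indices; the
  remaining cells are transposed to a column and filled strictly increasingly with fermionic indices.
\<close>

lemma super_schur_row:
  "super_schur (row l) k q j u =
   (\<Sum>(xs, ys)\<in>list_pairs (\<le>) (<) k j l. prod_list (map q xs) * prod_list (map u ys))"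
proof -
  have z: "(\<lambda>_. 0) = row 0" by (auto simp: row_def)
  have "super_schur (row l) k q j u =
      (\<Sum>m\<le>l. schur (row m) k q * skew_schur (column l) (column m) j u)"
    unfolding super_schur_def partitions_below_row conj_part_row
    by (subst sum.reindex) (auto intro: inj_on_subset[OF inj_row] simp: conj_part_row)
  also have "\<dots> = (\<Sum>m\<le>l. (\<Sum>xs\<in>sorted_lists (\<le>) k m. prod_list (map q xs)) *
      (\<Sum>ys\<in>sorted_lists (<) j (l - m). prod_list (map u ys)))"
    unfolding schur_def z by (intro sum.cong refl) (simp add: skew_schur_row skew_schur_column)
  finally show ?thesis by (simp only: sum_list_pairs)
qed

lemma super_schur_column:
  "super_schur (column l) k q j u =
   (\<Sum>(xs, ys)\<in>list_pairs (<) (\<le>) k j l. prod_list (map q xs) * prod_list (map u ys))"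
proof -
  have z: "(\<lambda>_. 0) = column 0" by (auto simp: column_def)
  have "super_schur (column l) k q j u =
      (\<Sum>m\<le>l. schur (column m) k q * skew_schur (row l) (row m) j u)"
    unfolding super_schur_def partitions_below_column conj_part_column
    by (subst sum.reindex) (auto intro: inj_on_subset[OF inj_column] simp: conj_part_column)
  also have "\<dots> = (\<Sum>m\<le>l. (\<Sum>xs\<in>sorted_lists (<) k m. prod_list (map q xs)) *
      (\<Sum>ys\<in>sorted_lists (\<le>) j (l - m). prod_list (map u ys)))"
    unfolding schur_def z by (intro sum.cong refl) (simp add: skew_schur_row skew_schur_column)
  finally show ?thesis by (simp only: sum_list_pairs)
qed

text \<open>
  With \<open>Inl\<close> and \<open>Inr\<close> this is a multidegree, and with the bosonic and fermionic variables of
  a fixed index it is a monomial of this multidegree.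
\<close>

definition list_mon :: "(nat \<Rightarrow> 'v) \<Rightarrow> (nat \<Rightarrow> 'v) \<Rightarrow> nat list \<times> nat list \<Rightarrow> 'v \<Rightarrow>\<^sub>0 nat" where
  "list_mon f g = (\<lambda>(xs, ys). (\<Sum>a\<leftarrow>xs. single (f a) 1) + (\<Sum>b\<leftarrow>ys. single (g b) 1))"

lemma prod_qvar_uvar:
  "prod_list (map qvar xs) * prod_list (map uvar ys) = single (list_mon Inl Inr (xs, ys)) 1"
proof -
  have "prod_list (map qvar xs) = single (\<Sum>a\<leftarrow>xs. single (Inl a) 1) 1"
    by (induction xs) (simp_all add: qvar_def mult_single)
  moreover have "prod_list (map uvar ys) = single (\<Sum>b\<leftarrow>ys. single (Inr b) 1) 1"
    by (induction ys) (simp_all add: uvar_def mult_single)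
  ultimately show ?thesis by (simp add: list_mon_def mult_single)
qed

lemma part_row: "part [l] = row l"
  by (auto simp: part_def row_def)

lemma part_column: "part [1, 1] = column 2"
  by (auto simp: part_def column_def numeral_2_eq_2 less_Suc_eq)

lemma super_schur_poly_eq:
  "super_schur_poly k j [l] = (\<Sum>z\<in>list_pairs (\<le>) (<) k j l. single (list_mon Inl Inr z) 1)"
  "super_schur_poly k j [1, 1] = (\<Sum>z\<in>list_pairs (<) (\<le>) k j 2. single (list_mon Inl Inr z) 1)"
  unfolding super_schur_poly_def part_row part_column super_schur_row super_schur_column
  by (simp_all add: prod_qvar_uvar case_prod_unfold)

abbreviation index_mon :: "2 \<Rightarrow> nat list \<times> nat list \<Rightarrow> smon" where
  "index_mon s \<equiv> list_mon (\<lambda>a. Bos a s) (\<lambda>b. Fer b s)"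

lemma lookup_index_mon:
  "lookup (index_mon s (xs, ys)) (Bos a t) = (if t = s then count (mset xs) a else 0)"
  "lookup (index_mon s (xs, ys)) (Fer b t) = (if t = s then count (mset ys) b else 0)"
proof -
  have "lookup (\<Sum>a\<leftarrow>xs. single (Bos a s) (1::nat)) (Bos a t) = (if t = s then count (mset xs) a else 0)"
    "lookup (\<Sum>a\<leftarrow>xs. single (Bos a s) (1::nat)) (Fer b t) = 0"
    by (induction xs) (auto simp: lookup_add lookup_single when_def)
  moreover
  have "lookup (\<Sum>b\<leftarrow>ys. single (Fer b s) (1::nat)) (Fer b t) = (if t = s then count (mset ys) b else 0)"
    "lookup (\<Sum>b\<leftarrow>ys. single (Fer b s) (1::nat)) (Bos a t) = 0"
    by (induction ys) (auto simp: lookup_add lookup_single when_def)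
  ultimately show
    "lookup (index_mon s (xs, ys)) (Bos a t) = (if t = s then count (mset xs) a else 0)"
    "lookup (index_mon s (xs, ys)) (Fer b t) = (if t = s then count (mset ys) b else 0)"
    by (simp_all add: list_mon_def lookup_add)
qed

lemma smon_deg_index_mon: "smon_deg (index_mon s z) = list_mon Inl Inr z"
proof -
  have "smon_deg (\<Sum>a\<leftarrow>xs. single (Bos a s) 1) = (\<Sum>a\<leftarrow>xs. single (Inl a) 1)" for xs
    by (induction xs) (simp_all add: smon_deg_add)
  moreover have "smon_deg (\<Sum>b\<leftarrow>ys. single (Fer b s) 1) = (\<Sum>b\<leftarrow>ys. single (Inr b) 1)" for ys
    by (induction ys) (simp_all add: smon_deg_add)
  ultimately show ?thesis by (cases z) (simp add: list_mon_def smon_deg_add)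
qed

lemma index_count_index_mon:
  "index_count t (index_mon s (xs, ys)) = (if t = s then length xs + length ys else 0)"
proof -
  have "index_count t (\<Sum>a\<leftarrow>xs. single (Bos a s) 1) = (if t = s then length xs else 0)"
    by (induction xs) (simp_all add: index_count_add)
  moreover have "index_count t (\<Sum>b\<leftarrow>ys. single (Fer b s) 1) = (if t = s then length ys else 0)"
    by (induction ys) (simp_all add: index_count_add)
  ultimately show ?thesis by (simp add: list_mon_def index_count_add)
qed

lemma index_mon_in_smonomials:
  assumes "set xs \<subseteq> {..<k}" "set ys \<subseteq> {..<j}" "distinct ys"
  shows "index_mon s (xs, ys) \<in> smonomials k j"
proof -
  have "v \<in> set (svars k j)" if "v \<in> keys (index_mon s (xs, ys))" for v
    using that assms(1,2)
    by (cases v) (auto simp: in_keys_iff lookup_index_mon in_set_svars blocks_def split: if_splits)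
  moreover have "count (mset ys) b \<le> 1" for b
    using assms(3) by (simp add: distinct_count_atmost_1)
  ultimately show ?thesis by (auto simp: smonomials_def lookup_index_mon)
qed

text \<open>
  The exponents of a monomial in variables of one index form a multiset of bosonic pairs and a set of
  fermionic pairs, which are listed uniquely by a weakly and a strictly increasing list.
\<close>

lemma bij_betw_index_mon:
  "bij_betw (index_mon s) (list_pairs (\<le>) (<) k j i) (pure_monomials k j s i)"
proof -
  let ?L = "list_pairs (\<le>) (<) k j i"
  have "inj_on (index_mon s) ?L"
  proof (rule inj_onI)
    fix z z' assume z: "z \<in> ?L" "z' \<in> ?L" and eq: "index_mon s z = index_mon s z'"
    obtain xs ys xs' ys' where zs: "z = (xs, ys)" "z' = (xs', ys')" by (cases z; cases z')
    have "count (mset xs) a = count (mset xs') a" for a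
      using arg_cong[OF eq, of "\<lambda>m. lookup m (Bos a s)"] by (simp add: zs lookup_index_mon)
    then have "mset xs = mset xs'" by (rule multiset_eqI)
    moreover have "count (mset ys) b = count (mset ys') b" for b
      using arg_cong[OF eq, of "\<lambda>m. lookup m (Fer b s)"] by (simp add: zs lookup_index_mon)
    then have "mset ys = mset ys'" by (rule multiset_eqI)
    moreover have "sorted xs" "sorted xs'" "sorted ys" "sorted ys'"
      using z by (auto simp: zs in_list_pairs intro: strict_sorted_imp_sorted)
    ultimately show "z = z'"
      unfolding zs by (metis properties_for_sort)
  qed
  moreover have "index_mon s ` ?L = pure_monomials k j s i"
  proof (intro Set.set_eqI iffI)
    fix m assume "m \<in> index_mon s ` ?L"
    then obtain xs ys where m: "m = index_mon s (xs, ys)" and L: "(xs, ys) \<in> ?L" by auto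
    then show "m \<in> pure_monomials k j s i"
      using index_mon_in_smonomials[of xs k ys j s]
      by (auto simp: pure_monomials_def index_count_index_mon in_list_pairs strict_sorted_iff)
  next
    fix m assume "m \<in> pure_monomials k j s i"
    then have m: "m \<in> smonomials k j" "index_count s m = i" "\<And>t. t \<noteq> s \<Longrightarrow> index_count t m = 0"
      by (auto simp: pure_monomials_def)
    have other: "lookup m v = 0" if "svar_index v \<noteq> s" for v
      using m(3)[OF that] index_count_pos_iff[of "svar_index v" m] by (auto simp: in_keys_iff)
    have out: "lookup m v = 0" if "v \<notin> set (svars k j)" for v
      using m(1) that by (auto simp: smonomials_def in_keys_iff)
    have le1: "lookup m (Fer b s) \<le> 1" for b using m(1) by (simp add: smonomials_def)
    define M where "M = (\<Sum>a<k. replicate_mset (lookup m (Bos a s)) a)"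
    define xs where "xs = sorted_list_of_multiset M"
    define ys where "ys = filter (\<lambda>b. lookup m (Fer b s) = 1) [0..<j]"
    have "count M a = (if a < k then lookup m (Bos a s) else 0)" for a
      by (simp add: M_def count_sum)
    then have cx: "count (mset xs) a = (if a < k then lookup m (Bos a s) else 0)" for a
      by (simp add: xs_def)
    have cy: "count (mset ys) b = (if b < j then lookup m (Fer b s) else 0)" for b
    proof -
      have "distinct ys" by (simp add: ys_def)
      then have "count (mset ys) b = (if b \<in> set ys then 1 else 0)"
        using distinct_count_atmost_1[of ys] by blast
      then show ?thesis using le1[of b] by (auto simp: ys_def)
    qed
    have m_eq: "m = index_mon s (xs, ys)"
    proof (rule poly_mapping_eqI)
      fix v show "lookup m v = lookup (index_mon s (xs, ys)) v"
        using other[of v] out[of v]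
        by (cases v) (auto simp: lookup_index_mon cx cy in_set_svars blocks_def)
    qed
    have "set xs \<subseteq> {..<k}"
    proof
      fix a assume "a \<in> set xs"
      then have "count (mset xs) a \<noteq> 0" by simp
      then show "a \<in> {..<k}" unfolding cx by (simp split: if_splits)
    qed
    moreover have "sorted xs" by (simp add: xs_def)
    moreover have "sorted_wrt (<) ys" "set ys \<subseteq> {..<j}"
      by (auto simp: ys_def sorted_wrt_filter)
    moreover have "length xs + length ys = i"
      using m(2) unfolding m_eq index_count_index_mon by simp
    ultimately have "(xs, ys) \<in> ?L" by (simp add: in_list_pairs)
    then show "m \<in> index_mon s ` ?L" using m_eq by blast
  qed
  ultimately show ?thesis by (simp add: bij_betw_def)
qed

lemma finite_pure_monomials: "finite (pure_monomials k j s i)"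
  using bij_betw_finite[OF bij_betw_index_mon] finite_list_pairs by blast

lemma super_schur_poly_row:
  "super_schur_poly k j [i] = (\<Sum>m\<in>pure_monomials k j s i. single (smon_deg m) 1)"
  unfolding super_schur_poly_eq sum.reindex_bij_betw[OF bij_betw_index_mon, symmetric]
    smon_deg_index_mon ..

text \<open>
  On lists with two entries altogether, where the bosonic entries come first.
\<close>

definition pair_mon :: "nat list \<times> nat list \<Rightarrow> smon" where
  "pair_mon = (\<lambda>(xs, ys). mixed_monomial ((map Inl xs @ map Inr ys) ! 0) ((map Inl xs @ map Inr ys) ! 1))"

lemma list_pairs_2_cases:
  assumes "z \<in> list_pairs (<) (\<le>) k j 2"
  obtains a a' where "z = ([a, a'], [])" "a < a'" "a' < k"
    | a b where "z = ([a], [b])" "a < k" "b < j"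
    | b b' where "z = ([], [b, b'])" "b \<le> b'" "b' < j"
proof -
  obtain xs ys where z: "z = (xs, ys)" by (cases z)
  have h: "sorted_wrt (<) xs" "set xs \<subseteq> {..<k}" "sorted_wrt (\<le>) ys" "set ys \<subseteq> {..<j}"
    "length xs + length ys = 2" using assms by (simp_all add: z in_list_pairs)
  consider "length xs = 2" "length ys = 0" | "length xs = 1" "length ys = 1" | "length xs = 0" "length ys = 2"
    using h(5) by linarith
  then show ?thesis
  proof cases
    case 1
    then obtain a a' where "xs = [a, a']" "ys = []"
      by (auto simp: numeral_2_eq_2 length_Suc_conv)
    then show ?thesis using h that(1)[of a a'] by (simp add: z)
  next
    case 2
    then obtain a b where "xs = [a]" "ys = [b]" by (auto simp: length_Suc_conv)
    then show ?thesis using h that(2)[of a b] by (simp add: z)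
  next
    case 3
    then obtain b b' where "xs = []" "ys = [b, b']"
      by (auto simp: numeral_2_eq_2 length_Suc_conv)
    then show ?thesis using h that(3)[of b b'] by (simp add: z)
  qed
qed

lemma bij_betw_pair_mon:
  "bij_betw pair_mon (list_pairs (<) (\<le>) k j 2) (mixed_monomials k j)"
proof -
  let ?L = "list_pairs (<) (\<le>) k j 2"
  have "inj_on pair_mon ?L"
  proof (rule inj_onI)
    fix z z' assume "z \<in> ?L" "z' \<in> ?L" "pair_mon z = pair_mon z'"
    then show "z = z'"
      by (elim list_pairs_2_cases) (simp_all add: pair_mon_def mixed_monomial_eq_iff)
  qed
  moreover have "pair_mon ` ?L = mixed_monomials k j"
  proof (intro Set.set_eqI iffI)
    fix m assume "m \<in> pair_mon ` ?L"
    then obtain z where m: "m = pair_mon z" and z: "z \<in> ?L" by blast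
    from z show "m \<in> mixed_monomials k j" unfolding m
      by (cases rule: list_pairs_2_cases)
        (auto simp: pair_mon_def mixed_monomial_in_mixed_monomials mixed_monomial_in_smonomials blocks_def)
  next
    fix m assume "m \<in> mixed_monomials k j"
    then obtain \<alpha> \<beta> where m: "m = mixed_monomial \<alpha> \<beta>"
      and ab: "\<alpha> \<in> blocks k j" "\<beta> \<in> blocks k j" "mixes \<alpha> \<beta>"
      by (auto simp: mixed_monomials_def)
    show "m \<in> pair_mon ` ?L"
    proof (cases \<alpha>; cases \<beta>)
      fix a a' assume h: "\<alpha> = Inl a" "\<beta> = Inl a'"
      show ?thesis
        by (rule image_eqI[of _ _ "([a, a'], [])"])
          (use ab in \<open>auto simp: m h pair_mon_def in_list_pairs blocks_def\<close>)
    next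
      fix a b assume h: "\<alpha> = Inl a" "\<beta> = Inr b"
      show ?thesis
        by (rule image_eqI[of _ _ "([a], [b])"])
          (use ab in \<open>auto simp: m h pair_mon_def in_list_pairs blocks_def\<close>)
    next
      fix b a assume h: "\<alpha> = Inr b" "\<beta> = Inl a"
      show ?thesis using ab by (simp add: h)
    next
      fix b b' assume h: "\<alpha> = Inr b" "\<beta> = Inr b'"
      show ?thesis
        by (rule image_eqI[of _ _ "([], [b, b'])"])
          (use ab in \<open>auto simp: m h pair_mon_def in_list_pairs blocks_def\<close>)
    qed
  qed
  ultimately show ?thesis by (simp add: bij_betw_def)
qed

lemma finite_mixed_monomials: "finite (mixed_monomials k j)"
  using bij_betw_finite[OF bij_betw_pair_mon] finite_list_pairs by blast

lemma super_schur_poly_column: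
  "super_schur_poly k j [1, 1] = (\<Sum>m\<in>mixed_monomials k j. single (smon_deg m) 1)"
proof -
  have "smon_deg (pair_mon z) = list_mon Inl Inr z" if "z \<in> list_pairs (<) (\<le>) k j 2" for z
    using that
    by (cases rule: list_pairs_2_cases)
      (simp_all add: pair_mon_def list_mon_def mixed_monomial_def smon_deg_add)
  then show ?thesis
    unfolding super_schur_poly_eq sum.reindex_bij_betw[OF bij_betw_pair_mon, symmetric]
    by (intro sum.cong refl) simp
qed

section \<open>The Hilbert series\<close>

lemma pure_monomials_zero: "pure_monomials k j s 0 = {0}"
proof -
  have "m = 0" if "m \<in> pure_monomials k j s 0" for m
    using that unfolding pure_monomials_def smon_eq_zero_iff by (cases "s = 1"; cases "s = 2") auto
  then show ?thesis by (auto simp: pure_monomials_def)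
qed

lemma finite_basis: "finite (basis n k j)"
  unfolding basis_def by (simp add: finite_pure_monomials finite_mixed_monomials)

lemma sum_basis:
  assumes "n \<ge> 2"
  shows "(\<Sum>m\<in>basis n k j. single (smon_deg m) 1) =
    1 + super_schur_poly k j [1, 1] + super_schur_poly k j [n]
      + 2 * (\<Sum>i = 1..n - 1. super_schur_poly k j [i])"
proof -
  let ?g = "\<lambda>m. single (smon_deg m) (1::int)"
  let ?P = "\<lambda>i. pure_monomials k j 1 i \<union> pure_monomials k j 2 i"
  have "{..<n} = insert 0 {1..n - 1}" using assms by auto
  then have basis: "basis n k j =
      {0} \<union> (mixed_monomials k j \<union> (pure_monomials k j 1 n \<union> (\<Union>i\<in>{1..n - 1}. ?P i)))"
    unfolding basis_def by (auto simp: pure_monomials_zero)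
  have mixed: "index_count 1 m = 1 \<and> index_count 2 m = 1" if "m \<in> mixed_monomials k j" for m
    using that by (auto simp: mixed_monomials_def)
  note fin = finite_pure_monomials finite_mixed_monomials
    finite_pure_monomials[of k j 1, unfolded pure_monomials_12]
    finite_pure_monomials[of k j 2, unfolded pure_monomials_12]
  have "sum ?g (basis n k j) = sum ?g {0} + sum ?g (mixed_monomials k j \<union> (pure_monomials k j 1 n \<union> (\<Union>i\<in>{1..n - 1}. ?P i)))"
    unfolding basis using assms by (intro sum.union_disjoint) (auto simp: fin pure_monomials_12 dest: mixed)
  also have "sum ?g (mixed_monomials k j \<union> (pure_monomials k j 1 n \<union> (\<Union>i\<in>{1..n - 1}. ?P i))) =
      sum ?g (mixed_monomials k j) + sum ?g (pure_monomials k j 1 n \<union> (\<Union>i\<in>{1..n - 1}. ?P i))"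
    by (intro sum.union_disjoint) (auto simp: fin pure_monomials_12 dest: mixed)
  also have "sum ?g (pure_monomials k j 1 n \<union> (\<Union>i\<in>{1..n - 1}. ?P i)) =
      sum ?g (pure_monomials k j 1 n) + sum ?g (\<Union>i\<in>{1..n - 1}. ?P i)"
    using assms by (intro sum.union_disjoint) (auto simp: fin pure_monomials_12)
  also have "sum ?g (\<Union>i\<in>{1..n - 1}. ?P i) = (\<Sum>i = 1..n - 1. sum ?g (?P i))"
    by (intro sum.UNION_disjoint) (auto simp: fin pure_monomials_12)
  also have "\<dots> = (\<Sum>i = 1..n - 1. 2 * super_schur_poly k j [i])"
  proof (rule sum.cong[OF refl])
    fix i assume "i \<in> {1..n - 1}"
    then have "sum ?g (?P i) = sum ?g (pure_monomials k j 1 i) + sum ?g (pure_monomials k j 2 i)"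
      by (intro sum.union_disjoint) (auto simp: fin pure_monomials_12)
    then show "sum ?g (?P i) = 2 * super_schur_poly k j [i]"
      using super_schur_poly_row[of k j i 1] super_schur_poly_row[of k j i 2] by simp
  qed
  finally show ?thesis
    by (simp add: super_schur_poly_column[of k j, simplified] super_schur_poly_row[of k j n 1] sum_distrib_left add.assoc)
qed

lemma lookup_sum_single_card:
  assumes "finite A"
  shows "lookup (\<Sum>m\<in>A. single (h m) (1::int)) d = int (card {m \<in> A. h m = d})"
proof -
  have "lookup (\<Sum>m\<in>A. single (h m) (1::int)) d = (\<Sum>m\<in>A. if h m = d then 1 else 0)"
    unfolding lookup_sum lookup_single when_def by (rule refl)
  also have "\<dots> = (\<Sum>m\<in>{m \<in> A. h m = d}. 1)"
    using assms by (intro sum.inter_filter[symmetric])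
  finally show ?thesis by simp
qed

theorem theorem4p1:
  fixes n k j :: nat
  assumes "n \<ge> 2"
  shows "coinv_hilb (dihedral n) k j =
           Poly_Mapping.lookup
             (1 + super_schur_poly k j [1, 1] + super_schur_poly k j [n]
                + 2 * (\<Sum>i = 1..n - 1. super_schur_poly k j [i]))"
proof
  fix d
  show "coinv_hilb (dihedral n) k j d =
           Poly_Mapping.lookup
             (1 + super_schur_poly k j [1, 1] + super_schur_poly k j [n]
                + 2 * (\<Sum>i = 1..n - 1. super_schur_poly k j [i])) d"
    unfolding sum_basis[OF assms, symmetric] lookup_sum_single_card[OF finite_basis]
    by (rule coinv_hilb_eq_card[OF assms finite_basis])
qed

end
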